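(* Let $\mathbf{k}$ be any field and let $n\ge 3$ be odd. If $g\in G_n(\mathbf{k})$ and $H\subset \mathbb{P}^n_{\mathbf{k}}$ is an irreducible hypersurface, then the discrepancy of $H$ with respect to $g$ is always even.
   Context: The standard involution is $\sigma_n\colon [x_0:\dots:x_n]\dashrightarrow [\frac{1}{x_0}:\dots:\frac{1}{x_n}]$, and $G_n(\mathbf{k})=\langle \sigma_n,\mathrm{Aut}(\mathbb{P}^n_{\mathbf{k}})\rangle$ is a subgroup of the group $\mathrm{Bir}(\mathbb{P}^n_{\mathbf{k}})$ of birational transformations of $\mathbb{P}^n_{\mathbf{k}}$. Definition (discrepancy). Let $\psi\colon X\dashrightarrow Y$ be a birational map between two smooth projective varieties and let $H\subset X$ be an irreducible hypersurface. One can always find a birational morphism $\pi\colon Z\to Y$ such that $Z$ is a smooth projective variety and $\pi^{-1}\psi\colon X\dashrightarrow Z$ restricts to a birational map $H\dashrightarrow E$ for some irreducible hypersurface $E\subset Z$. The discrepancy of $H$ with respect to $\psi$ is the integer defined as the order of vanishing of $K_Z-\pi^{*}(K_Y)$ along $E$ (i.e. the coefficient of $E$ in this relative canonical divisor). It depends only on $\psi$ and $H$, not on $\pi$. *)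

theory Defs
  imports
    "HOL-Library.Poly_Mapping"
    "HOL-Computational_Algebra.Fraction_Field"
    "HOL-Combinatorics.Permutations"
    "HOL-Algebra.QuotRing"
    "HOL-Algebra.Generated_Groups"
begin

section \<open>Polynomials in $x_0, \dots, x_N$\<close>

text \<open>
  Polynomials in countably many indeterminates are finitely supported functions on exponent
  vectors; products are convolution products. The ring $k[x_0,\dots,x_N]$ is carved out by a carrier set, so
  that the number of indeterminates can vary.
\<close>

type_synonym 'k mpol = "(nat \<Rightarrow>\<^sub>0 nat) \<Rightarrow>\<^sub>0 'k"

definition Const :: "'k \<Rightarrow> 'k::field mpol" where
  "Const c = Poly_Mapping.single 0 c"

definition Var :: "nat \<Rightarrow> 'k::field mpol" where
  "Var i = Poly_Mapping.single (Poly_Mapping.single i 1) 1"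

definition polys :: "nat \<Rightarrow> 'k::field mpol set" where
  "polys N = {f. \<forall>m\<in>Poly_Mapping.keys f. Poly_Mapping.keys m \<subseteq> {..N}}"

definition forms :: "nat \<Rightarrow> nat \<Rightarrow> 'k::field mpol set" where
  "forms N d = {f \<in> polys N. \<forall>m\<in>Poly_Mapping.keys f. (\<Sum>i\<le>N. Poly_Mapping.lookup m i) = d}"

definition poly_ring :: "nat \<Rightarrow> 'k::field mpol ring" where
  "poly_ring N = \<lparr>carrier = polys N, monoid.mult = (*), one = 1, zero = 0, add = (+)\<rparr>"

definition subst :: "(nat \<Rightarrow> 'k::field mpol) \<Rightarrow> 'k mpol \<Rightarrow> 'k mpol" where
  "subst F g = (\<Sum>m\<in>Poly_Mapping.keys g.
     Const (Poly_Mapping.lookup g m) * (\<Prod>i\<in>Poly_Mapping.keys m. F i ^ Poly_Mapping.lookup m i))"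

definition partial_deriv :: "nat \<Rightarrow> 'k::field mpol \<Rightarrow> 'k mpol" where
  "partial_deriv j f = (\<Sum>m\<in>Poly_Mapping.keys f.
     Poly_Mapping.single (m - Poly_Mapping.single j 1)
       (of_nat (Poly_Mapping.lookup m j) * Poly_Mapping.lookup f m))"

text \<open>Determinant of the $c \times c$ matrix $(A_{ij})_{i,j<c}$ with entries in a ring given as a record.\<close>

definition ring_det :: "('a, 'b) ring_scheme \<Rightarrow> nat \<Rightarrow> (nat \<Rightarrow> nat \<Rightarrow> 'a) \<Rightarrow> 'a" where
  "ring_det R c A =
     (\<Oplus>\<^bsub>R\<^esub>p\<in>{p. p permutes {..<c}}. [sign p] \<cdot>\<^bsub>R\<^esub> (\<Otimes>\<^bsub>R\<^esub>i\<in>{..<c}. A i (p i)))"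


section \<open>Projective varieties over a field\<close>

text \<open>
  The field $k$ is arbitrary, so points are scheme points: the points of $P^N$ are the homogeneous
  prime ideals of $k[x_0,\dots,x_N]$ that do not contain all of $x_0,\dots,x_N$. A projective variety
  (an integral closed subscheme of $P^N$) is a pair of $N$ and such an ideal, its generic point, and
  its points are the points of $P^N$ containing that ideal. For a point $Q$ of \<open>(N, P)\<close>, the
  closure of $Q$ with its reduced structure is the variety \<open>(N, Q)\<close>.
\<close>

type_synonym 'k proj_var = "nat \<times> 'k mpol set"

definition proj_points :: "nat \<Rightarrow> 'k::field mpol set set" where
  "proj_points N = {Q. primeideal Q (poly_ring N) \<and>
     Q = Idl\<^bsub>poly_ring N\<^esub> (Q \<inter> (\<Union>d. forms N d)) \<and> (\<exists>i\<le>N. Var i \<notin> Q)}"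

definition projective_variety :: "'k::field proj_var \<Rightarrow> bool" where
  "projective_variety V \<longleftrightarrow> snd V \<in> proj_points (fst V)"

definition points :: "'k::field proj_var \<Rightarrow> 'k mpol set set" where
  "points V = {Q \<in> proj_points (fst V). snd V \<subseteq> Q}"

definition proj_space :: "nat \<Rightarrow> 'k::field proj_var" where
  "proj_space n = (n, {0})"

text \<open>An irreducible hypersurface is a closed subvariety of codimension one; it is represented by its generic point.\<close>

definition hypersurfaces :: "'k::field proj_var \<Rightarrow> 'k mpol set set" where
  "hypersurfaces V = {H \<in> points V. H \<noteq> snd V \<and>
     (\<forall>Q\<in>points V. Q \<subseteq> H \<longrightarrow> Q = snd V \<or> Q = H)}"

text \<open>
  Smoothness over $k$ of relative dimension $n$ (Jacobian criterion): around each point, the variety is cut out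
  in $P^N$ by $c = N - n$ forms having a $c \times c$ Jacobian minor that does not vanish
  at that point. By Euler's formula it makes no difference whether one uses the partial derivatives with
  respect to all homogeneous coordinates or to the affine coordinates in a chart.
\<close>

definition smooth_projective :: "nat \<Rightarrow> 'k::field proj_var \<Rightarrow> bool" where
  "smooth_projective n V \<longleftrightarrow> projective_variety V \<and> n \<le> fst V \<and>
     (\<forall>Q\<in>points V. \<exists>f j.
        (\<forall>i < fst V - n. f i \<in> snd V \<and> (\<exists>d. f i \<in> forms (fst V) d) \<and> j i \<le> fst V) \<and>
        ring_det (poly_ring (fst V)) (fst V - n) (\<lambda>i l. partial_deriv (j l) (f i)) \<notin> Q \<and>
        (\<forall>p \<in> snd V. \<exists>s \<in> polys (fst V) - Q.
           s * p \<in> Idl\<^bsub>poly_ring (fst V)\<^esub> (f ` {..< fst V - n})))"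


section \<open>Function fields and local rings\<close>

text \<open>
  \<open>ps_local_ring N Q\<close> is the local ring of $P^N$ at $Q$: fractions of forms of equal degree whose
  denominator is not in $Q$.
\<close>

definition ps_local_ring :: "nat \<Rightarrow> 'k::field mpol set \<Rightarrow> 'k mpol fract ring" where
  "ps_local_ring N Q =
     \<lparr>carrier = {Fract f g | f g d. f \<in> forms N d \<and> g \<in> forms N d \<and> g \<notin> Q},
      monoid.mult = (*), one = 1, zero = 0, add = (+)\<rparr>"

definition ps_local_max :: "nat \<Rightarrow> 'k::field mpol set \<Rightarrow> 'k mpol fract set" where
  "ps_local_max N Q = {Fract f g | f g d. f \<in> forms N d \<and> g \<in> forms N d \<and> g \<notin> Q \<and> f \<in> Q}"

text \<open>The function field is the residue field of $P^N$ at the generic point of the variety.\<close>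

definition function_field :: "'k::field proj_var \<Rightarrow> 'k mpol fract set ring" where
  "function_field V = ps_local_ring (fst V) (snd V) Quot ps_local_max (fst V) (snd V)"

definition rat_fun :: "'k::field proj_var \<Rightarrow> 'k mpol fract \<Rightarrow> 'k mpol fract set" where
  "rat_fun V a = ps_local_max (fst V) (snd V) +>\<^bsub>ps_local_ring (fst V) (snd V)\<^esub> a"

text \<open>The local ring of a variety at one of its points and its maximal ideal, as subsets of the function field.\<close>

definition stalk :: "'k::field proj_var \<Rightarrow> 'k mpol set \<Rightarrow> 'k mpol fract set set" where
  "stalk V Q = rat_fun V ` carrier (ps_local_ring (fst V) Q)"

definition stalk_max :: "'k::field proj_var \<Rightarrow> 'k mpol set \<Rightarrow> 'k mpol fract set set" where
  "stalk_max V Q = rat_fun V ` ps_local_max (fst V) Q"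

text \<open>
  \<open>has_order V E h m\<close>: the rational function $h$ vanishes to order $m$ along the hypersurface $E$,
  i.e.\ $h = u t^m$ with $u$ a unit of the local ring at $E$ and $t$ a generator of its maximal ideal.
\<close>

definition has_order ::
  "'k::field proj_var \<Rightarrow> 'k mpol set \<Rightarrow> 'k mpol fract set \<Rightarrow> int \<Rightarrow> bool" where
  "has_order V E h m \<longleftrightarrow> (let K = function_field V in
     \<exists>t\<in>stalk V E. \<exists>u \<in> stalk V E - stalk_max V E.
       t \<noteq> \<zero>\<^bsub>K\<^esub> \<and> stalk_max V E = (\<lambda>a. a \<otimes>\<^bsub>K\<^esub> t) ` stalk V E \<and>
       h = u \<otimes>\<^bsub>K\<^esub> t [^]\<^bsub>K\<^esub> m)"


section \<open>Rational maps\<close>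

text \<open>
  A rational map $V \dashrightarrow W \subseteq P^M$ is represented by forms $F_0,\dots,F_M$ of the
  same degree, not all vanishing identically on $V$; the entries \<open>F i\<close> with \<open>i > M\<close> are irrelevant.
\<close>

definition rational_map :: "'k::field proj_var \<Rightarrow> 'k proj_var \<Rightarrow> (nat \<Rightarrow> 'k mpol) \<Rightarrow> bool" where
  "rational_map V W F \<longleftrightarrow>
     (\<exists>d. \<forall>i\<le>fst W. F i \<in> forms (fst V) d) \<and> (\<exists>i\<le>fst W. F i \<notin> snd V) \<and>
     (\<forall>g\<in>snd W. subst F g \<in> snd V)"

definition same_map ::
  "'k::field proj_var \<Rightarrow> 'k proj_var \<Rightarrow> (nat \<Rightarrow> 'k mpol) \<Rightarrow> (nat \<Rightarrow> 'k mpol) \<Rightarrow> bool" where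
  "same_map V W F F' \<longleftrightarrow> rational_map V W F \<and> rational_map V W F' \<and>
     (\<forall>i\<le>fst W. \<forall>j\<le>fst W. F i * F' j - F j * F' i \<in> snd V)"

definition map_class ::
  "'k::field proj_var \<Rightarrow> 'k proj_var \<Rightarrow> (nat \<Rightarrow> 'k mpol) \<Rightarrow> (nat \<Rightarrow> 'k mpol) set" where
  "map_class V W F = {F'. same_map V W F F'}"

text \<open>\<open>comp_map G F\<close> is \<open>G\<close> after \<open>F\<close>.\<close>

definition comp_map :: "(nat \<Rightarrow> 'k::field mpol) \<Rightarrow> (nat \<Rightarrow> 'k mpol) \<Rightarrow> nat \<Rightarrow> 'k mpol" where
  "comp_map G F = (\<lambda>i. subst F (G i))"

definition inverse_maps ::
  "'k::field proj_var \<Rightarrow> 'k proj_var \<Rightarrow> (nat \<Rightarrow> 'k mpol) \<Rightarrow> (nat \<Rightarrow> 'k mpol) \<Rightarrow> bool" where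
  "inverse_maps V W F G \<longleftrightarrow> rational_map V W F \<and> rational_map W V G \<and>
     same_map V V (comp_map G F) Var \<and> same_map W W (comp_map F G) Var"

definition birational_map :: "'k::field proj_var \<Rightarrow> 'k proj_var \<Rightarrow> (nat \<Rightarrow> 'k mpol) \<Rightarrow> bool" where
  "birational_map V W F \<longleftrightarrow> (\<exists>G. inverse_maps V W F G)"

definition morphism :: "'k::field proj_var \<Rightarrow> 'k proj_var \<Rightarrow> (nat \<Rightarrow> 'k mpol) \<Rightarrow> bool" where
  "morphism V W F \<longleftrightarrow> rational_map V W F \<and>
     (\<forall>Q\<in>points V. \<exists>F'. same_map V W F F' \<and> (\<exists>i\<le>fst W. F' i \<notin> Q))"

text \<open>\<open>image_point V W F Q Q'\<close>: the rational map $F$ is defined at the point $Q$ and maps it to $Q'$.\<close>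

definition image_point ::
  "'k::field proj_var \<Rightarrow> 'k proj_var \<Rightarrow> (nat \<Rightarrow> 'k mpol) \<Rightarrow> 'k mpol set \<Rightarrow> 'k mpol set \<Rightarrow> bool" where
  "image_point V W F Q Q' \<longleftrightarrow> Q \<in> points V \<and> Q' \<in> points W \<and>
     (\<exists>F'. same_map V W F F' \<and> (\<exists>i\<le>fst W. F' i \<notin> Q) \<and>
        (\<forall>d. \<forall>g\<in>forms (fst W) d. g \<in> Q' \<longleftrightarrow> subst F' g \<in> Q))"

text \<open>Pullback $K(W) \to K(V)$ of rational functions along a dominant rational map.\<close>

definition pullback ::
  "'k::field proj_var \<Rightarrow> 'k proj_var \<Rightarrow> (nat \<Rightarrow> 'k mpol) \<Rightarrow> 'k mpol fract set \<Rightarrow> 'k mpol fract set" where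
  "pullback V W F x = (THE y. \<exists>d. \<exists>f\<in>forms (fst W) d. \<exists>g\<in>forms (fst W) d - snd W.
     x = rat_fun W (Fract f g) \<and> y = rat_fun V (Fract (subst F f) (subst F g)))"


section \<open>The canonical sheaf\<close>

text \<open>
  On a variety that is smooth of dimension $n$, rational $n$-forms are identified with alternating
  $n$-linear functions on the $k$-derivations of the function field $K$, so that
  $g\, da_0 \wedge \dots \wedge da_{n-1}$ becomes $D \mapsto g \det (D_i(a_j))$.
\<close>

definition derivations ::
  "'k::field proj_var \<Rightarrow> ('k mpol fract set \<Rightarrow> 'k mpol fract set) set" where
  "derivations V = (let K = function_field V in
     {D \<in> carrier K \<rightarrow>\<^sub>E carrier K.
        (\<forall>a\<in>carrier K. \<forall>b\<in>carrier K. D (a \<oplus>\<^bsub>K\<^esub> b) = D a \<oplus>\<^bsub>K\<^esub> D b) \<and>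
        (\<forall>a\<in>carrier K. \<forall>b\<in>carrier K.
           D (a \<otimes>\<^bsub>K\<^esub> b) = (D a \<otimes>\<^bsub>K\<^esub> b) \<oplus>\<^bsub>K\<^esub> (a \<otimes>\<^bsub>K\<^esub> D b)) \<and>
        (\<forall>c. D (rat_fun V (Fract (Const c) 1)) = \<zero>\<^bsub>K\<^esub>)})"

type_synonym 'k dform = "(nat \<Rightarrow> 'k mpol fract set \<Rightarrow> 'k mpol fract set) \<Rightarrow> 'k mpol fract set"

definition dform ::
  "nat \<Rightarrow> 'k::field proj_var \<Rightarrow> 'k mpol fract set \<Rightarrow> (nat \<Rightarrow> 'k mpol fract set) \<Rightarrow> 'k dform" where
  "dform n V g a = (\<lambda>D \<in> {..<n} \<rightarrow>\<^sub>E derivations V.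
     g \<otimes>\<^bsub>function_field V\<^esub> ring_det (function_field V) n (\<lambda>i j. D i (a j)))"

definition dform_add ::
  "nat \<Rightarrow> 'k::field proj_var \<Rightarrow> 'k dform \<Rightarrow> 'k dform \<Rightarrow> 'k dform" where
  "dform_add n V \<omega> \<omega>' = (\<lambda>D \<in> {..<n} \<rightarrow>\<^sub>E derivations V. \<omega> D \<oplus>\<^bsub>function_field V\<^esub> \<omega>' D)"

definition dform_smult ::
  "nat \<Rightarrow> 'k::field proj_var \<Rightarrow> 'k mpol fract set \<Rightarrow> 'k dform \<Rightarrow> 'k dform" where
  "dform_smult n V h \<omega> = (\<lambda>D \<in> {..<n} \<rightarrow>\<^sub>E derivations V. h \<otimes>\<^bsub>function_field V\<^esub> \<omega> D)"

definition dform_zero :: "nat \<Rightarrow> 'k::field proj_var \<Rightarrow> 'k dform" where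
  "dform_zero n V = (\<lambda>D \<in> {..<n} \<rightarrow>\<^sub>E derivations V. \<zero>\<^bsub>function_field V\<^esub>)"

text \<open>The stalk at $Q$ of the canonical sheaf, as a submodule of the space of rational $n$-forms.\<close>

inductive_set canonical_stalk :: "nat \<Rightarrow> 'k::field proj_var \<Rightarrow> 'k mpol set \<Rightarrow> 'k dform set"
  for n V Q where
    wedge: "\<lbrakk>g \<in> stalk V Q; \<And>i. i < n \<Longrightarrow> a i \<in> stalk V Q\<rbrakk> \<Longrightarrow> dform n V g a \<in> canonical_stalk n V Q"
  | add: "\<lbrakk>\<omega> \<in> canonical_stalk n V Q; \<omega>' \<in> canonical_stalk n V Q\<rbrakk>
      \<Longrightarrow> dform_add n V \<omega> \<omega>' \<in> canonical_stalk n V Q"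

text \<open>\<open>local_equation n V Q \<eta> h\<close>: the divisor of the rational $n$-form \<open>\<eta>\<close> has local equation $h$ at $Q$.\<close>

definition local_equation ::
  "nat \<Rightarrow> 'k::field proj_var \<Rightarrow> 'k mpol set \<Rightarrow> 'k dform \<Rightarrow> 'k mpol fract set \<Rightarrow> bool" where
  "local_equation n V Q \<eta> h \<longleftrightarrow> h \<in> carrier (function_field V) \<and>
     (\<exists>\<omega>. \<omega> \<noteq> dform_zero n V \<and>
        canonical_stalk n V Q = (\<lambda>a. dform_smult n V a \<omega>) ` stalk V Q \<and>
        \<eta> = dform_smult n V h \<omega>)"


section \<open>Discrepancies\<close>

text \<open>
  For a birational morphism \<open>\<pi> : Z \<rightarrow> Y\<close> of smooth projective varieties of dimension $n$ and a
  hypersurface $E$ of $Z$, \<open>relative_canonical_coeff n Z Y \<pi> E m\<close> says that $m$ is the coefficient of $E$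
  in $K_Z - \pi^* K_Y$. Here $K_Y = div(\eta)$ for a nonzero rational $n$-form
  $\eta = g\, da_0 \wedge \dots \wedge da_{n-1}$ on $Y$ and $K_Z = div(\pi^*\eta)$; the relative canonical
  divisor requires these compatible choices and does not depend on $\eta$. The
  multiplicity of the pulled back Cartier divisor $\pi^* div(\eta)$ along $E$ is the order of the pullback of a
  local equation of $div(\eta)$ at the image of the generic point of $E$.
\<close>

definition relative_canonical_coeff ::
  "nat \<Rightarrow> 'k::field proj_var \<Rightarrow> 'k proj_var \<Rightarrow> (nat \<Rightarrow> 'k mpol) \<Rightarrow> 'k mpol set \<Rightarrow> int \<Rightarrow> bool" where
  "relative_canonical_coeff n Z Y \<pi> E m \<longleftrightarrow>
     (\<exists>g a hZ hY Q k l.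
        g \<in> carrier (function_field Y) \<and> (\<forall>i<n. a i \<in> carrier (function_field Y)) \<and>
        dform n Y g a \<noteq> dform_zero n Y \<and>
        local_equation n Z E (dform n Z (pullback Z Y \<pi> g) (\<lambda>i. pullback Z Y \<pi> (a i))) hZ \<and>
        has_order Z E hZ k \<and>
        image_point Z Y \<pi> E Q \<and> local_equation n Y Q (dform n Y g a) hY \<and>
        has_order Z E (pullback Z Y \<pi> hY) l \<and>
        m = k - l)"

text \<open>
  \<open>has_discrepancy n X Y \<phi> H m\<close>: some \<open>\<pi> : Z \<rightarrow> Y\<close> as required computes $m$ as the discrepancy of
  the hypersurface $H$ of $X$ with respect to the birational map \<open>\<phi> : X \<dashrightarrow> Y\<close>, an
  equivalence class of tuples of forms. $F$ represents $\pi^{-1} \phi$ and restricts to a birational map from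
  $H$ to $E$.
\<close>

definition has_discrepancy ::
  "nat \<Rightarrow> 'k::field proj_var \<Rightarrow> 'k proj_var \<Rightarrow> (nat \<Rightarrow> 'k mpol) set \<Rightarrow> 'k mpol set \<Rightarrow> int \<Rightarrow> bool" where
  "has_discrepancy n X Y \<phi> H m \<longleftrightarrow>
     (\<exists>\<psi>\<in>\<phi>. \<exists>Z \<pi> \<rho> E F.
        smooth_projective n Z \<and> morphism Z Y \<pi> \<and> inverse_maps Z Y \<pi> \<rho> \<and>
        E \<in> hypersurfaces Z \<and>
        same_map X Z F (comp_map \<rho> \<psi>) \<and> birational_map (fst X, H) (fst Z, E) F \<and>
        relative_canonical_coeff n Z Y \<pi> E m)"


section \<open>The group $G_n(k)$\<close>

definition Bir :: "'k::field proj_var \<Rightarrow> (nat \<Rightarrow> 'k mpol) set monoid" where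
  "Bir V = \<lparr>carrier = {map_class V V F | F. birational_map V V F},
     monoid.mult = (\<lambda>A B. \<Union>G\<in>A. \<Union>F\<in>B. map_class V V (comp_map G F)),
     one = map_class V V Var\<rparr>"

definition Aut :: "'k::field proj_var \<Rightarrow> (nat \<Rightarrow> 'k mpol) set set" where
  "Aut V = {map_class V V F | F. \<exists>G. inverse_maps V V F G \<and> morphism V V F \<and> morphism V V G}"

text \<open>The standard involution, $[1/x_0 : \dots : 1/x_n]$ with denominators cleared.\<close>

definition std_involution :: "nat \<Rightarrow> nat \<Rightarrow> 'k::field mpol" where
  "std_involution n i = (\<Prod>j\<in>{..n} - {i}. Var j)"

definition Gn :: "nat \<Rightarrow> (nat \<Rightarrow> 'k::field mpol) set set" where
  "Gn n = generate (Bir (proj_space n))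
     (insert (map_class (proj_space n) (proj_space n) (std_involution n)) (Aut (proj_space n)))"

end

theory Submission
  imports
    Defs
    "Jordan_Normal_Form.Determinant"
    "HOL-Computational_Algebra.Polynomial_Factorial"
begin

text \<open>
  Let $K = k(P^n)$. For functions $z_0, \dots, z_n \in K$ let $W(z)$ be the rational $n$-form that sends
  derivations $D_1, \dots, D_n$ to the determinant with rows $(z_j)_j, (D_1 z_j)_j, \dots, (D_n z_j)_j$
  (\<open>wronsk\<close>). By \<open>wronsk_scale\<close>,
  $W(l z) = l^{n+1} W(z)$; this reflects the isomorphism between the
  canonical sheaf of $P^n$ and $O(-n-1)$. Where $x_i$ does not vanish, the canonical stalk is generated by
  $W(x/x_i)$, and changing $i$ multiplies this generator by the power of exponent $n+1$ of a function.
  For odd $n$ this is a square: locally, the canonical sheaf has a generator that is globally well defined up to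
  units and squares.

  The birational maps $\psi$ for which $\psi^* W(x/x_0) = c h^2 W(x/x_0)$ with a constant $c$
  and $h \in K$ (\<open>square_jac\<close>) are closed under composition, and both kinds of generators of $G_n(k)$ are
  among them. For the involution, $W(1/z) = (-1)^n (\prod_j z_j)^{-2} W(z)$ by \<open>wronsk_inverse\<close>.
  An automorphism maps local generators to local generators, so its
  multiplier is a unit times a square at every point of $P^n$ (\<open>aut_local\<close>). A rational function with this property
  has even order along every hypersurface, hence is a constant times a square because polynomials over a field
  factor uniquely; \<open>loc_square_form_imp_square\<close> is the version of this used here.

  Now let $F$ be the birational map from $P^n$ to $Z$ with $\psi = \pi F$ that maps $H$ birationally to $E$.
  Pulling back along $F$ identifies $k(Z)$ with $K$. The ring at $H$ dominates the image of the ring at $E$, which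
  is a discrete valuation ring (\<open>hypersurface_dvr\<close>), so the two agree (\<open>dominating_eq\<close>).
  Let $Q = \pi(E)$, and suppose $x_i$ does not vanish at $Q$ and $x_j$ does not vanish at $H$. A form $\eta$ on
  $P^n$ is $h_Y W(x/x_i)$ up to a unit at $Q$, and the same form pulled back to $Z$ is
  $h_Z W(x/x_j)$ up to a unit at $H$ (\<open>local_equation_wronsk\<close>). Comparing them through $\psi$
  shows that $h_Z$ is $\psi^* h_Y$ times a unit and a square in $K$. Hence the orders of $h_Z$ and of $\psi^* h_Y$
  along $E$, whose difference is the discrepancy, have the same parity.
\<close>

section \<open>Polynomials and substitution\<close>

definition monom_val :: "(nat \<Rightarrow> 'r::comm_ring_1) \<Rightarrow> (nat \<Rightarrow>\<^sub>0 nat) \<Rightarrow> 'r" where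
  "monom_val v m = (\<Prod>i\<in>Poly_Mapping.keys m. v i ^ Poly_Mapping.lookup m i)"

text \<open>
  Evaluation with an arbitrary coefficient homomorphism \<open>\<alpha>\<close> into an arbitrary ring covers
  substitution of polynomials, regrading by an auxiliary variable and regarding one of the variables as
  the variable of a univariate polynomial; all three inherit their homomorphism laws from it.
\<close>

definition mpeval :: "('k::field \<Rightarrow> 'r::comm_ring_1) \<Rightarrow> (nat \<Rightarrow> 'r) \<Rightarrow> 'k mpol \<Rightarrow> 'r" where
  "mpeval \<alpha> v f = (\<Sum>m\<in>Poly_Mapping.keys f. \<alpha> (Poly_Mapping.lookup f m) * monom_val v m)"

lemma monom_val_superset:
  assumes "finite S" "Poly_Mapping.keys m \<subseteq> S"
  shows "monom_val v m = (\<Prod>i\<in>S. v i ^ Poly_Mapping.lookup m i)"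
  unfolding monom_val_def
  by (rule prod.mono_neutral_left) (use assms in \<open>auto simp: in_keys_iff\<close>)

lemma monom_val_0 [simp]: "monom_val v 0 = 1"
  by (simp add: monom_val_def)

lemma monom_val_add: "monom_val v (m + m') = monom_val v m * monom_val v m'"
proof -
  let ?S = "Poly_Mapping.keys m \<union> Poly_Mapping.keys m'"
  have "Poly_Mapping.keys (m + m') \<subseteq> ?S" by (rule Poly_Mapping.keys_add)
  then show ?thesis
    by (simp add: monom_val_superset[of ?S] lookup_add power_add prod.distrib)
qed

lemma monom_val_single [simp]: "monom_val v (Poly_Mapping.single i d) = v i ^ d"
  by (simp add: monom_val_def)

lemma mpol_eq_sum_single:
  "f = (\<Sum>m\<in>Poly_Mapping.keys f. Poly_Mapping.single m (Poly_Mapping.lookup f m))"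
proof (rule poly_mapping_eqI)
  fix k
  have "(\<Sum>m\<in>Poly_Mapping.keys f. Poly_Mapping.lookup (Poly_Mapping.single m (Poly_Mapping.lookup f m)) k)
      = (\<Sum>m\<in>Poly_Mapping.keys f. if m = k then Poly_Mapping.lookup f m else 0)"
    by (rule sum.cong) (auto simp: lookup_single when_def)
  also have "\<dots> = Poly_Mapping.lookup f k"
    by (auto simp: in_keys_iff)
  finally show "Poly_Mapping.lookup f k = Poly_Mapping.lookup
      (\<Sum>m\<in>Poly_Mapping.keys f. Poly_Mapping.single m (Poly_Mapping.lookup f m)) k"
    by (simp add: lookup_sum)
qed

lemma Const_0 [simp]: "Const 0 = 0" and Const_1 [simp]: "Const 1 = 1"
  by (simp_all add: Const_def)

lemma Const_add: "Const (a + b) = Const a + Const b"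
  by (simp add: Const_def single_add)

lemma Const_mult: "Const (a * b) = Const a * Const b"
  by (simp add: Const_def mult_single)

lemma Const_eq_0_iff [simp]: "Const a = 0 \<longleftrightarrow> a = 0"
  by (metis Const_0 Const_def inj_single injD)

lemma Var_power: "Var i ^ d = Poly_Mapping.single (Poly_Mapping.single i d) 1"
  by (induction d) (simp_all add: Var_def mult_single flip: single_add)

lemma monom_val_Var: "monom_val Var m = Poly_Mapping.single m 1"
proof -
  have fin: "finite (Poly_Mapping.keys m)" by simp
  have "(\<Prod>i\<in>S. Poly_Mapping.single (Poly_Mapping.single i (Poly_Mapping.lookup m i)) (1::'k::field)) =
      Poly_Mapping.single (\<Sum>i\<in>S. Poly_Mapping.single i (Poly_Mapping.lookup m i)) 1" if "finite S" for S
    using that by induction (simp_all add: mult_single)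
  from this[OF fin] have *: "(\<Prod>i\<in>Poly_Mapping.keys m. Poly_Mapping.single (Poly_Mapping.single i (Poly_Mapping.lookup m i)) (1::'k::field)) =
      Poly_Mapping.single (\<Sum>i\<in>Poly_Mapping.keys m. Poly_Mapping.single i (Poly_Mapping.lookup m i)) 1" .
  have "(\<Sum>i\<in>Poly_Mapping.keys m. Poly_Mapping.single i (Poly_Mapping.lookup m i)) = m"
  proof (rule poly_mapping_eqI)
    fix k
    have "(\<Sum>i\<in>Poly_Mapping.keys m. Poly_Mapping.lookup (Poly_Mapping.single i (Poly_Mapping.lookup m i)) k)
      = (\<Sum>i\<in>Poly_Mapping.keys m. if i = k then Poly_Mapping.lookup m i else 0)"
      by (rule sum.cong) (auto simp: lookup_single when_def)
    also have "\<dots> = Poly_Mapping.lookup m k"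
      by (auto simp: in_keys_iff)
    finally show "Poly_Mapping.lookup (\<Sum>i\<in>Poly_Mapping.keys m. Poly_Mapping.single i (Poly_Mapping.lookup m i)) k = Poly_Mapping.lookup m k"
      by (simp add: lookup_sum)
  qed
  with * show ?thesis by (simp add: monom_val_def Var_power)
qed

lemma single_eq_Const_monom: "Poly_Mapping.single m c = Const c * monom_val Var m"
  by (simp add: monom_val_Var Const_def mult_single)

lemma mpol_eq_sum_monom:
  "f = (\<Sum>m\<in>Poly_Mapping.keys f. Const (Poly_Mapping.lookup f m) * monom_val Var m)"
  by (subst mpol_eq_sum_single) (simp add: single_eq_Const_monom)

locale coeff_hom =
  fixes \<alpha> :: "'k::field \<Rightarrow> 'r::comm_ring_1"
  assumes hom_0: "\<alpha> 0 = 0" and hom_1: "\<alpha> 1 = 1"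
    and hom_add: "\<alpha> (a + b) = \<alpha> a + \<alpha> b" and hom_mult: "\<alpha> (a * b) = \<alpha> a * \<alpha> b"
begin

lemma mpeval_superset:
  assumes "finite S" "Poly_Mapping.keys f \<subseteq> S"
  shows "mpeval \<alpha> v f = (\<Sum>m\<in>S. \<alpha> (Poly_Mapping.lookup f m) * monom_val v m)"
  unfolding mpeval_def
  by (rule sum.mono_neutral_left) (use assms in \<open>auto simp: in_keys_iff hom_0\<close>)

lemma mpeval_0 [simp]: "mpeval \<alpha> v 0 = 0"
  by (simp add: mpeval_def)

lemma mpeval_add: "mpeval \<alpha> v (f + g) = mpeval \<alpha> v f + mpeval \<alpha> v g"
proof -
  let ?S = "Poly_Mapping.keys f \<union> Poly_Mapping.keys g"
  have "Poly_Mapping.keys (f + g) \<subseteq> ?S" by (rule Poly_Mapping.keys_add)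
  then show ?thesis
    by (simp add: mpeval_superset[of ?S] lookup_add hom_add algebra_simps sum.distrib)
qed

lemma mpeval_sum: "mpeval \<alpha> v (sum F S) = (\<Sum>i\<in>S. mpeval \<alpha> v (F i))"
  by (induction S rule: infinite_finite_induct) (simp_all add: mpeval_add)

lemma mpeval_single: "mpeval \<alpha> v (Poly_Mapping.single m c) = \<alpha> c * monom_val v m"
  by (subst mpeval_superset[of "{m}"]) simp_all

lemma mpeval_mult: "mpeval \<alpha> v (f * g) = mpeval \<alpha> v f * mpeval \<alpha> v g"
proof -
  have "f * g = (\<Sum>m\<in>Poly_Mapping.keys f. \<Sum>m'\<in>Poly_Mapping.keys g.
     Poly_Mapping.single (m + m') (Poly_Mapping.lookup f m * Poly_Mapping.lookup g m'))"
    by (subst (1) mpol_eq_sum_single[of f], subst (1) mpol_eq_sum_single[of g])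
       (simp add: sum_product mult_single)
  then have "mpeval \<alpha> v (f * g) = (\<Sum>m\<in>Poly_Mapping.keys f. \<Sum>m'\<in>Poly_Mapping.keys g.
     (\<alpha> (Poly_Mapping.lookup f m) * monom_val v m) * (\<alpha> (Poly_Mapping.lookup g m') * monom_val v m'))"
    by (simp add: mpeval_sum mpeval_single hom_mult monom_val_add mult_ac)
  also have "\<dots> = mpeval \<alpha> v f * mpeval \<alpha> v g"
    by (simp add: mpeval_def sum_product)
  finally show ?thesis .
qed

lemma mpeval_1 [simp]: "mpeval \<alpha> v 1 = 1"
  using mpeval_single[of v 0 1] by (simp add: hom_1)

lemma mpeval_Const [simp]: "mpeval \<alpha> v (Const c) = \<alpha> c"
  by (simp add: Const_def mpeval_single)

lemma mpeval_Var [simp]: "mpeval \<alpha> v (Var i) = v i"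
  by (simp add: Var_def mpeval_single hom_1)

lemma mpeval_uminus: "mpeval \<alpha> v (- f) = - mpeval \<alpha> v f"
  using mpeval_add[of v f "- f"] by (simp add: eq_neg_iff_add_eq_0 add.commute)

lemma mpeval_diff: "mpeval \<alpha> v (f - g) = mpeval \<alpha> v f - mpeval \<alpha> v g"
  using mpeval_add[of v f "- g"] by (simp add: mpeval_uminus)

lemma mpeval_power: "mpeval \<alpha> v (f ^ d) = mpeval \<alpha> v f ^ d"
  by (induction d) (simp_all add: mpeval_mult)

lemma mpeval_prod: "mpeval \<alpha> v (prod F S) = (\<Prod>i\<in>S. mpeval \<alpha> v (F i))"
  by (induction S rule: infinite_finite_induct) (simp_all add: mpeval_mult)

end

text \<open>
  Two homomorphisms that agree on constants and variables are equal; identities such as the associativity of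
  substitution follow by comparing both sides with one evaluation.
\<close>

lemma mpol_hom_eq_mpeval:
  fixes \<Phi> :: "'k::field mpol \<Rightarrow> 'r::comm_ring_1"
  assumes add: "\<And>f g. \<Phi> (f + g) = \<Phi> f + \<Phi> g" and mult: "\<And>f g. \<Phi> (f * g) = \<Phi> f * \<Phi> g"
    and one: "\<Phi> 1 = 1"
  shows "\<Phi> f = mpeval (\<lambda>c. \<Phi> (Const c)) (\<lambda>i. \<Phi> (Var i)) f"
proof -
  have z: "\<Phi> 0 = 0" using add[of 0 0] by simp
  have sum: "\<Phi> (sum F S) = (\<Sum>i\<in>S. \<Phi> (F i))" for F and S :: "(nat \<Rightarrow>\<^sub>0 nat) set"
    by (induction S rule: infinite_finite_induct) (simp_all add: add z)
  have pow: "\<Phi> (g ^ d) = \<Phi> g ^ d" for g d by (induction d) (simp_all add: one mult)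
  have prod: "\<Phi> (prod F S) = (\<Prod>i\<in>S. \<Phi> (F i))" for F and S :: "nat set"
    by (induction S rule: infinite_finite_induct) (simp_all add: mult one)
  show ?thesis
    by (subst mpol_eq_sum_monom) (simp add: sum mult monom_val_def prod pow mpeval_def)
qed

global_interpretation subst: coeff_hom Const
  rewrites "mpeval Const = subst"
proof -
  show "coeff_hom Const" by unfold_locales (simp_all add: Const_add Const_mult)
  show "mpeval Const = subst" by (intro ext) (simp add: mpeval_def subst_def monom_val_def)
qed

lemma subst_subst: "subst G (subst F g) = subst (\<lambda>i. subst G (F i)) g"
  using mpol_hom_eq_mpeval[of "\<lambda>f. subst G (subst F f)" g]
  by (simp add: subst.mpeval_add subst.mpeval_mult) (simp add: subst_def mpeval_def monom_val_def)

lemma subst_Var_id [simp]: "subst Var g = g"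
  using mpol_hom_eq_mpeval[of "\<lambda>f::'a mpol. f" g] by (simp add: subst_def mpeval_def monom_val_def)

lemma Const_in_polys [simp]: "Const c \<in> polys N"
  by (auto simp: polys_def Const_def)

lemma zero_in_polys [simp]: "0 \<in> polys N" and one_in_polys [simp]: "1 \<in> polys N"
  by (auto simp: polys_def)

lemma Var_in_polys [simp]: "i \<le> N \<Longrightarrow> Var i \<in> polys N"
  by (auto simp: polys_def Var_def)

lemma polys_add: "f \<in> polys N \<Longrightarrow> g \<in> polys N \<Longrightarrow> f + g \<in> polys N"
  using Poly_Mapping.keys_add[of f g] by (fastforce simp: polys_def)

lemma polys_mult: "f \<in> polys N \<Longrightarrow> g \<in> polys N \<Longrightarrow> f * g \<in> polys N"
proof -
  assume a: "f \<in> polys N" "g \<in> polys N"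
  have "Poly_Mapping.keys m \<subseteq> {..N}" if m: "m \<in> Poly_Mapping.keys (f * g)" for m
  proof -
    from m Poly_Mapping.keys_mult[of f g] obtain m1 m2 where m12: "m = m1 + m2"
      "m1 \<in> Poly_Mapping.keys f" "m2 \<in> Poly_Mapping.keys g" by blast
    then have "Poly_Mapping.keys m1 \<subseteq> {..N}" "Poly_Mapping.keys m2 \<subseteq> {..N}" using a by (auto simp: polys_def)
    then show ?thesis unfolding m12(1) using Poly_Mapping.keys_add[of m1 m2] by blast
  qed
  then show ?thesis by (auto simp: polys_def)
qed

lemma polys_uminus [simp]: "- f \<in> polys N \<longleftrightarrow> f \<in> polys N"
  by (auto simp: polys_def in_keys_iff)

lemma polys_diff: "f \<in> polys N \<Longrightarrow> g \<in> polys N \<Longrightarrow> f - g \<in> polys N"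
  using polys_add[of f N "- g"] by simp

lemma polys_prod: "(\<And>i. i \<in> S \<Longrightarrow> F i \<in> polys N) \<Longrightarrow> prod F S \<in> polys N"
  by (induction S rule: infinite_finite_induct) (simp_all add: polys_mult)

lemma polys_power: "f \<in> polys N \<Longrightarrow> f ^ d \<in> polys N"
  by (induction d) (simp_all add: polys_mult)

lemma ex_polys: "\<exists>N. f \<in> polys N"
proof -
  let ?S = "\<Union>m\<in>Poly_Mapping.keys f. Poly_Mapping.keys m"
  have "finite ?S" by simp
  then obtain N where "\<forall>i\<in>?S. i \<le> N" using finite_nat_set_iff_bounded_le by auto
  then have "f \<in> polys N" by (auto simp: polys_def)
  then show ?thesis ..
qed

lemma forms_polys: "f \<in> forms N d \<Longrightarrow> f \<in> polys N"
  by (simp add: forms_def)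

lemma forms_0 [simp]: "0 \<in> forms N d"
  by (auto simp: forms_def)

lemma Const_forms [simp]: "Const c \<in> forms N 0"
  by (auto simp: forms_def Const_def polys_def)

lemma one_forms [simp]: "1 \<in> forms N 0"
  using Const_forms[of 1] by (simp del: Const_forms)

lemma Var_forms [simp]: "i \<le> N \<Longrightarrow> Var i \<in> forms N 1" "i \<le> N \<Longrightarrow> Var i \<in> forms N (Suc 0)"
  by (auto simp: forms_def Var_def polys_def lookup_single when_def)

lemma forms_add: "f \<in> forms N d \<Longrightarrow> g \<in> forms N d \<Longrightarrow> f + g \<in> forms N d"
  using Poly_Mapping.keys_add[of f g] by (auto simp: forms_def polys_add)

lemma forms_uminus [simp]: "- f \<in> forms N d \<longleftrightarrow> f \<in> forms N d"
  by (auto simp: forms_def in_keys_iff)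

lemma forms_diff: "f \<in> forms N d \<Longrightarrow> g \<in> forms N d \<Longrightarrow> f - g \<in> forms N d"
  using forms_add[of f N d "- g"] by simp

lemma forms_sum: "(\<And>i. i \<in> S \<Longrightarrow> F i \<in> forms N d) \<Longrightarrow> sum F S \<in> forms N d"
  by (induction S rule: infinite_finite_induct) (simp_all add: forms_add)

lemma forms_mult: "f \<in> forms N d \<Longrightarrow> g \<in> forms N e \<Longrightarrow> f * g \<in> forms N (d + e)"
proof -
  assume a: "f \<in> forms N d" "g \<in> forms N e"
  have "(\<Sum>i\<le>N. Poly_Mapping.lookup m i) = d + e" if m: "m \<in> Poly_Mapping.keys (f * g)" for m
  proof -
    from m Poly_Mapping.keys_mult[of f g] obtain m1 m2 where "m = m1 + m2"
      "m1 \<in> Poly_Mapping.keys f" "m2 \<in> Poly_Mapping.keys g" by blast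
    then show ?thesis using a by (auto simp: forms_def lookup_add sum.distrib)
  qed
  then show ?thesis using a by (auto simp: forms_def polys_mult)
qed

lemma forms_power: "f \<in> forms N d \<Longrightarrow> f ^ k \<in> forms N (k * d)"
  by (induction k) (auto simp: forms_mult)

lemma forms_prod: "(\<And>i. i \<in> S \<Longrightarrow> F i \<in> forms N (d i)) \<Longrightarrow> prod F S \<in> forms N (sum d S)"
  by (induction S rule: infinite_finite_induct) (simp_all add: forms_mult)

lemma forms_degree_unique: "f \<in> forms N d \<Longrightarrow> f \<in> forms N e \<Longrightarrow> f \<noteq> 0 \<Longrightarrow> d = e"
proof -
  assume a: "f \<in> forms N d" "f \<in> forms N e" "f \<noteq> 0"
  then obtain m where "m \<in> Poly_Mapping.keys f" by (metis keys_eq_empty ex_in_conv)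
  then show "d = e" using a by (auto simp: forms_def)
qed

lemma monom_Const_forms:
  assumes "Poly_Mapping.keys m \<subseteq> {..N}"
  shows "Const c * monom_val Var m \<in> forms N (\<Sum>i\<le>N. Poly_Mapping.lookup m i)"
  using assms by (auto simp: forms_def polys_def single_eq_Const_monom[symmetric] split: if_splits)

lemma forms_induct [consumes 1, case_names zero add monom]:
  assumes "f \<in> forms N d" and "P 0" and "\<And>f g. P f \<Longrightarrow> P g \<Longrightarrow> P (f + g)"
    and "\<And>c m. Poly_Mapping.keys m \<subseteq> {..N} \<Longrightarrow> (\<Sum>i\<le>N. Poly_Mapping.lookup m i) = d \<Longrightarrow>
           P (Const c * monom_val Var m)"
  shows "P f"
proof -
  have "P (sum F S)" if "finite S" "\<And>m. m \<in> S \<Longrightarrow> P (F m)" for F and S :: "(nat \<Rightarrow>\<^sub>0 nat) set"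
    using that by induction (auto simp: assms)
  then show ?thesis
    by (subst mpol_eq_sum_monom) (use assms in \<open>auto simp: forms_def polys_def\<close>)
qed

lemma polys_induct [consumes 1, case_names zero add monom]:
  assumes "f \<in> polys N" and "P 0" and "\<And>f g. P f \<Longrightarrow> P g \<Longrightarrow> P (f + g)"
    and "\<And>c m. Poly_Mapping.keys m \<subseteq> {..N} \<Longrightarrow> P (Const c * monom_val Var m)"
  shows "P f"
proof -
  have "P (sum F S)" if "finite S" "\<And>m. m \<in> S \<Longrightarrow> P (F m)" for F and S :: "(nat \<Rightarrow>\<^sub>0 nat) set"
    using that by induction (auto simp: assms)
  then show ?thesis
    by (subst mpol_eq_sum_monom) (use assms in \<open>auto simp: polys_def\<close>)
qed

lemma monom_val_cong: "Poly_Mapping.keys m \<subseteq> S \<Longrightarrow> (\<And>i. i \<in> S \<Longrightarrow> v i = w i) \<Longrightarrow> monom_val v m = monom_val w m"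
  unfolding monom_val_def by (rule prod.cong) auto

lemma mpeval_cong: "f \<in> polys N \<Longrightarrow> (\<And>i. i \<le> N \<Longrightarrow> v i = w i) \<Longrightarrow> mpeval \<alpha> v f = mpeval \<alpha> w f"
  unfolding mpeval_def
  by (intro sum.cong arg_cong2[where f="(*)"] refl monom_val_cong[of _ "{..N}"]) (auto simp: polys_def)

lemma subst_monom_val: "subst F (monom_val Var m) = monom_val F m"
  by (simp add: monom_val_def subst.mpeval_prod subst.mpeval_power)

lemma monom_val_forms:
  assumes "Poly_Mapping.keys m \<subseteq> {..N}" "\<And>i. i \<le> N \<Longrightarrow> F i \<in> forms M e"
  shows "monom_val F m \<in> forms M ((\<Sum>i\<le>N. Poly_Mapping.lookup m i) * e)"
proof -
  have "monom_val F m = (\<Prod>i\<le>N. F i ^ Poly_Mapping.lookup m i)"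
    using assms by (intro monom_val_superset) auto
  also have "\<dots> \<in> forms M (\<Sum>i\<le>N. Poly_Mapping.lookup m i * e)"
    using assms by (intro forms_prod forms_power) auto
  finally show ?thesis by (simp add: sum_distrib_right)
qed

lemma subst_forms:
  assumes "f \<in> forms N d" "\<And>i. i \<le> N \<Longrightarrow> F i \<in> forms M e"
  shows "subst F f \<in> forms M (d * e)"
  using assms(1)
proof (induction rule: forms_induct)
  case (monom c m)
  then show ?case using forms_mult[OF Const_forms[of c M] monom_val_forms[OF monom(1) assms(2)]]
    by (simp add: subst.mpeval_mult subst_monom_val)
qed (auto simp: subst.mpeval_add forms_add)

lemma subst_polys:
  assumes "f \<in> polys N" "\<And>i. i \<le> N \<Longrightarrow> F i \<in> polys M"
  shows "subst F f \<in> polys M"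
  using assms(1)
proof (induction rule: polys_induct)
  case (monom c m)
  then have "monom_val F m \<in> polys M"
    unfolding monom_val_def using assms(2) by (intro polys_prod polys_power) auto
  then show ?case
    by (simp add: subst.mpeval_mult subst_monom_val polys_mult)
qed (auto simp: subst.mpeval_add polys_add)

section \<open>Grading and homogeneous primes\<close>

text \<open>
  This is $f(T x_0, T x_1, \dots)$ as a polynomial in $T$. Its coefficients are the homogeneous components of $f$,
  so sums and products of components are governed by the laws for coefficients of univariate polynomials.
\<close>

definition graded :: "'k::field mpol \<Rightarrow> 'k mpol poly" where
  "graded = mpeval (\<lambda>c. [:Const c:]) (\<lambda>i. monom (Var i) 1)"

interpretation pC: coeff_hom "\<lambda>c. [:Const c:]"
  by unfold_locales (simp_all add: Const_add Const_mult one_pCons)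

lemma graded_add: "graded (f + g) = graded f + graded g" and graded_mult: "graded (f * g) = graded f * graded g"
  and graded_0 [simp]: "graded 0 = 0" and graded_1 [simp]: "graded 1 = 1"
  and graded_power: "graded (f ^ k) = graded f ^ k"
  by (simp_all add: graded_def pC.mpeval_add pC.mpeval_mult pC.mpeval_power)

lemma graded_form:
  assumes "f \<in> forms N d"
  shows "graded f = monom f d"
  using assms
proof (induction rule: forms_induct)
  case (monom c m)
  have mv: "monom_val v m = (\<Prod>i\<le>N. v i ^ Poly_Mapping.lookup m i)" for v :: "nat \<Rightarrow> 'r::comm_ring_1"
    using monom by (intro monom_val_superset) auto
  have "(\<Prod>i\<in>S. monom (Var i :: 'a mpol) (Suc 0) ^ Poly_Mapping.lookup m i) =
      monom (\<Prod>i\<in>S. Var i ^ Poly_Mapping.lookup m i) (\<Sum>i\<in>S. Poly_Mapping.lookup m i)" if "finite S" for S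
    using that by induction (simp_all add: monom_power mult_monom)
  then have *: "monom_val (\<lambda>i. monom (Var i :: 'a mpol) (Suc 0)) m = monom (monom_val Var m) d"
    using monom by (simp add: mv)
  have "mpeval (\<lambda>c. [:Const c:]) (\<lambda>i. monom (Var i :: 'a mpol) (Suc 0)) (monom_val Var m)
     = monom_val (\<lambda>i. monom (Var i) (Suc 0)) m"
    by (simp add: monom_val_def pC.mpeval_prod pC.mpeval_power)
  then show ?case
    by (simp add: graded_def pC.mpeval_mult * smult_monom)
qed (simp_all add: graded_add add_monom)

definition hcomp :: "nat \<Rightarrow> 'k::field mpol \<Rightarrow> 'k mpol" where
  "hcomp d f = coeff (graded f) d"

lemma hcomp_0 [simp]: "hcomp d 0 = 0" by (simp add: hcomp_def)

lemma hcomp_add: "hcomp d (f + g) = hcomp d f + hcomp d g"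
  by (simp add: hcomp_def graded_add)

lemma hcomp_mult: "hcomp d (f * g) = (\<Sum>i\<le>d. hcomp i f * hcomp (d - i) g)"
  by (simp add: hcomp_def graded_mult coeff_mult)

lemma hcomp_form: "f \<in> forms N d \<Longrightarrow> hcomp e f = (if e = d then f else 0)"
  by (simp add: hcomp_def graded_form)

lemma hcomp_forms: "f \<in> polys N \<Longrightarrow> hcomp d f \<in> forms N d"
proof (induction rule: polys_induct)
  case (monom c m)
  then show ?case using monom_Const_forms[OF monom, of c]
    by (auto simp: hcomp_form[OF monom_Const_forms[OF monom]])
qed (simp_all add: hcomp_add forms_add)

lemma poly_graded_1: "poly (graded f) 1 = f"
proof -
  have "poly (graded f) 1 = mpeval Const Var f"
    using mpol_hom_eq_mpeval[of "\<lambda>f. poly (graded f) 1" f]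
    by (simp add: graded_add graded_mult) (simp add: graded_def poly_monom)
  also have "mpeval Const Var f = subst Var f"
    by (simp add: subst_def mpeval_def monom_val_def)
  finally show ?thesis by simp
qed

lemma sum_hcomp: "(\<Sum>d\<le>degree (graded f). hcomp d f) = f"
  using poly_graded_1[of f] by (simp add: poly_altdef hcomp_def)

lemma hcomp_poly_eq_0: "(\<And>d. hcomp d f = 0) \<Longrightarrow> f = 0"
  using sum_hcomp[of f] by simp

lemma poly_ring_simps [simp]:
  "carrier (poly_ring N) = polys N" "x \<otimes>\<^bsub>poly_ring N\<^esub> y = x * y" "\<one>\<^bsub>poly_ring N\<^esub> = 1"
  "\<zero>\<^bsub>poly_ring N\<^esub> = 0" "x \<oplus>\<^bsub>poly_ring N\<^esub> y = x + y"
  by (simp_all add: poly_ring_def)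

lemma poly_ring_cring: "cring (poly_ring N)"
  by (rule cringI; (rule abelian_groupI comm_monoidI)?)
     (auto simp: polys_add polys_mult algebra_simps intro: exI bexI[of _ "- x" for x])

lemma poly_ring_ring: "ring (poly_ring N)"
  using poly_ring_cring by (rule cring.axioms)

context
  fixes Q :: "'k::field mpol set" and N
  assumes Q: "Q \<in> proj_points N"
begin

lemma pp_primeideal: "primeideal Q (poly_ring N)"
  using Q by (simp add: proj_points_def)

lemma pp_ideal: "ideal Q (poly_ring N)"
  using pp_primeideal by (rule primeideal.axioms)

lemma pp_polys: "f \<in> Q \<Longrightarrow> f \<in> polys N"
  using ideal.Icarr[OF pp_ideal] by simp

lemma pp_zero: "0 \<in> Q"
  using additive_subgroup.zero_closed[OF ideal.axioms(1)[OF pp_ideal]] by simp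

lemma pp_add: "f \<in> Q \<Longrightarrow> g \<in> Q \<Longrightarrow> f + g \<in> Q"
  using additive_subgroup.a_closed[OF ideal.axioms(1)[OF pp_ideal], of f g] by simp

lemma pp_mult: "f \<in> Q \<Longrightarrow> g \<in> polys N \<Longrightarrow> f * g \<in> Q"
  using ideal.I_r_closed[OF pp_ideal, of f g] by simp

lemma pp_mult': "f \<in> Q \<Longrightarrow> g \<in> polys N \<Longrightarrow> g * f \<in> Q"
  using ideal.I_l_closed[OF pp_ideal, of f g] by simp

lemma pp_uminus: "f \<in> Q \<Longrightarrow> - f \<in> Q"
  using pp_mult[of f "- 1"] by simp

lemma pp_diff: "f \<in> Q \<Longrightarrow> g \<in> Q \<Longrightarrow> f - g \<in> Q"
  using pp_add[of f "- g"] pp_uminus[of g] by simp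

lemma pp_prime: "f \<in> polys N \<Longrightarrow> g \<in> polys N \<Longrightarrow> f * g \<in> Q \<Longrightarrow> f \<in> Q \<or> g \<in> Q"
  using primeideal.I_prime[OF pp_primeideal, of f g] by simp

lemma pp_one: "1 \<notin> Q"
proof
  assume "1 \<in> Q"
  then have "polys N \<subseteq> Q" using pp_mult[of 1] by auto
  then have "polys N = Q" using pp_polys by auto
  then show False using primeideal.I_notcarr[OF pp_primeideal] by simp
qed

lemma pp_power: "f \<in> polys N \<Longrightarrow> f ^ d \<in> Q \<Longrightarrow> f \<in> Q"
proof (induction d)
  case (Suc d)
  then show ?case using pp_prime[of f "f ^ d"] polys_power[of f N d] by auto
qed (use pp_one in auto)

lemma pp_Var: "\<exists>i\<le>N. Var i \<notin> Q"
  using Q by (simp add: proj_points_def)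

lemma pp_gen: "Q = Idl\<^bsub>poly_ring N\<^esub> (Q \<inter> (\<Union>d. forms N d))"
  using Q unfolding proj_points_def by blast

end

lemma pp_subset:
  assumes "Q \<in> proj_points N" "Q' \<in> proj_points N"
    and "\<And>f d. f \<in> forms N d \<Longrightarrow> f \<in> Q \<Longrightarrow> f \<in> Q'"
  shows "Q \<subseteq> Q'"
proof -
  interpret R: ring "poly_ring N :: 'a mpol ring" by (rule poly_ring_ring)
  have "Idl\<^bsub>poly_ring N\<^esub> (Q \<inter> (\<Union>d. forms N d)) \<subseteq> Q'"
    by (rule R.genideal_minimal[OF pp_ideal[OF assms(2)]]) (use assms(3) in blast)
  then show ?thesis using pp_gen[OF assms(1)] by simp
qed

text \<open>
  A homogeneous prime is determined by its forms, and primality need only be tested on forms: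
  if neither $f$ nor $g$ lies in the ideal, the product of their lowest components outside \<open>I\<close> is, modulo
  \<open>I\<close>, a component of $f g$. Thus points of $P^N$ can be constructed from a condition on forms.
\<close>

lemma homogeneous_prime:
  fixes I :: "'k::field mpol set"
  assumes I_form: "\<And>f. f \<in> I \<Longrightarrow> \<exists>d. f \<in> forms N d"
    and I_0: "0 \<in> I"
    and I_add: "\<And>f g d. f \<in> I \<Longrightarrow> g \<in> I \<Longrightarrow> f \<in> forms N d \<Longrightarrow> g \<in> forms N d \<Longrightarrow> f + g \<in> I"
    and I_mult: "\<And>f g d e. f \<in> I \<Longrightarrow> f \<in> forms N d \<Longrightarrow> g \<in> forms N e \<Longrightarrow> f * g \<in> I"
    and I_prime: "\<And>f g d e. f * g \<in> I \<Longrightarrow> f \<in> forms N d \<Longrightarrow> g \<in> forms N e \<Longrightarrow> f \<in> I \<or> g \<in> I"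
    and I_Var: "i \<le> N" "Var i \<notin> I"
  defines "Q \<equiv> {f \<in> polys N. \<forall>d. hcomp d f \<in> I}"
  shows "Q \<in> proj_points N" and "\<And>f d. f \<in> forms N d \<Longrightarrow> f \<in> Q \<longleftrightarrow> f \<in> I"
proof -
  interpret R: cring "poly_ring N :: 'k mpol ring" by (rule poly_ring_cring)
  have sumI: "(\<Sum>x\<in>S. F x) \<in> I" if "\<And>x. x \<in> S \<Longrightarrow> F x \<in> I \<and> F x \<in> forms N d" for S :: "nat set" and F d
  proof -
    have "(\<Sum>x\<in>S. F x) \<in> I \<and> (\<Sum>x\<in>S. F x) \<in> forms N d"
      using that
    proof (induction S rule: infinite_finite_induct)
      case (insert x F')
      then show ?case using I_add[of "F x" "sum F F'" d] forms_add[of "F x" N d "sum F F'"] by auto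
    qed (auto simp: I_0)
    then show ?thesis ..
  qed
  have I_mult': "g * f \<in> I" if "f \<in> I" "f \<in> forms N d" "g \<in> forms N e" for f g d e
    using I_mult[OF that] by (simp add: mult.commute)
  show iff: "f \<in> Q \<longleftrightarrow> f \<in> I" if "f \<in> forms N d" for f d
    using that I_0 forms_polys[OF that] by (auto simp: Q_def hcomp_form)
  have Q0: "0 \<in> Q" by (simp add: Q_def I_0)
  have Qadd: "f + g \<in> Q" if "f \<in> Q" "g \<in> Q" for f g
    using that by (auto simp: Q_def hcomp_add polys_add intro: I_add hcomp_forms)
  have Qmult: "f * g \<in> Q" if "f \<in> Q" "g \<in> polys N" for f g
  proof -
    have "hcomp d (f * g) \<in> I" for d
      unfolding hcomp_mult
    proof (rule sumI[where d = d], rule conjI)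
      fix x assume x: "x \<in> {..d}"
      show "hcomp x f * hcomp (d - x) g \<in> I"
        using that by (intro I_mult[where d = x and e = "d - x"] hcomp_forms) (auto simp: Q_def)
      show "hcomp x f * hcomp (d - x) g \<in> forms N d"
        using forms_mult[of "hcomp x f" N x "hcomp (d - x) g" "d - x"] hcomp_forms that x
        by (auto simp: Q_def)
    qed
    then show ?thesis using that by (auto simp: Q_def polys_mult)
  qed
  have Qid: "ideal Q (poly_ring N)"
  proof (rule idealI)
    show "ring (poly_ring N :: 'k mpol ring)" by (rule poly_ring_ring)
    show "subgroup Q (add_monoid (poly_ring N))"
    proof (rule group.subgroupI)
      show "Group.group (add_monoid (poly_ring N :: 'k mpol ring))"
        by (rule R.add.is_group)
      show "Q \<subseteq> carrier (add_monoid (poly_ring N))" by (auto simp: Q_def)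
      show "Q \<noteq> {}" using Q0 by auto
      fix a assume a: "a \<in> Q"
      have "inv\<^bsub>add_monoid (poly_ring N)\<^esub> a = - a"
        using a R.minus_equality[of "- a" a] by (auto simp: Q_def a_inv_def)
      then show "inv\<^bsub>add_monoid (poly_ring N)\<^esub> a \<in> Q"
        using Qmult[OF a, of "- 1"] by simp
    next
      fix a b assume "a \<in> Q" "b \<in> Q"
      then show "a \<otimes>\<^bsub>add_monoid (poly_ring N)\<^esub> b \<in> Q" using Qadd by simp
    qed
    fix a x :: "'k mpol" assume "a \<in> Q" "x \<in> carrier (poly_ring N)"
    then show "x \<otimes>\<^bsub>poly_ring N\<^esub> a \<in> Q" "a \<otimes>\<^bsub>poly_ring N\<^esub> x \<in> Q"
      using Qmult[of a x] by (simp_all add: mult.commute)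
  qed
  have VarQ: "Var i \<notin> Q" using iff[OF Var_forms(1)[OF I_Var(1)]] I_Var by simp
  have prime: "f \<in> Q \<or> g \<in> Q" if fg: "f \<in> polys N" "g \<in> polys N" "f * g \<in> Q" for f g
  proof (rule ccontr)
    assume "\<not> ?thesis"
    with fg have ex: "\<exists>d. hcomp d f \<notin> I" "\<exists>d. hcomp d g \<notin> I" by (auto simp: Q_def)
    define d where "d = (LEAST d. hcomp d f \<notin> I)"
    define e where "e = (LEAST e. hcomp e g \<notin> I)"
    have d: "hcomp d f \<notin> I" "\<And>d'. d' < d \<Longrightarrow> hcomp d' f \<in> I"
      unfolding d_def using LeastI_ex[OF ex(1)] not_less_Least by blast+
    have e: "hcomp e g \<notin> I" "\<And>e'. e' < e \<Longrightarrow> hcomp e' g \<in> I"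
      unfolding e_def using LeastI_ex[OF ex(2)] not_less_Least by blast+
    have hf: "hcomp x f \<in> forms N x" "hcomp x g \<in> forms N x" for x using fg hcomp_forms by auto
    have fm: "hcomp x f * hcomp (d + e - x) g \<in> forms N (d + e)" if "x \<le> d + e" for x
      using forms_mult[OF hf(1)[of x] hf(2)[of "d + e - x"]] that by simp
    have sI: "(\<Sum>x\<in>{..d+e} - {d}. hcomp x f * hcomp (d + e - x) g) \<in> I"
    proof (rule sumI[where d = "d + e"])
      fix x assume x: "x \<in> {..d + e} - {d}"
      have "hcomp x f * hcomp (d + e - x) g \<in> I"
      proof (cases "x < d")
        case True
        then show ?thesis using I_mult[OF d(2)[OF True] hf(1) hf(2)] by simp
      next
        case False
        with x have "d + e - x < e" by auto
        from I_mult'[OF e(2)[OF this] hf(2) hf(1)] show ?thesis by simp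
      qed
      then show "hcomp x f * hcomp (d + e - x) g \<in> I \<and> hcomp x f * hcomp (d + e - x) g \<in> forms N (d + e)"
        using fm x by auto
    qed
    have sF: "(\<Sum>x\<in>{..d+e} - {d}. hcomp x f * hcomp (d + e - x) g) \<in> forms N (d + e)"
      by (rule forms_sum) (use fm in auto)
    have "hcomp (d + e) (f * g) = hcomp d f * hcomp e g + (\<Sum>x\<in>{..d+e} - {d}. hcomp x f * hcomp (d + e - x) g)"
      unfolding hcomp_mult by (subst sum.remove[of _ d]) auto
    moreover have "hcomp (d + e) (f * g) \<in> I" using fg by (auto simp: Q_def)
    moreover have "hcomp (d + e) (f * g) \<in> forms N (d + e)" using fg by (auto intro: hcomp_forms polys_mult)
    moreover have "- (\<Sum>x\<in>{..d+e} - {d}. hcomp x f * hcomp (d + e - x) g) \<in> I"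
      using I_mult[OF sI sF, of "- 1" 0] by simp
    ultimately have "hcomp d f * hcomp e g \<in> I"
      using I_add[of "hcomp (d + e) (f * g)" "- (\<Sum>x\<in>{..d+e} - {d}. hcomp x f * hcomp (d + e - x) g)" "d + e"] sF
      by simp
    then show False using I_prime[OF _ hf(1) hf(2)] d e by blast
  qed
  have Qprime: "primeideal Q (poly_ring N)"
  proof (rule primeidealI[OF Qid])
    show "cring (poly_ring N :: 'k mpol ring)" by (rule poly_ring_cring)
    show "carrier (poly_ring N) \<noteq> Q" using VarQ I_Var by auto
  qed (use prime in auto)
  have gen: "Q = Idl\<^bsub>poly_ring N\<^esub> (Q \<inter> (\<Union>d. forms N d))"
  proof
    let ?J = "Idl\<^bsub>poly_ring N\<^esub> (Q \<inter> (\<Union>d. forms N d))"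
    show "?J \<subseteq> Q" by (rule R.genideal_minimal[OF Qid]) blast
    have sub: "Q \<inter> (\<Union>d. forms N d) \<subseteq> carrier (poly_ring N)" by (auto simp: Q_def)
    have J: "ideal ?J (poly_ring N)" by (rule R.genideal_ideal[OF sub])
    have J1: "Q \<inter> (\<Union>d. forms N d) \<subseteq> ?J" by (rule R.genideal_self[OF sub])
    show "Q \<subseteq> ?J"
    proof
      fix f assume f: "f \<in> Q"
      have J0: "0 \<in> ?J" using additive_subgroup.zero_closed[OF ideal.axioms(1)[OF J]] by simp
      have Jadd: "x + y \<in> ?J" if "x \<in> ?J" "y \<in> ?J" for x y
        using additive_subgroup.a_closed[OF ideal.axioms(1)[OF J], of x y] that by simp
      have "hcomp d f \<in> ?J" for d
      proof -
        have fp: "f \<in> polys N" using f by (simp add: Q_def)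
        have "hcomp d f \<in> Q" using f iff[OF hcomp_forms[OF fp, of d]] by (simp add: Q_def)
        then show ?thesis using J1 hcomp_forms[OF fp, of d] by blast
      qed
      then have "(\<Sum>d\<in>S. hcomp d f) \<in> ?J" for S
        by (induction S rule: infinite_finite_induct) (use J0 Jadd in \<open>simp_all\<close>)
      from this[of "{..degree (graded f)}"] show "f \<in> ?J" by (simp add: sum_hcomp)
    qed
  qed
  show "Q \<in> proj_points N"
    using Qprime gen VarQ I_Var unfolding proj_points_def by blast
qed

lemma Var_neq_0 [simp]: "Var i \<noteq> 0"
proof
  assume "Var i = (0 :: 'a mpol)"
  then have "Poly_Mapping.lookup (Var i :: 'a mpol) (Poly_Mapping.single i 1) = 0" by simp
  then show False by (simp add: Var_def)
qed

lemma zero_pp: "{0} \<in> proj_points N"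
proof -
  have "{f \<in> polys N. \<forall>d. hcomp d f \<in> {0::'a mpol}} \<in> proj_points N"
    by (rule homogeneous_prime(1)[of "{0::'a mpol}" N 0]) auto
  moreover have "{f \<in> polys N. \<forall>d. hcomp d f \<in> {0::'a mpol}} = {0}"
    using hcomp_poly_eq_0 by auto
  ultimately show ?thesis by simp
qed

section \<open>Polynomials that are locally squares\<close>

definition polys_lt :: "nat \<Rightarrow> 'k::field mpol set" where
  "polys_lt j = {f. \<forall>m\<in>Poly_Mapping.keys f. Poly_Mapping.keys m \<subseteq> {..<j}}"

lemma polys_eq_polys_lt: "polys N = polys_lt (Suc N)"
  by (simp add: polys_def polys_lt_def lessThan_Suc_atMost)

lemma polys_lt_mono: "i \<le> j \<Longrightarrow> polys_lt i \<subseteq> polys_lt j"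
  by (fastforce simp: polys_lt_def)

lemma polys_lt_0_iff: "f \<in> polys_lt 0 \<longleftrightarrow> (\<exists>c. f = Const c)"
proof
  assume f: "f \<in> polys_lt 0"
  have "Poly_Mapping.keys f \<subseteq> {0}" using f by (auto simp: polys_lt_def)
  then have "f = Poly_Mapping.single 0 (Poly_Mapping.lookup f 0)"
    by (intro poly_mapping_eqI) (auto simp: lookup_single when_def in_keys_iff)
  then show "\<exists>c. f = Const c" by (auto simp: Const_def)
qed (auto simp: polys_lt_def Const_def split: if_splits)

lemma Const_polys_lt [simp]: "Const c \<in> polys_lt j"
  by (auto simp: polys_lt_def Const_def)

lemma zero_polys_lt [simp]: "0 \<in> polys_lt j" and one_polys_lt [simp]: "1 \<in> polys_lt j"
  using Const_polys_lt[of 0] Const_polys_lt[of 1] by (simp_all del: Const_polys_lt)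

lemma Var_polys_lt [simp]: "i < j \<Longrightarrow> Var i \<in> polys_lt j"
  by (auto simp: polys_lt_def Var_def)

lemma polys_lt_add: "f \<in> polys_lt j \<Longrightarrow> g \<in> polys_lt j \<Longrightarrow> f + g \<in> polys_lt j"
  using Poly_Mapping.keys_add[of f g] by (fastforce simp: polys_lt_def)

lemma polys_lt_mult: "f \<in> polys_lt j \<Longrightarrow> g \<in> polys_lt j \<Longrightarrow> f * g \<in> polys_lt j"
proof (cases j)
  case 0
  then show "f \<in> polys_lt j \<Longrightarrow> g \<in> polys_lt j \<Longrightarrow> f * g \<in> polys_lt j"
    by (auto simp: polys_lt_0_iff simp flip: Const_mult)
next
  case (Suc N)
  then show "f \<in> polys_lt j \<Longrightarrow> g \<in> polys_lt j \<Longrightarrow> f * g \<in> polys_lt j"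
    using polys_mult[of f N g] by (simp add: polys_eq_polys_lt)
qed

lemma polys_lt_sum: "(\<And>i. i \<in> S \<Longrightarrow> F i \<in> polys_lt j) \<Longrightarrow> sum F S \<in> polys_lt j"
  by (induction S rule: infinite_finite_induct) (simp_all add: polys_lt_add)

text \<open>
  The polynomial \<open>f\<close> as a univariate polynomial in $x_j$ whose coefficients do not involve $x_j$.
\<close>

definition in_var :: "nat \<Rightarrow> 'k::field mpol \<Rightarrow> 'k mpol poly" where
  "in_var j = mpeval (\<lambda>c. [:Const c:]) (\<lambda>i. if i = j then [:0, 1:] else [:Var i:])"

lemma in_var_add: "in_var j (f + g) = in_var j f + in_var j g" and in_var_mult: "in_var j (f * g) = in_var j f * in_var j g"
  and in_var_0 [simp]: "in_var j 0 = 0" and in_var_1 [simp]: "in_var j 1 = 1"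
  and in_var_power: "in_var j (f ^ k) = in_var j f ^ k"
  and in_var_Const [simp]: "in_var j (Const c) = [:Const c:]"
  and in_var_Var: "in_var j (Var i) = (if i = j then [:0, 1:] else [:Var i:])"
  by (simp_all add: in_var_def pC.mpeval_add pC.mpeval_mult pC.mpeval_power)

lemma poly_in_var: "poly (in_var j f) (Var j) = f"
proof -
  have "poly (in_var j f) (Var j) = mpeval (\<lambda>c. poly (in_var j (Const c)) (Var j)) (\<lambda>i. poly (in_var j (Var i)) (Var j)) f"
    by (rule mpol_hom_eq_mpeval) (simp_all add: in_var_add in_var_mult)
  also have "(\<lambda>i. poly (in_var j (Var i)) (Var j :: 'a mpol)) = Var"
    by (auto simp: in_var_Var)
  also have "mpeval (\<lambda>c. poly (in_var j (Const c)) (Var j)) Var f = subst Var f"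
    by (simp add: subst_def mpeval_def monom_val_def)
  finally show ?thesis by simp
qed

lemma in_var_eq_0_iff [simp]: "in_var j f = 0 \<longleftrightarrow> f = 0"
  using poly_in_var[of j f] by auto

lemma coeffs_polys_lt_mult:
  assumes "\<And>e. coeff p e \<in> polys_lt j" "\<And>e. coeff q e \<in> polys_lt j"
  shows "coeff (p * q) e \<in> polys_lt j"
  unfolding coeff_mult using assms by (intro polys_lt_sum polys_lt_mult)

lemma coeff_in_var_polys_lt:
  assumes "f \<in> polys_lt (Suc j)"
  shows "coeff (in_var j f) e \<in> polys_lt j"
proof -
  have "f \<in> polys j" using assms by (simp add: polys_eq_polys_lt)
  then show ?thesis
  proof (induction arbitrary: e rule: polys_induct)
    case (monom c m)
    have v: "coeff (in_var j (Var i)) e \<in> polys_lt j" if "i \<le> j" for i e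
      using that by (auto simp: in_var_Var coeff_pCons split: nat.split)
    have c: "coeff [:Const c:] e \<in> polys_lt j" for e
      by (auto simp: coeff_pCons split: nat.split)
    have one: "coeff 1 e \<in> polys_lt j" for e by (simp add: coeff_1)
    have pw: "coeff (in_var j (Var i) ^ k) e \<in> polys_lt j" if "i \<le> j" for i k e
    proof (induction k arbitrary: e)
      case (Suc k)
      show ?case unfolding power_Suc by (rule coeffs_polys_lt_mult) (use v that Suc in auto)
    qed (simp add: one)
    have pr: "coeff (\<Prod>i\<in>S. in_var j (Var i) ^ Poly_Mapping.lookup m i) e \<in> polys_lt j"
      if "finite S" "S \<subseteq> {..j}" for S :: "nat set" and e
      using that
    proof (induction S arbitrary: e)
      case (insert x F)
      show ?case unfolding prod.insert[OF insert(1,2)]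
        by (rule coeffs_polys_lt_mult) (use insert pw in auto)
    qed (simp add: one)
    have hm: "in_var j (monom_val Var m) = (\<Prod>i\<in>Poly_Mapping.keys m. in_var j (Var i) ^ Poly_Mapping.lookup m i)"
      by (simp add: in_var_def monom_val_def pC.mpeval_prod pC.mpeval_power)
    have "coeff (in_var j (monom_val Var m)) e \<in> polys_lt j" for e
      unfolding hm using pr[of "Poly_Mapping.keys m" e] monom by simp
    then show ?case unfolding in_var_mult in_var_Const
      by (intro coeffs_polys_lt_mult c)
  qed (simp_all add: in_var_add polys_lt_add)
qed

lemma in_var_const:
  assumes "f \<in> polys_lt j"
  shows "in_var j f = [:f:]"
proof (cases j)
  case 0
  then show ?thesis using assms by (auto simp: polys_lt_0_iff)
next
  case (Suc N)
  have f: "f \<in> polys N" using assms Suc by (simp add: polys_eq_polys_lt)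
  have "in_var j f = mpeval (\<lambda>c. [:Const c:]) (\<lambda>i. [:Var i:]) f"
    unfolding in_var_def by (rule mpeval_cong[OF f]) (use Suc in auto)
  also have "\<dots> = [:f:]"
    using mpol_hom_eq_mpeval[of "\<lambda>f. [:f:]" f] by (simp add: one_pCons)
  finally show ?thesis .
qed

text \<open>
  The order of \<open>F\<close> at \<open>p\<close> is even because \<open>s\<close> and \<open>s'\<close> have order $0$ there. Cancelling common factors
  \<open>p\<close> from \<open>a\<close> and \<open>b\<close> lowers the degree of \<open>b\<close>, and the descent ends with a
  second factor \<open>p\<close> of \<open>F\<close>.
\<close>

lemma prime_dvd_imp_square_dvd:
  fixes p F :: "'a::field poly"
  assumes p: "prime_elem p" and s: "\<not> p dvd s" "\<not> p dvd s'" and b: "b \<noteq> 0" and a: "a \<noteq> 0"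
    and eq: "s * F * b\<^sup>2 = s' * a\<^sup>2" and dvd: "p dvd F"
  shows "p\<^sup>2 dvd F"
  using b a eq
proof (induction "degree b" arbitrary: a b rule: less_induct)
  case less
  have p0: "p \<noteq> 0" and pu: "\<not> is_unit p" using p by (auto simp: prime_elem_def)
  obtain F1 where F1: "F = p * F1" using dvd by blast
  have "p dvd s' * a\<^sup>2" using less.prems dvd by (metis dvd_mult dvd_mult2)
  then have "p dvd a" using p s by (metis prime_elem_dvd_multD prime_elem_dvd_power)
  then obtain a1 where a1: "a = p * a1" by blast
  have eq1: "s * F1 * b\<^sup>2 = s' * p * a1\<^sup>2"
    using less.prems p0 unfolding F1 a1 by (simp add: power2_eq_square algebra_simps)
  then have "p dvd s * F1 * b\<^sup>2" by simp
  then consider "p dvd F1" | "p dvd b"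
    using p s by (meson prime_elem_dvd_multD prime_elem_dvd_power)
  then show ?case
  proof cases
    case 1
    then show ?thesis by (simp add: F1 power2_eq_square)
  next
    case 2
    then obtain b1 where b1: "b = p * b1" by blast
    have nz: "b1 \<noteq> 0" "a1 \<noteq> 0" using less.prems b1 a1 by auto
    have "degree p > 0" using pu p0 by (simp add: is_unit_iff_degree)
    then have "degree b1 < degree b" using b1 p0 nz by (simp add: degree_mult_eq)
    moreover have "s * F * b1\<^sup>2 = s' * a1\<^sup>2"
      using eq1 p0 unfolding F1 b1 by (simp add: power2_eq_square algebra_simps)
    ultimately show ?thesis using less.hyps nz by blast
  qed
qed

lemma ex_prime_elem_dvd:
  fixes F :: "'a::field poly"
  assumes "degree F > 0"
  shows "\<exists>p. prime_elem p \<and> p dvd F"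
  using assms
proof (induction "degree F" arbitrary: F rule: less_induct)
  case less
  have F0: "F \<noteq> 0" using less.prems by auto
  show ?case
  proof (cases "irreducible F")
    case True
    then show ?thesis using field_poly_irreducible_imp_prime[of F] by auto
  next
    case False
    moreover have "\<not> is_unit F" using less.prems F0 by (simp add: is_unit_iff_degree)
    ultimately obtain a b where ab: "F = a * b" "\<not> is_unit a" "\<not> is_unit b"
      using F0 by (auto simp: irreducible_def)
    then have "a \<noteq> 0" "b \<noteq> 0" using F0 by auto
    moreover from this ab have "degree a > 0" "degree b > 0" by (simp_all add: is_unit_iff_degree)
    ultimately have "degree a < degree F" "degree a > 0" by (simp_all add: ab degree_mult_eq)
    then show ?thesis using less.hyps[of a] ab by auto
  qed
qed

text \<open>
  Squares of prime factors are split off one at a time until a constant remains.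
\<close>

lemma locally_square_imp_square:
  fixes F :: "'a::field poly"
  assumes "F \<noteq> 0"
    and "\<And>p. prime_elem p \<Longrightarrow> \<exists>s s' a b. \<not> p dvd s \<and> \<not> p dvd s' \<and> a \<noteq> 0 \<and> b \<noteq> 0 \<and> s * F * b\<^sup>2 = s' * a\<^sup>2"
  shows "\<exists>h. F = smult (lead_coeff F) (h\<^sup>2)"
proof -
  have "\<exists>c h. F = smult c (h\<^sup>2)" using assms
  proof (induction "degree F" arbitrary: F rule: less_induct)
    case less
    show ?case
    proof (cases "degree F = 0")
      case True
      then obtain c where "F = [:c:]" by (metis degree_eq_zeroE)
      then have "F = smult c (1\<^sup>2)" by simp
      then show ?thesis by blast
    next
      case False
      obtain p where p: "prime_elem p" "p dvd F"
        using ex_prime_elem_dvd[of F] False by auto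
      then have p0: "p \<noteq> 0" by (auto simp: prime_elem_def)
      have pu: "\<not> is_unit p" using p by (auto simp: prime_elem_def)
      have "degree p > 0" using pu p0 by (simp add: is_unit_iff_degree)
      from less.prems(2)[OF p(1)] have "p\<^sup>2 dvd F"
        using prime_dvd_imp_square_dvd[OF p(1) _ _ _ _ _ p(2)] by blast
      then obtain F' where F': "F = p\<^sup>2 * F'" by blast
      have F'0: "F' \<noteq> 0" using F' less.prems by auto
      have "degree F = 2 * degree p + degree F'"
        unfolding F' using p0 F'0 by (simp add: degree_mult_eq degree_power_eq)
      then have "degree F' < degree F" using \<open>degree p > 0\<close> by simp
      moreover have "\<exists>s s' a b. \<not> q dvd s \<and> \<not> q dvd s' \<and> a \<noteq> 0 \<and> b \<noteq> 0 \<and> s * F' * b\<^sup>2 = s' * a\<^sup>2"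
        if "prime_elem q" for q
      proof -
        from less.prems(2)[OF that] obtain s s' a b where
          *: "\<not> q dvd s" "\<not> q dvd s'" "a \<noteq> 0" "b \<noteq> 0" "s * F * b\<^sup>2 = s' * a\<^sup>2" by blast
        have "s * F' * (p * b)\<^sup>2 = s' * a\<^sup>2" using *(5) F' by (simp add: power_mult_distrib mult_ac)
        moreover have "p * b \<noteq> 0" using * p0 by simp
        ultimately show ?thesis using *(1-3) by blast
      qed
      ultimately obtain c h where "F' = smult c (h\<^sup>2)" using less.hyps[of F'] F'0 by blast
      then have "F = smult c ((p * h)\<^sup>2)" using F' by (simp add: power_mult_distrib)
      then show ?thesis by blast
    qed
  qed
  then obtain c h where ch: "F = smult c (h\<^sup>2)" by blast
  have "h \<noteq> 0" using ch assms(1) by auto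
  have lc: "lead_coeff F = c * (lead_coeff h)\<^sup>2"
    using ch by (simp add: lead_coeff_power lead_coeff_smult)
  have "F = smult (lead_coeff F) ((smult (1 / lead_coeff h) h)\<^sup>2)"
    unfolding lc using \<open>h \<noteq> 0\<close> by (simp add: ch smult_power power_divide)
  then show ?thesis by blast
qed

definition mprime :: "'k::field mpol set \<Rightarrow> bool" where
  "mprime q \<longleftrightarrow> 0 \<in> q \<and> (\<forall>f\<in>q. \<forall>g\<in>q. f + g \<in> q) \<and> (\<forall>f\<in>q. \<forall>g. f * g \<in> q) \<and> 1 \<notin> q \<and>
     (\<forall>f g. f * g \<in> q \<longrightarrow> f \<in> q \<or> g \<in> q)"

text \<open>
  In the localisation at \<open>q\<close>, the polynomial \<open>u\<close> is a unit times a square of a nonzero fraction; denominators are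
  cleared. The primes \<open>q\<close> range over those that do not contain all of $x_0, \dots, x_n$, so that the
  homogeneous part of \<open>q\<close> is a point of $P^n$.
\<close>

definition loc_square :: "nat \<Rightarrow> 'k::field mpol \<Rightarrow> bool" where
  "loc_square n u \<longleftrightarrow> (\<forall>q. mprime q \<and> (\<exists>i\<le>n. Var i \<notin> q) \<longrightarrow>
     (\<exists>s s' a b. s \<notin> q \<and> s' \<notin> q \<and> a \<noteq> 0 \<and> b \<noteq> 0 \<and> s * u * b\<^sup>2 = s' * a\<^sup>2))"

lemma poly_fract_poly: "poly (fract_poly p) (to_fract x) = to_fract (poly p x)"
  by (induction p) (simp_all add: map_poly_pCons)

lemma fract_poly_power: "fract_poly (p ^ k) = fract_poly p ^ k"
  by (induction k) simp_all

text \<open>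
  Induction on the number of variables. Over the fraction field of the ring of coefficients, \<open>u\<close> is a polynomial in the last variable,
  and every prime element there contracts to a prime \<open>q\<close> of the polynomial ring; the local hypothesis at
  these primes makes \<open>u\<close> a square up to its leading coefficient. That coefficient differs
  from \<open>u\<close> by a square of a fraction, hence inherits the local hypothesis and has one variable less.
\<close>

lemma loc_square_polys_lt_imp_square:
  assumes n: "n \<ge> 1"
  shows "u \<in> polys_lt j \<Longrightarrow> u \<noteq> 0 \<Longrightarrow> loc_square n u \<Longrightarrow>
     \<exists>c a b. c \<noteq> 0 \<and> a \<noteq> 0 \<and> b \<noteq> 0 \<and> u * b\<^sup>2 = Const c * a\<^sup>2"
proof (induction j arbitrary: u)
  case 0
  then obtain c where "u = Const c" by (auto simp: polys_lt_0_iff)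
  moreover from this 0 have "c \<noteq> 0" by auto
  ultimately have "c \<noteq> 0 \<and> (1::'a mpol) \<noteq> 0 \<and> (1::'a mpol) \<noteq> 0 \<and> u * 1\<^sup>2 = Const c * 1\<^sup>2" by simp
  then show ?case by blast
next
  case (Suc j)
  define F where "F = fract_poly (in_var j u)"
  have F0: "F \<noteq> 0" using Suc.prems by (simp add: F_def)
  have "\<exists>s s' a b. \<not> p dvd s \<and> \<not> p dvd s' \<and> a \<noteq> 0 \<and> b \<noteq> 0 \<and> s * F * b\<^sup>2 = s' * a\<^sup>2" if p: "prime_elem p" for p
  proof -
    define q where "q = {g. p dvd fract_poly (in_var j g)}"
    have pu: "\<not> is_unit p" using p by (auto simp: prime_elem_def)
    have "mprime q"
      using p pu by (auto simp: mprime_def q_def in_var_add in_var_mult prime_elem_dvd_mult_iff)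
    moreover have "\<exists>i\<le>n. Var i \<notin> q"
    proof -
      have "Var i \<notin> q" if "i \<noteq> j" for i
      proof
        assume "Var i \<in> q"
        then have "p dvd [:to_fract (Var i):]" using that by (simp add: q_def in_var_Var map_poly_pCons)
        moreover have "is_unit [:to_fract (Var i :: 'a mpol):]" by (simp add: is_unit_const_poly_iff dvd_field_iff)
        ultimately show False using pu dvd_trans by blast
      qed
      \<comment> \<open>All variables except $x_j$ become units, so with two variables at hand \<open>q\<close> misses one of them.\<close>
      then have "Var 0 \<notin> q \<or> Var 1 \<notin> q" by (cases "j = 0") auto
      then show ?thesis using n by auto
    qed
    ultimately obtain s s' a b where *: "s \<notin> q" "s' \<notin> q" "a \<noteq> 0" "b \<noteq> 0" "s * u * b\<^sup>2 = s' * a\<^sup>2"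
      using Suc.prems(3) unfolding loc_square_def by blast
    define H where "H = (\<lambda>g :: 'a mpol. fract_poly (in_var j g))"
    have Hm: "H (f * g) = H f * H g" "H (f ^ k) = H f ^ k" "H f = 0 \<longleftrightarrow> f = 0" for f g k
      by (simp_all add: H_def in_var_mult in_var_power fract_poly_power)
    have "H s * F * (H b)\<^sup>2 = H s' * (H a)\<^sup>2"
      using arg_cong[OF *(5), of H] by (simp add: Hm F_def flip: H_def) (simp add: H_def)
    moreover have "\<not> p dvd H s" "\<not> p dvd H s'" "H a \<noteq> 0" "H b \<noteq> 0"
      using * by (simp_all add: q_def H_def)
    ultimately show ?thesis by blast
  qed
  from locally_square_imp_square[OF F0 this] obtain h where h: "F = smult (lead_coeff F) (h\<^sup>2)" by blast
  define c0 where "c0 = lead_coeff (in_var j u)"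
  have c0: "c0 \<in> polys_lt j" "c0 \<noteq> 0" using coeff_in_var_polys_lt[OF Suc.prems(1)] Suc.prems(2) by (simp_all add: c0_def)
  have lc: "lead_coeff F = to_fract c0"
    by (simp add: F_def c0_def degree_map_poly coeff_map_poly)
  obtain x y where xy: "poly h (to_fract (Var j)) = Fraction_Field.Fract x y" "y \<noteq> 0" by (cases "poly h (to_fract (Var j))") auto
  have "to_fract u = poly F (to_fract (Var j))" by (simp add: F_def poly_fract_poly poly_in_var)
  also have "\<dots> = to_fract c0 * (Fraction_Field.Fract x y)\<^sup>2" by (subst h) (simp add: lc xy)
  finally have u: "u * y\<^sup>2 = c0 * x\<^sup>2"
    using xy(2) by (simp add: to_fract_def power2_eq_square eq_fract)
  then have x0: "x \<noteq> 0" using xy Suc.prems by auto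
  have "loc_square n c0"
    unfolding loc_square_def
  proof (intro allI impI)
    fix q :: "'a mpol set" assume "mprime q \<and> (\<exists>i\<le>n. Var i \<notin> q)"
    then obtain s s' a b where *: "s \<notin> q" "s' \<notin> q" "a \<noteq> 0" "b \<noteq> 0" "s * u * b\<^sup>2 = s' * a\<^sup>2"
      using Suc.prems(3) unfolding loc_square_def by blast
    have "s * c0 * (x * b)\<^sup>2 = (s * u * b\<^sup>2) * y\<^sup>2" using u by (simp add: power_mult_distrib mult_ac)
    also have "\<dots> = s' * (a * y)\<^sup>2" using * by (simp add: power_mult_distrib mult_ac)
    finally have "s * c0 * (x * b)\<^sup>2 = s' * (a * y)\<^sup>2" .
    moreover have "x * b \<noteq> 0" "a * y \<noteq> 0" using * x0 xy(2) by auto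
    ultimately show "\<exists>s s' a b. s \<notin> q \<and> s' \<notin> q \<and> a \<noteq> 0 \<and> b \<noteq> 0 \<and> s * c0 * b\<^sup>2 = s' * a\<^sup>2"
      using *(1,2) by blast
  qed
  from Suc.IH[OF c0 this] obtain c a b where *: "c \<noteq> 0" "a \<noteq> 0" "b \<noteq> 0" "c0 * b\<^sup>2 = Const c * a\<^sup>2" by blast
  have "u * (y * b)\<^sup>2 = (c0 * b\<^sup>2) * x\<^sup>2" using u by (simp add: power_mult_distrib mult_ac)
  also have "\<dots> = Const c * (x * a)\<^sup>2" using * by (simp add: power_mult_distrib mult_ac)
  finally have "u * (y * b)\<^sup>2 = Const c * (x * a)\<^sup>2" .
  moreover have "y * b \<noteq> 0" "x * a \<noteq> 0" using * x0 xy(2) by auto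
  ultimately show ?case using *(1) by blast
qed

text \<open>
  Leading coefficients with respect to the superfluous variables satisfy the same equation,
  since leading coefficients are multiplicative.
\<close>

lemma square_descend_polys_lt:
  assumes u: "u \<in> polys_lt k" and eq: "u * b\<^sup>2 = Const c * a\<^sup>2" and nz: "a \<noteq> 0" "b \<noteq> 0"
  shows "\<exists>a b. a \<in> polys_lt k \<and> b \<in> polys_lt k \<and> a \<noteq> 0 \<and> b \<noteq> 0 \<and> u * b\<^sup>2 = Const c * a\<^sup>2"
proof -
  obtain N1 N2 where "a \<in> polys N1" "b \<in> polys N2" using ex_polys by blast
  then have ab: "a \<in> polys_lt (k + Suc (N1 + N2))" "b \<in> polys_lt (k + Suc (N1 + N2))"
    using polys_lt_mono[of "Suc N1" "k + Suc (N1 + N2)"] polys_lt_mono[of "Suc N2" "k + Suc (N1 + N2)"]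
    by (auto simp: polys_eq_polys_lt)
  have "a \<in> polys_lt (k + l) \<Longrightarrow> b \<in> polys_lt (k + l) \<Longrightarrow> ?thesis"
    for l using eq nz
  proof (induction l arbitrary: a b)
    case 0
    then show ?case by auto
  next
    case (Suc l)
    let ?h = "in_var (k + l)"
    have hu: "?h u = [:u:]" by (rule in_var_const) (use u polys_lt_mono[of k "k + l"] in auto)
    have "?h u * ?h b ^ 2 = [:Const c:] * ?h a ^ 2"
      using arg_cong[OF Suc.prems(3), of ?h] by (simp add: in_var_mult in_var_power)
    then have "lead_coeff ([:u:] * ?h b ^ 2) = lead_coeff ([:Const c:] * ?h a ^ 2)" by (simp add: hu)
    then have "u * lead_coeff (?h b) ^ 2 = Const c * lead_coeff (?h a) ^ 2"
      unfolding lead_coeff_mult lead_coeff_power by simp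
    then show ?case
      using Suc.IH[of "lead_coeff (?h a)" "lead_coeff (?h b)"] Suc.prems
        coeff_in_var_polys_lt[of a "k + l"] coeff_in_var_polys_lt[of b "k + l"] by auto
  qed
  then show ?thesis using ab by blast
qed

text \<open>
  The components of highest degree of a solution satisfy the same equation, so the solution
  may be taken homogeneous.
\<close>

lemma loc_square_form_imp_square:
  assumes n: "n \<ge> 1" and u: "u \<in> forms n d" "u \<noteq> 0" "loc_square n u"
  obtains c a b e1 e2 where "c \<noteq> 0" "a \<noteq> 0" "b \<noteq> 0" "a \<in> forms n e1" "b \<in> forms n e2"
     "u * b\<^sup>2 = Const c * a\<^sup>2"
proof -
  have up: "u \<in> polys_lt (Suc n)" using forms_polys[OF u(1)] by (simp add: polys_eq_polys_lt)
  obtain c a b where 1: "c \<noteq> 0" "a \<noteq> 0" "b \<noteq> 0" "u * b\<^sup>2 = Const c * a\<^sup>2"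
    using loc_square_polys_lt_imp_square[OF n up u(2,3)] by blast
  obtain a' b' where 2: "a' \<in> polys n" "b' \<in> polys n" "a' \<noteq> 0" "b' \<noteq> 0" "u * b'\<^sup>2 = Const c * a'\<^sup>2"
    using square_descend_polys_lt[OF up 1(4,2,3)] by (auto simp: polys_eq_polys_lt)
  have g0: "graded f = 0 \<longleftrightarrow> f = 0" for f :: "'a mpol" using poly_graded_1[of f] by auto
  have "graded u * graded b' ^ 2 = graded (Const c) * graded a' ^ 2"
    using arg_cong[OF 2(5), of graded] by (simp add: graded_mult graded_power)
  then have "lead_coeff (graded u * graded b' ^ 2) = lead_coeff (graded (Const c) * graded a' ^ 2)" by simp
  then have "lead_coeff (graded u) * lead_coeff (graded b') ^ 2 = lead_coeff (graded (Const c)) * lead_coeff (graded a') ^ 2"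
    unfolding lead_coeff_mult lead_coeff_power .
  then have "u * lead_coeff (graded b') ^ 2 = Const c * lead_coeff (graded a') ^ 2"
    by (simp add: graded_form[OF u(1)] graded_form[OF Const_forms[of c n]] u 1 degree_monom_eq del: Const_forms)
  moreover have "lead_coeff (graded b') \<in> forms n (degree (graded b'))" "lead_coeff (graded a') \<in> forms n (degree (graded a'))"
    using 2 hcomp_forms by (auto simp: hcomp_def)
  moreover have "lead_coeff (graded b') \<noteq> 0" "lead_coeff (graded a') \<noteq> 0" using 2 g0 by auto
  ultimately show thesis using that 1(1) by blast
qed

section \<open>Wronskian determinants of derivations\<close>

text \<open>
  Local rings and function fields appear below as subsets of one field of fractions, so subrings,
  homomorphisms and derivations are relativised to sets.
\<close>

definition subring_set :: "'a::comm_ring_1 set \<Rightarrow> bool" where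
  "subring_set S \<longleftrightarrow> 0 \<in> S \<and> 1 \<in> S \<and> (\<forall>a\<in>S. - a \<in> S) \<and> (\<forall>a\<in>S. \<forall>b\<in>S. a + b \<in> S \<and> a * b \<in> S)"

context
  fixes S :: "'a::comm_ring_1 set"
  assumes S: "subring_set S"
begin

lemma sr_0: "0 \<in> S" and sr_1: "1 \<in> S" and sr_uminus: "a \<in> S \<Longrightarrow> - a \<in> S"
  and sr_add: "a \<in> S \<Longrightarrow> b \<in> S \<Longrightarrow> a + b \<in> S" and sr_mult: "a \<in> S \<Longrightarrow> b \<in> S \<Longrightarrow> a * b \<in> S"
  using S by (auto simp: subring_set_def)

lemma sr_diff: "a \<in> S \<Longrightarrow> b \<in> S \<Longrightarrow> a - b \<in> S"
  using sr_add[of a "- b"] sr_uminus[of b] by simp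

lemma sr_sum: "(\<And>x. x \<in> T \<Longrightarrow> F x \<in> S) \<Longrightarrow> sum F T \<in> S"
  by (induction T rule: infinite_finite_induct) (auto simp: sr_0 sr_add)

lemma sr_prod: "(\<And>x. x \<in> T \<Longrightarrow> F x \<in> S) \<Longrightarrow> prod F T \<in> S"
  by (induction T rule: infinite_finite_induct) (auto simp: sr_1 sr_mult)

lemma sr_power: "a \<in> S \<Longrightarrow> a ^ k \<in> S"
  by (induction k) (auto simp: sr_1 sr_mult)

lemma sr_sign: "of_int (sign p) \<in> S"
  by (auto simp: sign_def sr_1 sr_uminus)

lemma sr_det:
  assumes "\<And>i j. i < n \<Longrightarrow> j < n \<Longrightarrow> A i j \<in> S"
  shows "det (mat n n (\<lambda>(i, j). A i j)) \<in> S"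
proof -
  have "det (mat n n (\<lambda>(i, j). A i j)) =
     (\<Sum>p\<in>{p. p permutes {0..<n}}. of_int (sign p) * (\<Prod>i=0..<n. A i (p i)))"
    by (subst det_def'[of _ n]) (auto intro!: sum.cong prod.cong arg_cong2[where f="(*)"] dest: permutes_in_image)
  also have "\<dots> \<in> S"
    by (intro sr_sum sr_mult sr_prod sr_sign assms) (auto dest: permutes_in_image)
  finally show ?thesis .
qed

end

definition hom_on :: "'a::comm_ring_1 set \<Rightarrow> ('a \<Rightarrow> 'b::comm_ring_1) \<Rightarrow> bool" where
  "hom_on S h \<longleftrightarrow> h 1 = 1 \<and> (\<forall>a\<in>S. \<forall>b\<in>S. h (a + b) = h a + h b \<and> h (a * b) = h a * h b)"

context
  fixes S :: "'a::comm_ring_1 set" and h :: "'a \<Rightarrow> 'b::comm_ring_1"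
  assumes S: "subring_set S" and h: "hom_on S h"
begin

lemma ho_1: "h 1 = 1" and ho_add: "a \<in> S \<Longrightarrow> b \<in> S \<Longrightarrow> h (a + b) = h a + h b"
  and ho_mult: "a \<in> S \<Longrightarrow> b \<in> S \<Longrightarrow> h (a * b) = h a * h b"
  using h by (auto simp: hom_on_def)

lemma ho_0: "h 0 = 0"
  using ho_add[OF sr_0[OF S] sr_0[OF S]] by simp

lemma ho_uminus: "a \<in> S \<Longrightarrow> h (- a) = - h a"
  using ho_add[of a "- a"] sr_uminus[OF S, of a] ho_0 by (simp add: eq_neg_iff_add_eq_0 add.commute)

lemma ho_sum: "(\<And>x. x \<in> T \<Longrightarrow> F x \<in> S) \<Longrightarrow> h (sum F T) = (\<Sum>x\<in>T. h (F x))"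
  by (induction T rule: infinite_finite_induct) (auto simp: ho_0 ho_add sr_sum[OF S])

lemma ho_prod: "(\<And>x. x \<in> T \<Longrightarrow> F x \<in> S) \<Longrightarrow> h (prod F T) = (\<Prod>x\<in>T. h (F x))"
  by (induction T rule: infinite_finite_induct) (auto simp: ho_1 ho_mult sr_prod[OF S])

lemma ho_power: "a \<in> S \<Longrightarrow> h (a ^ k) = h a ^ k"
  by (induction k) (auto simp: ho_1 ho_mult sr_power[OF S])

lemma ho_sign: "h (of_int (sign p)) = of_int (sign p)"
  by (auto simp: sign_def ho_1 ho_uminus sr_1[OF S])

lemma ho_det:
  assumes "\<And>i j. i < n \<Longrightarrow> j < n \<Longrightarrow> A i j \<in> S"
  shows "h (det (mat n n (\<lambda>(i, j). A i j))) = det (mat n n (\<lambda>(i, j). h (A i j)))"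
proof -
  have perm: "p i < n" if "p permutes {0..<n}" "i < n" for p i
    using that by (auto dest: permutes_in_image)
  have e: "det (mat n n (\<lambda>(i, j). B i j)) =
     (\<Sum>p\<in>{p. p permutes {0..<n}}. of_int (sign p) * (\<Prod>i=0..<n. B i (p i)))"
    for B :: "nat \<Rightarrow> nat \<Rightarrow> 'r::comm_ring_1"
    by (subst det_def'[of _ n]) (auto intro!: sum.cong prod.cong arg_cong2[where f="(*)"] dest: perm)
  have "h (det (mat n n (\<lambda>(i, j). A i j))) =
     (\<Sum>p\<in>{p. p permutes {0..<n}}. h (of_int (sign p) * (\<Prod>i=0..<n. A i (p i))))"
    unfolding e by (intro ho_sum sr_mult[OF S] sr_sign[OF S] sr_prod[OF S]) (auto simp: perm assms)
  also have "\<dots> = (\<Sum>p\<in>{p. p permutes {0..<n}}. of_int (sign p) * (\<Prod>i=0..<n. h (A i (p i))))"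
  proof (rule sum.cong[OF refl])
    fix p assume "p \<in> {p. p permutes {0..<n}}"
    then have "\<And>i. i \<in> {0..<n} \<Longrightarrow> A i (p i) \<in> S" using assms perm by auto
    then show "h (of_int (sign p) * (\<Prod>i=0..<n. A i (p i))) = of_int (sign p) * (\<Prod>i=0..<n. h (A i (p i)))"
      using ho_mult[OF sr_sign[OF S] sr_prod[OF S, of "{0..<n}" "\<lambda>i. A i (p i)"]] ho_prod[of "{0..<n}" "\<lambda>i. A i (p i)"]
      by (simp add: ho_sign)
  qed
  finally show ?thesis unfolding e .
qed

end

definition derivs :: "'a::field set \<Rightarrow> ('a \<Rightarrow> 'a) set" where
  "derivs K = {D. (\<forall>a\<in>K. D a \<in> K) \<and> (\<forall>a\<in>K. \<forall>b\<in>K. D (a + b) = D a + D b \<and> D (a * b) = D a * b + a * D b)}"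

context
  fixes K :: "'a::field set" and D :: "'a \<Rightarrow> 'a"
  assumes K: "subring_set K" and D: "D \<in> derivs K"
begin

lemma der_closed: "a \<in> K \<Longrightarrow> D a \<in> K"
  and der_add: "a \<in> K \<Longrightarrow> b \<in> K \<Longrightarrow> D (a + b) = D a + D b"
  and der_mult: "a \<in> K \<Longrightarrow> b \<in> K \<Longrightarrow> D (a * b) = D a * b + a * D b"
  using D by (auto simp: derivs_def)

lemma der_0: "D 0 = 0"
  using der_add[OF sr_0[OF K] sr_0[OF K]] by (metis add_0 add_cancel_right_left)

lemma der_1: "D 1 = 0"
  using der_mult[OF sr_1[OF K] sr_1[OF K]] by (metis mult_1 mult_1_right add_cancel_right_left)

lemma der_inverse:
  assumes "a \<in> K" "inverse a \<in> K" "a \<noteq> 0"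
  shows "D (inverse a) = - D a / a\<^sup>2"
proof -
  have "D (a * inverse a) = 0" using assms by (simp add: der_1)
  then have "D a * inverse a + a * D (inverse a) = 0" using der_mult[OF assms(1,2)] by simp
  then have "a * D (inverse a) = - D a * inverse a" by (simp add: eq_neg_iff_add_eq_0 add.commute)
  then have "D (inverse a) = inverse a * (- D a * inverse a)" using assms(3) by (simp add: field_simps)
  then show ?thesis by (simp add: field_simps power2_eq_square)
qed

end

text \<open>
  Row $0$ consists of the functions themselves, and row $i + 1$ of their images under the derivation \<open>D i\<close>. The extra row makes
  all $n + 1$ homogeneous coordinates play the same role.
\<close>

definition wronsk_mat :: "nat \<Rightarrow> (nat \<Rightarrow> 'a::field \<Rightarrow> 'a) \<Rightarrow> (nat \<Rightarrow> 'a) \<Rightarrow> 'a mat" where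
  "wronsk_mat n D z = mat (Suc n) (Suc n) (\<lambda>(i, j). if i = 0 then z j else D (i - 1) (z j))"

definition wronsk :: "nat \<Rightarrow> (nat \<Rightarrow> 'a::field \<Rightarrow> 'a) \<Rightarrow> (nat \<Rightarrow> 'a) \<Rightarrow> 'a" where
  "wronsk n D z = det (wronsk_mat n D z)"

definition jac :: "nat \<Rightarrow> (nat \<Rightarrow> 'a::field \<Rightarrow> 'a) \<Rightarrow> (nat \<Rightarrow> 'a) \<Rightarrow> 'a" where
  "jac n D a = det (mat n n (\<lambda>(i, j). D i (a j)))"

lemma wronsk_mat_carrier [simp]: "wronsk_mat n D z \<in> carrier_mat (Suc n) (Suc n)"
  by (simp add: wronsk_mat_def)

lemma wronsk_cong: "(\<And>j. j \<le> n \<Longrightarrow> z j = z' j) \<Longrightarrow> wronsk n D z = wronsk n D z'"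
  unfolding wronsk_def wronsk_mat_def by (rule arg_cong[where f = det], rule eq_matI) auto

lemma jac_cong: "(\<And>j. j < n \<Longrightarrow> z j = z' j) \<Longrightarrow> jac n D z = jac n D z'"
  unfolding jac_def by (rule arg_cong[where f = det], rule eq_matI) auto

text \<open>
  By the product rule, scaling the functions by \<open>l\<close> multiplies the matrix from the left by a lower triangular one
  with diagonal entries \<open>l\<close>; the derivatives of \<open>l\<close> sit in its first column.
\<close>

lemma wronsk_scale:
  assumes K: "subring_set K" and D: "\<And>i. i < n \<Longrightarrow> D i \<in> derivs K"
    and l: "l \<in> K" and z: "\<And>j. j \<le> n \<Longrightarrow> z j \<in> K"
  shows "wronsk n D (\<lambda>j. l * z j) = l ^ Suc n * wronsk n D z"
proof -
  let ?L = "mat (Suc n) (Suc n) (\<lambda>(i, j). if i = j then l else if j = 0 then D (i - 1) l else 0)"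
  have L: "?L \<in> carrier_mat (Suc n) (Suc n)" by simp
  have "wronsk_mat n D (\<lambda>j. l * z j) = ?L * wronsk_mat n D z"
  proof (rule eq_matI)
    fix i j assume "i < dim_row (?L * wronsk_mat n D z)" "j < dim_col (?L * wronsk_mat n D z)"
    then have ij: "i < Suc n" "j < Suc n" by (simp_all add: wronsk_mat_def)
    have "(?L * wronsk_mat n D z) $$ (i, j) = (\<Sum>k<Suc n. (if i = k then l else if k = 0 then D (i - 1) l else 0) *
       (if k = 0 then z j else D (k - 1) (z j)))"
      using ij by (simp add: wronsk_mat_def scalar_prod_def lessThan_atLeast0)
    also have "\<dots> = (\<Sum>k<Suc n. (if k = i then l * (if k = 0 then z j else D (k - 1) (z j)) else 0)
       + (if k = 0 then (if i = 0 then 0 else D (i - 1) l * z j) else 0))"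
      by (rule sum.cong) auto
    also have "\<dots> = l * (if i = 0 then z j else D (i - 1) (z j)) + (if i = 0 then 0 else D (i - 1) l * z j)"
      using ij by (simp add: sum.distrib del: sum.lessThan_Suc)
    also have "\<dots> = wronsk_mat n D (\<lambda>j. l * z j) $$ (i, j)"
      using ij der_mult[OF K D[of "i - 1"] l, of "z j"] z[of j] by (auto simp: wronsk_mat_def)
    finally show "wronsk_mat n D (\<lambda>j. l * z j) $$ (i, j) = (?L * wronsk_mat n D z) $$ (i, j)" by simp
  qed (simp_all add: wronsk_mat_def)
  moreover have "det ?L = l ^ Suc n"
  proof -
    have "det ?L = prod_list (diag_mat ?L)" by (rule det_lower_triangular[OF _ L]) auto
    also have "\<dots> = (\<Prod>i=0..<Suc n. ?L $$ (i, i))" by (simp add: prod_list_diag_prod del: prod.op_ivl_Suc)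
    also have "\<dots> = (\<Prod>i=0..<Suc n. l)" by (rule prod.cong) auto
    finally show ?thesis by (simp del: prod.op_ivl_Suc)
  qed
  ultimately show ?thesis unfolding wronsk_def by (simp add: det_mult[OF L])
qed

text \<open>
  Constancy of the coefficients \<open>c\<close> is replaced by the second assumption, that the derivations act on the
  combinations as if the coefficients were constant; \<open>frame_expansion\<close> below provides such combinations.
\<close>

lemma wronsk_lin:
  assumes "\<And>j. j \<le> n \<Longrightarrow> b j = (\<Sum>k\<le>n. c j k * z k)"
    and "\<And>i j. i < n \<Longrightarrow> j \<le> n \<Longrightarrow> D i (b j) = (\<Sum>k\<le>n. c j k * D i (z k))"
  shows "wronsk n D b = det (mat (Suc n) (Suc n) (\<lambda>(k, j). c j k)) * wronsk n D z"
proof -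
  let ?C = "mat (Suc n) (Suc n) (\<lambda>(k, j). c j k)"
  have C: "?C \<in> carrier_mat (Suc n) (Suc n)" by simp
  have "wronsk_mat n D b = wronsk_mat n D z * ?C"
  proof (rule eq_matI)
    fix i j assume "i < dim_row (wronsk_mat n D z * ?C)" "j < dim_col (wronsk_mat n D z * ?C)"
    then have ij: "i < Suc n" "j < Suc n" by (simp_all add: wronsk_mat_def)
    have "(wronsk_mat n D z * ?C) $$ (i, j) = (\<Sum>k<Suc n. (if i = 0 then z k else D (i - 1) (z k)) * c j k)"
      using ij by (simp add: wronsk_mat_def scalar_prod_def lessThan_atLeast0)
    also have "\<dots> = wronsk_mat n D b $$ (i, j)"
      using ij assms(1)[of j] assms(2)[of "i - 1" j]
      by (auto simp: wronsk_mat_def mult.commute lessThan_Suc_atMost)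
    finally show "wronsk_mat n D b $$ (i, j) = (wronsk_mat n D z * ?C) $$ (i, j)" by simp
  qed (simp_all add: wronsk_mat_def)
  then show ?thesis unfolding wronsk_def by (simp add: det_mult[OF wronsk_mat_carrier C] mult.commute)
qed

text \<open>
  As $1/z = z \cdot z^{-2}$ and $D(1/z) = - D z \cdot z^{-2}$, every column is scaled by a square
  and the $n$ rows of derivatives change sign.
\<close>

lemma wronsk_inverse:
  assumes K: "subring_set K" and D: "\<And>i. i < n \<Longrightarrow> D i \<in> derivs K"
    and z: "\<And>j. j \<le> n \<Longrightarrow> z j \<in> K \<and> inverse (z j) \<in> K \<and> z j \<noteq> 0"
  shows "wronsk n D (\<lambda>j. inverse (z j)) = (-1) ^ n * (\<Prod>j\<le>n. inverse (z j))\<^sup>2 * wronsk n D z"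
proof -
  let ?A = "mat (Suc n) (Suc n) (\<lambda>(i, j). if i = j then (if i = 0 then 1 else -1) else (0::'a))"
  let ?C = "mat (Suc n) (Suc n) (\<lambda>(i, j). if i = j then (inverse (z j))\<^sup>2 else 0)"
  have A: "?A \<in> carrier_mat (Suc n) (Suc n)" and C: "?C \<in> carrier_mat (Suc n) (Suc n)" by simp_all
  have "wronsk_mat n D (\<lambda>j. inverse (z j)) = ?A * (wronsk_mat n D z * ?C)"
  proof (rule eq_matI)
    fix i j assume "i < dim_row (?A * (wronsk_mat n D z * ?C))" "j < dim_col (?A * (wronsk_mat n D z * ?C))"
    then have ij: "i < Suc n" "j < Suc n" by (simp_all add: wronsk_mat_def)
    have zj: "z j \<in> K" "inverse (z j) \<in> K" "z j \<noteq> 0" using z[of j] ij by auto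
    have WC: "(wronsk_mat n D z * ?C) $$ (i, j) = (if i = 0 then z j else D (i - 1) (z j)) * (inverse (z j))\<^sup>2" if i: "i < Suc n" for i
    proof -
      have "(wronsk_mat n D z * ?C) $$ (i, j) = (\<Sum>k<Suc n. (if i = 0 then z k else D (i - 1) (z k)) * (if k = j then (inverse (z j))\<^sup>2 else 0))"
        using ij i by (simp add: wronsk_mat_def scalar_prod_def lessThan_atLeast0)
      also have "\<dots> = (\<Sum>k<Suc n. if k = j then (if i = 0 then z j else D (i - 1) (z j)) * (inverse (z j))\<^sup>2 else 0)"
        by (rule sum.cong) auto
      finally show ?thesis using ij by (simp del: sum.lessThan_Suc)
    qed
    have "(?A * M) $$ (i, j) = (\<Sum>k<Suc n. (if i = k then (if i = 0 then 1 else -1) else 0) * M $$ (k, j))"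
      if M: "M \<in> carrier_mat (Suc n) (Suc n)" for M
      using ij M by (simp add: scalar_prod_def lessThan_atLeast0 carrier_matD[OF M])
    from this[OF mult_carrier_mat[OF wronsk_mat_carrier C]]
    have "(?A * (wronsk_mat n D z * ?C)) $$ (i, j) = (\<Sum>k<Suc n. (if i = k then (if i = 0 then 1 else -1) else 0) * (wronsk_mat n D z * ?C) $$ (k, j))" .
    also have "\<dots> = (\<Sum>k<Suc n. if k = i then (if i = 0 then 1 else -1) * (wronsk_mat n D z * ?C) $$ (i, j) else 0)"
      by (rule sum.cong) auto
    also have "\<dots> = (if i = 0 then 1 else -1) * (wronsk_mat n D z * ?C) $$ (i, j)"
      using ij by (simp del: sum.lessThan_Suc index_mult_mat(1))
    also have "\<dots> = wronsk_mat n D (\<lambda>j. inverse (z j)) $$ (i, j)"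
      unfolding WC[OF ij(1)] using ij zj der_inverse[OF K D[of "i - 1"] zj]
      by (auto simp: wronsk_mat_def field_simps power2_eq_square)
    finally show "wronsk_mat n D (\<lambda>j. inverse (z j)) $$ (i, j) = (?A * (wronsk_mat n D z * ?C)) $$ (i, j)" by simp
  qed (simp_all add: wronsk_mat_def)
  moreover have "det ?A = (-1) ^ n"
  proof -
    have "det ?A = prod_list (diag_mat ?A)" by (rule det_lower_triangular[OF _ A]) auto
    also have "\<dots> = (\<Prod>i<Suc n. ?A $$ (i, i))"
      by (simp add: prod_list_diag_prod atLeast0LessThan del: prod.op_ivl_Suc prod.lessThan_Suc)
    also have "\<dots> = (\<Prod>i<Suc n. if i = 0 then 1 else -1)" by (rule prod.cong) auto
    finally show ?thesis by (simp only: prod.lessThan_Suc_shift) simp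
  qed
  moreover have "det ?C = (\<Prod>j\<le>n. inverse (z j))\<^sup>2"
  proof -
    have "det ?C = prod_list (diag_mat ?C)" by (rule det_lower_triangular[OF _ C]) auto
    also have "\<dots> = (\<Prod>i<Suc n. ?C $$ (i, i))"
      by (simp add: prod_list_diag_prod atLeast0LessThan del: prod.op_ivl_Suc prod.lessThan_Suc)
    also have "\<dots> = (\<Prod>i<Suc n. (inverse (z i))\<^sup>2)" by (rule prod.cong) auto
    finally show ?thesis by (simp add: prod_power_distrib lessThan_Suc_atMost)
  qed
  ultimately show ?thesis
    unfolding wronsk_def by (simp add: det_mult[OF A] det_mult[OF wronsk_mat_carrier C] mult_carrier_mat[OF wronsk_mat_carrier C])
qed

text \<open>
  If one of the functions is $1$, its column is $(1, 0, \dots, 0)$, and the determinant reduces to the usual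
  Jacobian of the affine coordinates.
\<close>

lemma wronsk_one:
  assumes "z 0 = 1" "\<And>i. i < n \<Longrightarrow> D i 1 = 0"
  shows "wronsk n D z = jac n D (\<lambda>j. z (Suc j))"
proof -
  have "wronsk n D z = (\<Sum>i<Suc n. wronsk_mat n D z $$ (i, 0) * cofactor (wronsk_mat n D z) i 0)"
    unfolding wronsk_def by (rule laplace_expansion_column) auto
  also have "\<dots> = (\<Sum>i<Suc n. if i = 0 then cofactor (wronsk_mat n D z) 0 0 else 0)"
    by (rule sum.cong) (use assms in \<open>auto simp: wronsk_mat_def\<close>)
  also have "\<dots> = cofactor (wronsk_mat n D z) 0 0" by (simp del: sum.lessThan_Suc)
  also have "mat_delete (wronsk_mat n D z) 0 0 = mat n n (\<lambda>(i, j). D i (z (Suc j)))"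
    by (rule eq_matI) (auto simp: mat_delete_def wronsk_mat_def)
  then have "cofactor (wronsk_mat n D z) 0 0 = jac n D (\<lambda>j. z (Suc j))"
    by (simp add: cofactor_def jac_def)
  finally show ?thesis .
qed

lemma wronsk_swap:
  assumes "k \<le> n"
  shows "wronsk n D (z \<circ> Transposition.transpose 0 k) = (if k = 0 then 1 else - 1) * wronsk n D z"
proof (cases "k = 0")
  case False
  have "wronsk_mat n D (z \<circ> Transposition.transpose 0 k) = swapcols 0 k (wronsk_mat n D z)"
    by (rule eq_matI) (use assms in \<open>auto simp: wronsk_mat_def mat_swapcols_def Transposition.transpose_def\<close>)
  then show ?thesis
    unfolding wronsk_def using False det_swapcols[of 0 "Suc n" k "wronsk_mat n D z"] assms by simp
qed simp

lemma wronsk_hom: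
  assumes K: "subring_set K" and h: "hom_on K h" and D: "\<And>i. i < n \<Longrightarrow> D i \<in> derivs K"
    and D': "\<And>i a. i < n \<Longrightarrow> a \<in> K \<Longrightarrow> D' i (h a) = h (D i a)" and z: "\<And>j. j \<le> n \<Longrightarrow> z j \<in> K"
  shows "h (wronsk n D z) = wronsk n D' (\<lambda>j. h (z j))"
proof -
  have "h (wronsk n D z) = det (mat (Suc n) (Suc n) (\<lambda>(i, j). h (if i = 0 then z j else D (i - 1) (z j))))"
    unfolding wronsk_def wronsk_mat_def
    by (rule ho_det[OF K h]) (use z D der_closed[OF K] in auto)
  also have "mat (Suc n) (Suc n) (\<lambda>(i, j). h (if i = 0 then z j else D (i - 1) (z j))) = wronsk_mat n D' (\<lambda>j. h (z j))"
    by (rule eq_matI) (use z D' in \<open>auto simp: wronsk_mat_def\<close>)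
  finally show ?thesis by (simp add: wronsk_def)
qed

lemma jac_hom:
  assumes K: "subring_set K" and h: "hom_on K h" and D: "\<And>i. i < n \<Longrightarrow> D i \<in> derivs K"
    and D': "\<And>i a. i < n \<Longrightarrow> a \<in> K \<Longrightarrow> D' i (h a) = h (D i a)" and z: "\<And>j. j < n \<Longrightarrow> z j \<in> K"
  shows "h (jac n D z) = jac n D' (\<lambda>j. h (z j))"
proof -
  have "h (jac n D z) = det (mat n n (\<lambda>(i, j). h (D i (z j))))"
    unfolding jac_def by (rule ho_det[OF K h]) (use z D der_closed[OF K] in auto)
  also have "mat n n (\<lambda>(i, j). h (D i (z j))) = mat n n (\<lambda>(i, j). D' i (h (z j)))"
    by (rule eq_matI) (use z D' in auto)
  finally show ?thesis by (simp add: jac_def)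
qed

section \<open>Local rings of projective space\<close>

lemma to_fract_power: "to_fract (x ^ k) = to_fract x ^ k"
  by (induction k) simp_all

lemma to_fract_prod: "to_fract (prod F T) = (\<Prod>t\<in>T. to_fract (F t))"
  by (induction T rule: infinite_finite_induct) simp_all

lemma Fract_conv: "Fraction_Field.Fract f g = to_fract f / to_fract g"
  by (simp add: to_fract_def)

text \<open>
  The carrier of the local ring of $P^N$ at \<open>Q\<close>, and below its maximal ideal, in terms of the embedding of polynomials
  into fractions. In particular \<open>loc N {0}\<close> is the function field of $P^N$.
\<close>

definition loc :: "nat \<Rightarrow> 'k::field mpol set \<Rightarrow> 'k mpol fract set" where
  "loc N Q = {to_fract f / to_fract g | f g d. f \<in> forms N d \<and> g \<in> forms N d \<and> g \<notin> Q}"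

definition locm :: "nat \<Rightarrow> 'k::field mpol set \<Rightarrow> 'k mpol fract set" where
  "locm N Q = {to_fract f / to_fract g | f g d. f \<in> forms N d \<and> g \<in> forms N d \<and> g \<notin> Q \<and> f \<in> Q}"

lemma ps_local_ring_simps [simp]:
  "carrier (ps_local_ring N Q) = loc N Q" "x \<otimes>\<^bsub>ps_local_ring N Q\<^esub> y = x * y" "\<one>\<^bsub>ps_local_ring N Q\<^esub> = 1"
  "\<zero>\<^bsub>ps_local_ring N Q\<^esub> = 0" "x \<oplus>\<^bsub>ps_local_ring N Q\<^esub> y = x + y"
  by (simp_all add: ps_local_ring_def loc_def Fract_conv)

lemma ps_local_max_eq: "ps_local_max N Q = locm N Q"
  by (simp add: ps_local_max_def locm_def Fract_conv)

lemma locI: "f \<in> forms N d \<Longrightarrow> g \<in> forms N d \<Longrightarrow> g \<notin> Q \<Longrightarrow> to_fract f / to_fract g \<in> loc N Q"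
  by (auto simp: loc_def)

lemma locmI: "f \<in> forms N d \<Longrightarrow> g \<in> forms N d \<Longrightarrow> g \<notin> Q \<Longrightarrow> f \<in> Q \<Longrightarrow> to_fract f / to_fract g \<in> locm N Q"
  by (auto simp: locm_def)

lemma locE:
  assumes "a \<in> loc N Q"
  obtains f g d where "a = to_fract f / to_fract g" "f \<in> forms N d" "g \<in> forms N d" "g \<notin> Q"
  using assms by (auto simp: loc_def)

lemma locmE:
  assumes "a \<in> locm N Q"
  obtains f g d where "a = to_fract f / to_fract g" "f \<in> forms N d" "g \<in> forms N d" "g \<notin> Q" "f \<in> Q"
  using assms by (auto simp: locm_def)

context
  fixes Q :: "'k::field mpol set" and N
  assumes Q: "Q \<in> proj_points N"
begin

lemma nz: "g \<notin> Q \<Longrightarrow> g \<noteq> 0"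
  using pp_zero[OF Q] by auto

lemma notin_mult: "f \<notin> Q \<Longrightarrow> g \<notin> Q \<Longrightarrow> f \<in> forms N d \<Longrightarrow> g \<in> forms N e \<Longrightarrow> f * g \<notin> Q"
  using pp_prime[OF Q] forms_polys by blast

lemma notin_power: "f \<notin> Q \<Longrightarrow> f \<in> forms N d \<Longrightarrow> f ^ k \<notin> Q"
  using pp_power[OF Q] forms_polys by blast

lemma loc_subring: "subring_set (loc N Q)"
  unfolding subring_set_def
proof (intro conjI ballI)
  have "to_fract 0 / to_fract 1 \<in> loc N Q" "to_fract 1 / to_fract 1 \<in> loc N Q"
    using pp_one[OF Q] by (intro locI[where d = 0]; simp)+
  then show "0 \<in> loc N Q" "1 \<in> loc N Q" by simp_all
next
  fix a assume "a \<in> loc N Q"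
  then obtain f g d where a: "a = to_fract f / to_fract g" "f \<in> forms N d" "g \<in> forms N d" "g \<notin> Q" by (rule locE)
  have "to_fract (- f) / to_fract g \<in> loc N Q" using a by (intro locI[where d = d]) auto
  then show "- a \<in> loc N Q" by (simp add: a)
next
  fix a b assume "a \<in> loc N Q" "b \<in> loc N Q"
  then obtain f g d f' g' d' where a: "a = to_fract f / to_fract g" "f \<in> forms N d" "g \<in> forms N d" "g \<notin> Q"
    and b: "b = to_fract f' / to_fract g'" "f' \<in> forms N d'" "g' \<in> forms N d'" "g' \<notin> Q"
    by (elim locE)
  have gg: "g * g' \<in> forms N (d + d')" "g * g' \<notin> Q" using a b notin_mult forms_mult by auto
  have nz': "g \<noteq> 0" "g' \<noteq> 0" using a b nz by auto
  have "f * g' \<in> forms N (d + d')" "f' * g \<in> forms N (d + d')"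
    using a b forms_mult[of f' N d' g d] forms_mult[of f N d g' d'] by (simp_all add: add.commute)
  then have "to_fract (f * g' + f' * g) / to_fract (g * g') \<in> loc N Q"
    by (intro locI[where d = "d + d'"] gg forms_add)
  then show "a + b \<in> loc N Q" using nz' by (simp add: a(1) b(1) field_simps)
  have "to_fract (f * f') / to_fract (g * g') \<in> loc N Q"
    using a b by (intro locI[where d = "d + d'"] gg forms_mult)
  then show "a * b \<in> loc N Q" using nz' by (simp add: a(1) b(1))
qed

lemma loc_Const: "to_fract (Const c) \<in> loc N Q"
  using locI[of "Const c" N 0 1 Q] pp_one[OF Q] by simp

lemma fract_in_locm_iff:
  assumes "f \<in> forms N d" "g \<in> forms N d" "g \<notin> Q"
  shows "to_fract f / to_fract g \<in> locm N Q \<longleftrightarrow> f \<in> Q"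
proof
  assume "to_fract f / to_fract g \<in> locm N Q"
  then obtain f' g' d' where *: "to_fract f / to_fract g = to_fract f' / to_fract g'"
     "f' \<in> forms N d'" "g' \<in> forms N d'" "g' \<notin> Q" "f' \<in> Q" by (rule locmE)
  have "g \<noteq> 0" "g' \<noteq> 0" using assms * nz by auto
  then have "to_fract (f * g') = to_fract (f' * g)" using * by (simp add: field_simps)
  then have "f * g' = f' * g" by (simp only: to_fract_eq_iff)
  also have "\<dots> \<in> Q" using * assms pp_mult[OF Q] forms_polys by blast
  finally show "f \<in> Q" using pp_prime[OF Q] * assms forms_polys by blast
qed (use assms in \<open>auto intro: locmI\<close>)

lemma locm_subset: "locm N Q \<subseteq> loc N Q"
  by (auto simp: locm_def loc_def)

lemma loc_unit_inverse:
  assumes "a \<in> loc N Q" "a \<notin> locm N Q"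
  shows "inverse a \<in> loc N Q" "inverse a \<notin> locm N Q" "a \<noteq> 0"
proof -
  from assms(1) obtain f g d where a: "a = to_fract f / to_fract g" "f \<in> forms N d" "g \<in> forms N d" "g \<notin> Q" by (rule locE)
  then have "f \<notin> Q" using assms(2) fract_in_locm_iff by auto
  then have "to_fract g / to_fract f \<in> loc N Q" "to_fract g / to_fract f \<notin> locm N Q"
    using a fract_in_locm_iff[of g d f] by (auto intro: locI)
  then show "inverse a \<in> loc N Q" "inverse a \<notin> locm N Q" by (simp_all add: a)
  show "a \<noteq> 0" using a \<open>f \<notin> Q\<close> nz by auto
qed

lemma locm_mult: "a \<in> locm N Q \<Longrightarrow> b \<in> loc N Q \<Longrightarrow> a * b \<in> locm N Q"
proof -
  assume "a \<in> locm N Q" "b \<in> loc N Q"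
  then obtain f g d f' g' d' where a: "a = to_fract f / to_fract g" "f \<in> forms N d" "g \<in> forms N d" "g \<notin> Q" "f \<in> Q"
    and b: "b = to_fract f' / to_fract g'" "f' \<in> forms N d'" "g' \<in> forms N d'" "g' \<notin> Q"
    by (elim locE locmE)
  have "to_fract (f * f') / to_fract (g * g') \<in> locm N Q"
    using a b notin_mult[of g g' d d'] pp_mult[OF Q, of f f'] forms_polys[of f' N d']
    by (intro locmI[where d = "d + d'"] forms_mult) auto
  then show ?thesis by (simp add: a(1) b(1))
qed

lemma locm_add: "a \<in> locm N Q \<Longrightarrow> b \<in> locm N Q \<Longrightarrow> a + b \<in> locm N Q"
proof -
  assume "a \<in> locm N Q" "b \<in> locm N Q"
  then obtain f g d f' g' d' where a: "a = to_fract f / to_fract g" "f \<in> forms N d" "g \<in> forms N d" "g \<notin> Q" "f \<in> Q"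
    and b: "b = to_fract f' / to_fract g'" "f' \<in> forms N d'" "g' \<in> forms N d'" "g' \<notin> Q" "f' \<in> Q"
    by (elim locmE)
  have nz': "g \<noteq> 0" "g' \<noteq> 0" using a b nz by auto
  have "to_fract (f * g' + f' * g) / to_fract (g * g') \<in> locm N Q"
  proof (rule locmI[where d = "d + d'"])
    show "f * g' + f' * g \<in> forms N (d + d')" using a b forms_mult[of f' N d' g d] forms_mult[of f N d g' d']
      by (auto simp: add.commute intro: forms_add)
    show "g * g' \<in> forms N (d + d')" "g * g' \<notin> Q" using a b notin_mult forms_mult by auto
    show "f * g' + f' * g \<in> Q" using a b pp_add[OF Q] pp_mult[OF Q] forms_polys by blast
  qed
  then show "a + b \<in> locm N Q" using nz' by (simp add: a(1) b(1) field_simps)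
qed

lemma one_notin_locm: "1 \<notin> locm N Q"
  using fract_in_locm_iff[of 1 0 1] pp_one[OF Q] by simp

lemma loc_mono: "Q' \<subseteq> Q \<Longrightarrow> loc N Q \<subseteq> loc N Q'"
  unfolding loc_def by blast

lemma loc_subset_K: "loc N Q \<subseteq> loc N {0}"
  using loc_mono[of "{0}"] pp_zero[OF Q] by auto

lemma aff_loc: "i \<le> N \<Longrightarrow> Var i \<notin> Q \<Longrightarrow> k \<le> N \<Longrightarrow> to_fract (Var k) / to_fract (Var i) \<in> loc N Q"
  by (intro locI[where d = 1]) auto

end

lemma K_subring: "subring_set (loc N {0})"
  by (rule loc_subring[OF zero_pp])

lemma K_inverse: "a \<in> loc N {0} \<Longrightarrow> inverse a \<in> loc N {0}"
proof -
  assume "a \<in> loc N {0}"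
  then obtain f g d where a: "a = to_fract f / to_fract g" "f \<in> forms N d" "g \<in> forms N d" "g \<notin> {0}" by (rule locE)
  show ?thesis
  proof (cases "f = 0")
    case True
    then show ?thesis using sr_0[OF K_subring] a by auto
  next
    case False
    then show ?thesis using a locI[of g N d f "{0}"] by simp
  qed
qed

text \<open>
  The $k$-derivations of the function field of $P^n$; only their values on \<open>loc n {0}\<close> matter.
\<close>

definition Ders :: "nat \<Rightarrow> ('k::field mpol fract \<Rightarrow> 'k mpol fract) set" where
  "Ders n = {D \<in> derivs (loc n {0}). \<forall>c. D (to_fract (Const c)) = 0}"

definition aff :: "nat \<Rightarrow> nat \<Rightarrow> 'k::field mpol fract" where
  "aff i k = to_fract (Var k) / to_fract (Var i)"

lemma Ders_derivs: "D \<in> Ders n \<Longrightarrow> D \<in> derivs (loc n {0})"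
  by (simp add: Ders_def)

lemma aff_K: "i \<le> n \<Longrightarrow> k \<le> n \<Longrightarrow> aff i k \<in> loc n {0}"
  unfolding aff_def by (rule aff_loc[OF zero_pp]) auto

lemma aff_self [simp]: "aff i i = 1"
  by (simp add: aff_def)

text \<open>
  The differentials of the affine coordinates $x_k / x_i$ generate the module of differentials of the local ring:
  the functions whose differential is such a combination contain the constants and the coordinates and are closed under sums, products
  and inverses of units, hence exhaust the local ring.
\<close>

lemma frame_derivation:
  assumes Q: "Q \<in> proj_points n" and i: "i \<le> n" "Var i \<notin> Q" and a: "a \<in> loc n Q"
  shows "\<exists>c. (\<forall>k\<le>n. c k \<in> loc n Q) \<and> (\<forall>D\<in>Ders n. D a = (\<Sum>k\<le>n. c k * D (aff i k)))"
proof -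
  define S where "S = {a \<in> loc n Q. \<exists>c. (\<forall>k\<le>n. c k \<in> loc n Q) \<and> (\<forall>D\<in>Ders n. D a = (\<Sum>k\<le>n. c k * D (aff i k)))}"
  note sr = loc_subring[OF Q]
  note K = K_subring[of n]
  have LK: "x \<in> loc n {0}" if "x \<in> loc n Q" for x using loc_subset_K[OF Q] that by blast
  have SI: "x \<in> S" if "x \<in> loc n Q" "\<And>k. k \<le> n \<Longrightarrow> c k \<in> loc n Q" "\<And>D. D \<in> Ders n \<Longrightarrow> D x = (\<Sum>k\<le>n. c k * D (aff i k))"
    for x c using that unfolding S_def by blast
  have SE: "\<exists>c. x \<in> loc n Q \<and> (\<forall>k\<le>n. c k \<in> loc n Q) \<and> (\<forall>D\<in>Ders n. D x = (\<Sum>k\<le>n. c k * D (aff i k)))" if "x \<in> S" for x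
    using that unfolding S_def by blast
  have S_Const: "to_fract (Const c) \<in> S" for c
    by (rule SI[of _ "\<lambda>_. 0"]) (auto simp: loc_Const[OF Q] sr_0[OF sr] Ders_def)
  have S_aff: "aff i k \<in> S" if "k \<le> n" for k
  proof (rule SI[of _ "\<lambda>l. if l = k then 1 else 0"])
    show "aff i k \<in> loc n Q" unfolding aff_def by (rule aff_loc[OF Q i that])
    show "D (aff i k) = (\<Sum>l\<le>n. (if l = k then 1 else 0) * D (aff i l))" for D :: "'a mpol fract \<Rightarrow> 'a mpol fract"
      using that by (simp add: if_distrib[of "\<lambda>x. x * _"] cong: if_cong)
  qed (auto simp: sr_0[OF sr] sr_1[OF sr])
  have S_add: "x + y \<in> S" if xy: "x \<in> S" "y \<in> S" for x y
  proof -
    from SE[OF xy(1)] SE[OF xy(2)] obtain c c' where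
      *: "x \<in> loc n Q" "\<forall>k\<le>n. c k \<in> loc n Q" "\<forall>D\<in>Ders n. D x = (\<Sum>k\<le>n. c k * D (aff i k))"
       "y \<in> loc n Q" "\<forall>k\<le>n. c' k \<in> loc n Q" "\<forall>D\<in>Ders n. D y = (\<Sum>k\<le>n. c' k * D (aff i k))" by blast
    show ?thesis
      by (rule SI[of _ "\<lambda>k. c k + c' k"])
        (use * in \<open>auto simp: sr_add[OF sr] der_add[OF K Ders_derivs LK LK] sum.distrib algebra_simps\<close>)
  qed
  have S_mult: "x * y \<in> S" if xy: "x \<in> S" "y \<in> S" for x y
  proof -
    from SE[OF xy(1)] SE[OF xy(2)] obtain c c' where
      *: "x \<in> loc n Q" "\<forall>k\<le>n. c k \<in> loc n Q" "\<forall>D\<in>Ders n. D x = (\<Sum>k\<le>n. c k * D (aff i k))"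
       "y \<in> loc n Q" "\<forall>k\<le>n. c' k \<in> loc n Q" "\<forall>D\<in>Ders n. D y = (\<Sum>k\<le>n. c' k * D (aff i k))" by blast
    show ?thesis
    proof (rule SI[of _ "\<lambda>k. y * c k + x * c' k"])
      fix D :: "'a mpol fract \<Rightarrow> 'a mpol fract" assume D: "D \<in> Ders n"
      have "D (x * y) = y * D x + x * D y"
        using * by (simp add: der_mult[OF K Ders_derivs[OF D] LK LK] mult.commute)
      also have "\<dots> = y * (\<Sum>k\<le>n. c k * D (aff i k)) + x * (\<Sum>k\<le>n. c' k * D (aff i k))"
        using *(3,6) D by (metis (lifting))
      also have "\<dots> = (\<Sum>k\<le>n. (y * c k + x * c' k) * D (aff i k))"
        by (simp add: sum_distrib_left sum.distrib algebra_simps)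
      finally show "D (x * y) = (\<Sum>k\<le>n. (y * c k + x * c' k) * D (aff i k))" .
    qed (use * in \<open>auto simp: sr_add[OF sr] sr_mult[OF sr]\<close>)
  qed
  have S_inv: "inverse x \<in> S" if x: "x \<in> S" "x \<notin> locm n Q" for x
  proof -
    from SE[OF x(1)] obtain c where
      *: "x \<in> loc n Q" "\<forall>k\<le>n. c k \<in> loc n Q" "\<forall>D\<in>Ders n. D x = (\<Sum>k\<le>n. c k * D (aff i k))" by blast
    note u = loc_unit_inverse[OF Q *(1) x(2)]
    show ?thesis
    proof (rule SI[of _ "\<lambda>k. - ((inverse x)\<^sup>2 * c k)"])
      fix D :: "'a mpol fract \<Rightarrow> 'a mpol fract" assume D: "D \<in> Ders n"
      show "D (inverse x) = (\<Sum>k\<le>n. - ((inverse x)\<^sup>2 * c k) * D (aff i k))"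
      proof -
        have "D x = (\<Sum>k\<le>n. c k * D (aff i k))" using *(3) D by blast
        then show ?thesis
          unfolding der_inverse[OF K Ders_derivs[OF D] LK[OF *(1)] LK[OF u(1)] u(3)]
          by (simp add: sum_distrib_left sum_negf divide_inverse power_inverse mult_ac)
      qed
    qed (use u * in \<open>auto simp: sr_uminus[OF sr] sr_mult[OF sr] sr_power[OF sr]\<close>)
  qed
  have S_1: "1 \<in> S" using S_Const[of 1] by simp
  have S_pow: "x ^ k \<in> S" if "x \<in> S" for x k using that by (induction k) (auto simp: S_1 S_mult)
  have S_prod: "prod F T \<in> S" if "\<And>t. t \<in> T \<Longrightarrow> F t \<in> S" for F and T :: "nat set"
    using that by (induction T rule: infinite_finite_induct) (auto simp: S_1 S_mult)
  have S_form: "to_fract f / to_fract (Var i) ^ d \<in> S" if "f \<in> forms n d" for f d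
    using that
  proof (induction rule: forms_induct)
    case zero
    then show ?case using S_Const[of 0] by simp
  next
    case (add f g)
    then show ?case using S_add by (simp add: add_divide_distrib)
  next
    case (monom c m)
    have "to_fract (monom_val Var m) / to_fract (Var i) ^ d
        = (\<Prod>k\<le>n. to_fract (Var k) ^ Poly_Mapping.lookup m k) / (\<Prod>k\<le>n. to_fract (Var i) ^ Poly_Mapping.lookup m k)"
      using monom by (simp add: monom_val_superset[of "{..n}"] to_fract_prod to_fract_power flip: power_sum)
    also have "\<dots> = (\<Prod>k\<le>n. aff i k ^ Poly_Mapping.lookup m k)"
      by (simp add: prod_dividef aff_def power_divide)
    also have "\<dots> \<in> S" by (intro S_prod S_pow S_aff) auto
    finally have "to_fract (Const c) * (to_fract (monom_val Var m) / to_fract (Var i) ^ d) \<in> S" by (rule S_mult[OF S_Const])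
    then show ?case by simp
  qed
  from a obtain f g d where fg: "a = to_fract f / to_fract g" "f \<in> forms n d" "g \<in> forms n d" "g \<notin> Q" by (rule locE)
  have "to_fract g / to_fract (Var i ^ d) \<notin> locm n Q"
    using fract_in_locm_iff[OF Q fg(3), of "Var i ^ d"] forms_power[OF Var_forms(1)[OF i(1)], of d] fg
      notin_power[OF Q i(2) Var_forms(1)[OF i(1)]] by simp
  then have "inverse (to_fract g / to_fract (Var i) ^ d) \<in> S"
    using S_form[OF fg(3)] by (intro S_inv) (auto simp: to_fract_power)
  then have "to_fract f / to_fract (Var i) ^ d * inverse (to_fract g / to_fract (Var i) ^ d) \<in> S"
    using S_mult S_form[OF fg(2)] by blast
  then have "a \<in> S" by (simp add: fg(1))
  then show ?thesis unfolding S_def by blast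
qed

text \<open>
  The coordinate $x_i / x_i = 1$ has derivative $0$, so its coefficient in \<open>frame_derivation\<close> is free; it is
  adjusted until the combination also represents \<open>a\<close> itself.
\<close>

lemma frame_expansion:
  assumes Q: "Q \<in> proj_points n" and i: "i \<le> n" "Var i \<notin> Q" and a: "a \<in> loc n Q"
  shows "\<exists>c. (\<forall>k\<le>n. c k \<in> loc n Q) \<and> a = (\<Sum>k\<le>n. c k * aff i k) \<and>
     (\<forall>D\<in>Ders n. D a = (\<Sum>k\<le>n. c k * D (aff i k)))"
proof -
  note sr = loc_subring[OF Q]
  from frame_derivation[OF assms] obtain c where c: "\<forall>k\<le>n. c k \<in> loc n Q"
    "\<forall>D\<in>Ders n. D a = (\<Sum>k\<le>n. c k * D (aff i k))" by blast
  define c' where "c' = (\<lambda>k. if k = i then a - (\<Sum>k\<in>{..n}-{i}. c k * aff i k) else c k)"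
  have al: "aff i k \<in> loc n Q" if "k \<le> n" for k
    unfolding aff_def by (rule aff_loc[OF Q i that])
  have "c' k \<in> loc n Q" if "k \<le> n" for k
    using c(1) that a unfolding c'_def
    by (auto simp: al intro!: sr_diff[OF sr] sr_sum[OF sr] sr_mult[OF sr])
  moreover have split: "(\<Sum>k\<le>n. F k) = F i + (\<Sum>k\<in>{..n}-{i}. F k)" for F :: "nat \<Rightarrow> 'a mpol fract"
    using i by (simp add: sum.remove)
  have r: "(\<Sum>k\<in>{..n}-{i}. c' k * F k) = (\<Sum>k\<in>{..n}-{i}. c k * F k)" for F
    by (rule sum.cong) (auto simp: c'_def)
  have "a = (\<Sum>k\<le>n. c' k * aff i k)" unfolding split[of "\<lambda>k. c' k * aff i k"] r by (simp add: c'_def)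
  moreover have "D a = (\<Sum>k\<le>n. c' k * D (aff i k))" if D: "D \<in> Ders n" for D
  proof -
    have "D (aff i i) = 0" using der_1[OF K_subring Ders_derivs[OF D]] by simp
    moreover have "D a = (\<Sum>k\<le>n. c k * D (aff i k))" using c(2) D by blast
    ultimately show ?thesis unfolding split[of "\<lambda>k. c' k * D (aff i k)"] split[of "\<lambda>k. c k * D (aff i k)"] r
      by simp
  qed
  ultimately show ?thesis by blast
qed

definition Dtuple :: "nat \<Rightarrow> (nat \<Rightarrow> 'k::field mpol fract \<Rightarrow> 'k mpol fract) \<Rightarrow> bool" where
  "Dtuple n D \<longleftrightarrow> (\<forall>i<n. D i \<in> Ders n)"

text \<open>
  The determinant of the coefficients from \<open>frame_expansion\<close> is the factor. Consequently $W(x/x_i)$ generates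
  the canonical stalk at each point where $x_i$ does not vanish.
\<close>

lemma frame_wronsk:
  assumes Q: "Q \<in> proj_points n" and i: "i \<le> n" "Var i \<notin> Q" and b: "\<And>j. j \<le> n \<Longrightarrow> b j \<in> loc n Q"
  shows "\<exists>r\<in>loc n Q. \<forall>D. Dtuple n D \<longrightarrow> wronsk n D b = r * wronsk n D (aff i)"
proof -
  have "\<forall>j. \<exists>c. j \<le> n \<longrightarrow> (\<forall>k\<le>n. c k \<in> loc n Q) \<and> b j = (\<Sum>k\<le>n. c k * aff i k) \<and>
     (\<forall>D\<in>Ders n. D (b j) = (\<Sum>k\<le>n. c k * D (aff i k)))"
    using frame_expansion[OF Q i b] by blast
  then obtain c where c: "\<And>j. j \<le> n \<Longrightarrow> (\<forall>k\<le>n. c j k \<in> loc n Q) \<and> b j = (\<Sum>k\<le>n. c j k * aff i k) \<and>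
     (\<forall>D\<in>Ders n. D (b j) = (\<Sum>k\<le>n. c j k * D (aff i k)))" using choice[of "\<lambda>j c. j \<le> n \<longrightarrow> (\<forall>k\<le>n. c k \<in> loc n Q) \<and> b j = (\<Sum>k\<le>n. c k * aff i k) \<and>
     (\<forall>D\<in>Ders n. D (b j) = (\<Sum>k\<le>n. c k * D (aff i k)))"] by blast
  let ?r = "det (mat (Suc n) (Suc n) (\<lambda>(k, j). c j k))"
  have "?r \<in> loc n Q" by (rule sr_det[OF loc_subring[OF Q]]) (use c in auto)
  moreover have "wronsk n D b = ?r * wronsk n D (aff i)" if "Dtuple n D" for D
    by (rule wronsk_lin) (use c that in \<open>auto simp: Dtuple_def\<close>)
  ultimately show ?thesis by blast
qed

lemma aff_change: "aff i' k = aff i' i * aff i k"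
  by (simp add: aff_def)

lemma wronsk_aff_change:
  assumes "i \<le> n" "i' \<le> n" "Dtuple n D"
  shows "wronsk n D (aff i') = aff i' i ^ Suc n * wronsk n D (aff i)"
proof -
  have "wronsk n D (aff i') = wronsk n D (\<lambda>k. aff i' i * aff i k)"
    by (rule wronsk_cong) (rule aff_change)
  also have "\<dots> = aff i' i ^ Suc n * wronsk n D (aff i)"
    by (rule wronsk_scale[OF K_subring[of n]]) (use assms in \<open>auto simp: Dtuple_def Ders_derivs aff_K\<close>)
  finally show ?thesis .
qed

section \<open>Function fields and proportional tuples\<close>

context
  fixes P :: "'k::field mpol set" and N
  assumes P: "P \<in> proj_points N"
begin

lemma plr_cring: "cring (ps_local_ring N P)"
  by (rule cringI; (rule abelian_groupI comm_monoidI)?)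
     (auto simp: sr_add[OF loc_subring[OF P]] sr_mult[OF loc_subring[OF P]] sr_0[OF loc_subring[OF P]]
        sr_1[OF loc_subring[OF P]] algebra_simps intro: bexI[of _ "- x" for x] sr_uminus[OF loc_subring[OF P]])

lemma locm_0: "0 \<in> locm N P"
  using locmI[of 0 N 0 1 P] pp_zero[OF P] pp_one[OF P] by simp

lemma locm_uminus: "a \<in> locm N P \<Longrightarrow> - a \<in> locm N P"
  using locm_mult[OF P, of a "- 1"] sr_uminus[OF loc_subring[OF P] sr_1[OF loc_subring[OF P]]] by simp

lemma locm_ideal: "ideal (locm N P) (ps_local_ring N P)"
proof -
  interpret R: cring "ps_local_ring N P" by (rule plr_cring)
  show ?thesis
  proof (rule idealI)
    show "ring (ps_local_ring N P)" by (rule R.ring_axioms)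
    show "subgroup (locm N P) (add_monoid (ps_local_ring N P))"
    proof (rule group.subgroupI)
      show "Group.group (add_monoid (ps_local_ring N P))" by (rule R.add.is_group)
      show "locm N P \<subseteq> carrier (add_monoid (ps_local_ring N P))" using locm_subset[OF P] by simp
      show "locm N P \<noteq> {}" using locm_0 by auto
      fix a assume a: "a \<in> locm N P"
      have "inv\<^bsub>add_monoid (ps_local_ring N P)\<^esub> a = - a"
        using a R.minus_equality[of "- a" a] locm_subset[OF P] sr_uminus[OF loc_subring[OF P]]
        by (auto simp: a_inv_def)
      then show "inv\<^bsub>add_monoid (ps_local_ring N P)\<^esub> a \<in> locm N P" using locm_uminus[OF a] by simp
    next
      fix a b assume "a \<in> locm N P" "b \<in> locm N P"
      then show "a \<otimes>\<^bsub>add_monoid (ps_local_ring N P)\<^esub> b \<in> locm N P" using locm_add[OF P] by simp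
    qed
    fix a x assume "a \<in> locm N P" "x \<in> carrier (ps_local_ring N P)"
    then show "x \<otimes>\<^bsub>ps_local_ring N P\<^esub> a \<in> locm N P" "a \<otimes>\<^bsub>ps_local_ring N P\<^esub> x \<in> locm N P"
      using locm_mult[OF P, of a x] by (simp_all add: mult.commute)
  qed
qed

lemma function_field_eq: "function_field (N, P) = ps_local_ring N P Quot locm N P"
  by (simp add: function_field_def ps_local_max_eq)

lemma rat_fun_eq: "rat_fun (N, P) a = {h + a | h. h \<in> locm N P}"
  by (auto simp: rat_fun_def ps_local_max_eq a_r_coset_def')

lemma ff_cring: "cring (function_field (N, P))"
  unfolding function_field_eq by (rule ideal.quotient_is_cring[OF locm_ideal plr_cring])

lemma rf_hom: "(+>\<^bsub>ps_local_ring N P\<^esub>) (locm N P) \<in> Ring.ring_hom (ps_local_ring N P) (function_field (N, P))"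
  unfolding function_field_eq by (rule ideal.rcos_ring_hom[OF locm_ideal])

lemma rat_fun_eq': "rat_fun (N, P) a = locm N P +>\<^bsub>ps_local_ring N P\<^esub> a"
  by (simp add: rat_fun_def ps_local_max_eq)

lemma rf_mult: "a \<in> loc N P \<Longrightarrow> b \<in> loc N P \<Longrightarrow>
   rat_fun (N, P) a \<otimes>\<^bsub>function_field (N, P)\<^esub> rat_fun (N, P) b = rat_fun (N, P) (a * b)"
  using ring_hom_mult[OF rf_hom, of a b] by (simp add: rat_fun_eq')

lemma rf_add: "a \<in> loc N P \<Longrightarrow> b \<in> loc N P \<Longrightarrow>
   rat_fun (N, P) a \<oplus>\<^bsub>function_field (N, P)\<^esub> rat_fun (N, P) b = rat_fun (N, P) (a + b)"
  using ring_hom_add[OF rf_hom, of a b] by (simp add: rat_fun_eq')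

lemma rf_one: "\<one>\<^bsub>function_field (N, P)\<^esub> = rat_fun (N, P) 1"
  using ring_hom_one[OF rf_hom] by (simp add: rat_fun_eq')

lemma rf_zero: "\<zero>\<^bsub>function_field (N, P)\<^esub> = rat_fun (N, P) 0"
  using ring_hom_zero[OF rf_hom cring.axioms(1)[OF plr_cring] cring.axioms(1)[OF ff_cring]]
  by (simp add: rat_fun_eq')

lemma rf_closed: "a \<in> loc N P \<Longrightarrow> rat_fun (N, P) a \<in> carrier (function_field (N, P))"
  using ring_hom_closed[OF rf_hom, of a] by (simp add: rat_fun_eq')

lemma ff_carrier: "carrier (function_field (N, P)) = rat_fun (N, P) ` loc N P"
  unfolding function_field_eq FactRing_def A_RCOSETS_def' by (auto simp: rat_fun_eq')

lemma rat_fun_eq_iff: "a \<in> loc N P \<Longrightarrow> b \<in> loc N P \<Longrightarrow>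
   rat_fun (N, P) a = rat_fun (N, P) b \<longleftrightarrow> a - b \<in> locm N P"
proof
  assume "rat_fun (N, P) a = rat_fun (N, P) b"
  moreover have "a \<in> rat_fun (N, P) a" using locm_0 by (force simp: rat_fun_eq)
  ultimately show "a - b \<in> locm N P" by (auto simp: rat_fun_eq)
next
  assume "a - b \<in> locm N P"
  note ab = this
  have "(\<exists>h'. h + a = h' + b \<and> h' \<in> locm N P)" "(\<exists>h'. h + b = h' + a \<and> h' \<in> locm N P)" if "h \<in> locm N P" for h
    using locm_add[OF P that ab] locm_add[OF P that locm_uminus[OF ab]]
    by (intro exI[of _ "h + (a - b)"] exI[of _ "h + - (a - b)"]; simp)+
  then show "rat_fun (N, P) a = rat_fun (N, P) b" unfolding rat_fun_eq by blast
qed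

lemma ffE:
  assumes "x \<in> carrier (function_field (N, P))"
  obtains f g d where "x = rat_fun (N, P) (to_fract f / to_fract g)" "f \<in> forms N d" "g \<in> forms N d" "g \<notin> P"
  using assms by (auto simp: ff_carrier elim!: locE)

lemma rat_fun_fract_eq_iff:
  assumes "f \<in> forms N d" "g \<in> forms N d" "g \<notin> P" "f' \<in> forms N d'" "g' \<in> forms N d'" "g' \<notin> P"
  shows "rat_fun (N, P) (to_fract f / to_fract g) = rat_fun (N, P) (to_fract f' / to_fract g') \<longleftrightarrow>
     f * g' - f' * g \<in> P"
proof -
  have nz': "g \<noteq> 0" "g' \<noteq> 0" using assms nz[OF P] by auto
  then have e: "to_fract f / to_fract g - to_fract f' / to_fract g' = to_fract (f * g' - f' * g) / to_fract (g * g')"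
    by (simp add: field_simps)
  have "f * g' - f' * g \<in> forms N (d + d')"
    using forms_mult[OF assms(4,2)] forms_mult[OF assms(1,5)] by (simp add: add.commute forms_diff)
  moreover have "g * g' \<in> forms N (d + d')" "g * g' \<notin> P"
    using assms notin_mult[OF P assms(3,6)] forms_mult by auto
  ultimately show ?thesis
    using assms by (subst rat_fun_eq_iff) (auto intro: locI simp: e fract_in_locm_iff[OF P] simp del: to_fract_mult to_fract_diff)
qed

end

lemma rat_fun_space: "rat_fun (n, {0}) a = {a}"
proof -
  have "locm n {0} = {0}" using locm_0[OF zero_pp] by (auto simp: locm_def)
  then show ?thesis using rat_fun_eq[OF zero_pp, of n a] by auto
qed

text \<open>
  Proportionality of tuples modulo \<open>P\<close>: the relation between two representatives of one rational map on the variety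
  of \<open>P\<close>.
\<close>

definition prop_mod :: "nat \<Rightarrow> 'k::field mpol set \<Rightarrow> (nat \<Rightarrow> 'k mpol) \<Rightarrow> (nat \<Rightarrow> 'k mpol) \<Rightarrow> bool" where
  "prop_mod M P v w \<longleftrightarrow> (\<forall>i\<le>M. \<forall>j\<le>M. v i * w j - v j * w i \<in> P)"

context
  fixes P :: "'k::field mpol set" and N M and v w :: "nat \<Rightarrow> 'k mpol"
  assumes P: "P \<in> proj_points N"
    and v: "\<And>i. i \<le> M \<Longrightarrow> v i \<in> polys N" and w: "\<And>i. i \<le> M \<Longrightarrow> w i \<in> polys N"
    and vw: "prop_mod M P v w"
begin

lemma cong_mult:
  assumes "a - b \<in> P" "c - d \<in> P" "a \<in> polys N" "b \<in> polys N" "c \<in> polys N" "d \<in> polys N"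
  shows "a * c - b * d \<in> P"
proof -
  have "a * c - b * d = (a - b) * c + b * (c - d)" by (simp add: algebra_simps)
  then show ?thesis using assms pp_add[OF P] pp_mult[OF P] pp_mult'[OF P] by auto
qed

lemma cong_power:
  assumes "a - b \<in> P" "a \<in> polys N" "b \<in> polys N"
  shows "a ^ k - b ^ k \<in> P"
proof (induction k)
  case (Suc k)
  show ?case unfolding power_Suc
    by (rule cong_mult[OF assms(1) Suc]) (use assms polys_power in auto)
qed (simp add: pp_zero[OF P])

lemma cong_prod:
  assumes "\<And>x. x \<in> T \<Longrightarrow> F x - G x \<in> P \<and> F x \<in> polys N \<and> G x \<in> polys N"
  shows "prod F T - prod G T \<in> P"
  using assms
  by (induction T rule: infinite_finite_induct) (auto simp: pp_zero[OF P] intro!: cong_mult polys_prod)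

text \<open>
  Modulo \<open>P\<close> one has $w_j v_k = v_j w_k$ for all $k$, and the form \<open>f\<close> is evaluated at both sides.
\<close>

lemma prop_subst:
  assumes f: "f \<in> forms M d" and j: "j \<le> M"
  shows "w j ^ d * subst v f - v j ^ d * subst w f \<in> P"
  using f
proof (induction rule: forms_induct)
  case zero
  then show ?case by (simp add: pp_zero[OF P])
next
  case (add f g)
  have "w j ^ d * subst v (f + g) - v j ^ d * subst w (f + g) =
     (w j ^ d * subst v f - v j ^ d * subst w f) + (w j ^ d * subst v g - v j ^ d * subst w g)"
    by (simp add: subst.mpeval_add algebra_simps)
  then show ?case using add pp_add[OF P] by simp
next
  case (monom c m)
  have e: "x ^ d * monom_val y m = (\<Prod>k\<le>M. (x * y k) ^ Poly_Mapping.lookup m k)" for x and y :: "nat \<Rightarrow> 'k mpol"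
    using monom by (simp add: monom_val_superset[of "{..M}"] power_mult_distrib prod.distrib flip: power_sum)
  have "(\<Prod>k\<le>M. (w j * v k) ^ Poly_Mapping.lookup m k) - (\<Prod>k\<le>M. (v j * w k) ^ Poly_Mapping.lookup m k) \<in> P"
  proof (rule cong_prod, intro conjI cong_power polys_power polys_mult)
    fix k assume k: "k \<in> {..M}"
    have "v k * w j - v j * w k \<in> P" using vw k j by (auto simp: prop_mod_def)
    then show "w j * v k - v j * w k \<in> P" by (simp add: mult.commute)
  qed (use v w j in auto)
  then have "w j ^ d * monom_val v m - v j ^ d * monom_val w m \<in> P" by (simp add: e)
  then have "(w j ^ d * monom_val v m - v j ^ d * monom_val w m) * Const c \<in> P" by (rule pp_mult[OF P]) simp
  then show ?case by (simp add: subst.mpeval_mult subst_monom_val algebra_simps)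
qed

lemma prop_notin:
  assumes "j \<le> M" "w j \<notin> P" "i \<le> M" "v i \<notin> P"
  shows "v j \<notin> P"
proof
  assume "v j \<in> P"
  then have "v j * w i \<in> P" using pp_mult[OF P] w assms by auto
  moreover have "v i * w j - v j * w i \<in> P" using vw assms by (auto simp: prop_mod_def)
  ultimately have "v i * w j \<in> P" using pp_add[OF P, of "v i * w j - v j * w i" "v j * w i"] by simp
  then show False using pp_prime[OF P] v w assms by blast
qed

lemma prop_subst_cross:
  assumes f: "f \<in> forms M d" and g: "g \<in> forms M d" and j: "j \<le> M" "w j \<notin> P"
  shows "subst v f * subst w g - subst v g * subst w f \<in> P"
proof -
  have pol: "subst v h \<in> polys N" "subst w h \<in> polys N" if "h \<in> forms M d" for h
    using subst_polys[OF forms_polys[OF that]] v w by auto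
  let ?a = "w j ^ d * subst v f - v j ^ d * subst w f" and ?b = "w j ^ d * subst v g - v j ^ d * subst w g"
  have "?a * subst w g - ?b * subst w f \<in> P"
    using pp_diff[OF P pp_mult[OF P prop_subst[OF f j(1)] pol(2)[OF g]] pp_mult[OF P prop_subst[OF g j(1)] pol(2)[OF f]]] .
  also have "?a * subst w g - ?b * subst w f = w j ^ d * (subst v f * subst w g - subst v g * subst w f)"
    by (simp add: algebra_simps)
  finally have "w j ^ d \<in> P \<or> subst v f * subst w g - subst v g * subst w f \<in> P"
    using pp_prime[OF P] w[OF j(1)] pol f g by (metis polys_power polys_mult polys_diff)
  then show ?thesis using pp_power[OF P w[OF j(1)]] j by blast
qed

lemma prop_subst_in:
  assumes f: "f \<in> forms M d" and j: "j \<le> M" "w j \<notin> P" and sv: "subst v f \<in> P"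
    and i: "i \<le> M" "v i \<notin> P"
  shows "subst w f \<in> P"
proof -
  have pol: "subst w f \<in> polys N" using subst_polys[OF forms_polys[OF f]] w by auto
  have "w j ^ d * subst v f \<in> P" using pp_mult'[OF P sv] w j polys_power by blast
  with prop_subst[OF f j(1)] have "v j ^ d * subst w f \<in> P"
    using pp_diff[OF P, of "w j ^ d * subst v f" "w j ^ d * subst v f - v j ^ d * subst w f"] by simp
  moreover have "v j ^ d \<notin> P" using prop_notin[OF j i] pp_power[OF P v[OF j(1)]] by blast
  ultimately show ?thesis using pp_prime[OF P polys_power[OF v[OF j(1)]] pol] by blast
qed

end

lemma prop_mod_sym: "P \<in> proj_points N \<Longrightarrow> prop_mod M P v w \<Longrightarrow> prop_mod M P w v"
  unfolding prop_mod_def by (metis pp_uminus minus_diff_eq mult.commute)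

section \<open>Rational maps and pullbacks\<close>

lemma same_mapD:
  assumes "same_map (N, P) (M, R) F F'"
  shows "rational_map (N, P) (M, R) F" "rational_map (N, P) (M, R) F'" "prop_mod M P F F'"
  using assms by (auto simp: same_map_def prop_mod_def)

lemma same_mapI:
  "rational_map (N, P) (M, R) F \<Longrightarrow> rational_map (N, P) (M, R) F' \<Longrightarrow> prop_mod M P F F' \<Longrightarrow>
    same_map (N, P) (M, R) F F'"
  by (auto simp: same_map_def prop_mod_def)

lemma rational_map_forms:
  "rational_map (N, P) (M, R) F \<Longrightarrow> \<exists>e. \<forall>i\<le>M. F i \<in> forms N e"
  by (auto simp: rational_map_def)

lemma rational_map_polys: "rational_map (N, P) (M, R) F \<Longrightarrow> i \<le> M \<Longrightarrow> F i \<in> polys N"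
  by (drule rational_map_forms) (auto dest: forms_polys)

lemma rational_map_notin: "rational_map (N, P) (M, R) F \<Longrightarrow> \<exists>i\<le>M. F i \<notin> P"
  by (auto simp: rational_map_def)

lemma rational_map_in: "rational_map (N, P) (M, R) F \<Longrightarrow> g \<in> R \<Longrightarrow> subst F g \<in> P"
  by (auto simp: rational_map_def)

context
  fixes P :: "'k::field mpol set" and N
  assumes P: "P \<in> proj_points N"
begin

lemma same_map_refl: "rational_map (N, P) (M, R) F \<Longrightarrow> same_map (N, P) (M, R) F F"
proof -
  have "F i * F j - F j * F i = 0" for i j by (simp add: mult.commute)
  then show "rational_map (N, P) (M, R) F \<Longrightarrow> same_map (N, P) (M, R) F F"
    by (simp add: same_map_def pp_zero[OF P])
qed

lemma same_map_sym: "same_map (N, P) (M, R) F F' \<Longrightarrow> same_map (N, P) (M, R) F' F"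
  by (rule same_mapI[OF same_mapD(2,1) prop_mod_sym[OF P same_mapD(3)]])

lemma same_map_trans:
  assumes 1: "same_map (N, P) (M, R) F F'" and 2: "same_map (N, P) (M, R) F' F''"
  shows "same_map (N, P) (M, R) F F''"
proof (rule same_mapI)
  show "rational_map (N, P) (M, R) F" "rational_map (N, P) (M, R) F''"
    using same_mapD(1)[OF 1] same_mapD(2)[OF 2] .
  note p = rational_map_polys[OF same_mapD(1)[OF 1]] rational_map_polys[OF same_mapD(1)[OF 2]] rational_map_polys[OF same_mapD(2)[OF 2]]
  obtain k where k: "k \<le> M" "F' k \<notin> P" using rational_map_notin[OF same_mapD(1)[OF 2]] by blast
  show "prop_mod M P F F''"
    unfolding prop_mod_def
  proof (intro allI impI)
    fix i j assume ij: "i \<le> M" "j \<le> M"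
    have c1: "F a * F' b - F b * F' a \<in> P" if "a \<le> M" "b \<le> M" for a b
      using same_mapD(3)[OF 1] that by (auto simp: prop_mod_def)
    have c2: "F' a * F'' b - F' b * F'' a \<in> P" if "a \<le> M" "b \<le> M" for a b
      using same_mapD(3)[OF 2] that by (auto simp: prop_mod_def)
    have pol: "F a \<in> polys N" "F' a \<in> polys N" "F'' a \<in> polys N" if "a \<le> M" for a
      using p that by auto
    have "(F i * F' k - F k * F' i) * F'' j \<in> P" by (rule pp_mult[OF P c1 pol(3)]) (use ij k in auto)
    moreover have "F k * (F' i * F'' j - F' j * F'' i) \<in> P" by (rule pp_mult'[OF P c2 pol(1)]) (use ij k in auto)
    moreover have "(F j * F' k - F k * F' j) * F'' i \<in> P" by (rule pp_mult[OF P c1 pol(3)]) (use ij k in auto)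
    ultimately have "(F i * F' k - F k * F' i) * F'' j + F k * (F' i * F'' j - F' j * F'' i)
        - (F j * F' k - F k * F' j) * F'' i \<in> P"
      by (intro pp_diff[OF P] pp_add[OF P])
    also have "(F i * F' k - F k * F' i) * F'' j + F k * (F' i * F'' j - F' j * F'' i)
        - (F j * F' k - F k * F' j) * F'' i = F' k * (F i * F'' j - F j * F'' i)"
      by (simp add: algebra_simps)
    finally show "F i * F'' j - F j * F'' i \<in> P"
      using pp_prime[OF P, of "F' k" "F i * F'' j - F j * F'' i"] k
        polys_diff[OF polys_mult[OF pol(1,3)] polys_mult[OF pol(1,3)]] pol(2) ij by blast
  qed
qed

lemma same_map_cross:
  assumes s: "same_map (N, P) (M, R) F F'" and f: "f \<in> forms M d" "g \<in> forms M d"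
  shows "subst F f * subst F' g - subst F g * subst F' f \<in> P"
proof -
  obtain j where j: "j \<le> M" "F' j \<notin> P" using rational_map_notin[OF same_mapD(2)[OF s]] by blast
  show ?thesis
    by (rule prop_subst_cross[OF P _ _ same_mapD(3)[OF s] f j])
       (use rational_map_polys[OF same_mapD(1)[OF s]] rational_map_polys[OF same_mapD(2)[OF s]] in auto)
qed

lemma same_map_in:
  assumes s: "same_map (N, P) (M, R) F F'" and f: "f \<in> forms M d" and sv: "subst F f \<in> P"
  shows "subst F' f \<in> P"
proof -
  obtain j where j: "j \<le> M" "F' j \<notin> P" using rational_map_notin[OF same_mapD(2)[OF s]] by blast
  obtain i where i: "i \<le> M" "F i \<notin> P" using rational_map_notin[OF same_mapD(1)[OF s]] by blast
  show ?thesis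
    by (rule prop_subst_in[OF P _ _ same_mapD(3)[OF s] f j sv i])
       (use rational_map_polys[OF same_mapD(1)[OF s]] rational_map_polys[OF same_mapD(2)[OF s]] in auto)
qed

end

text \<open>
  The image of the generic point of the source is the generic point of the target; this is
  what makes composition and pullback well defined.
\<close>

definition dominant :: "'k::field proj_var \<Rightarrow> 'k proj_var \<Rightarrow> (nat \<Rightarrow> 'k mpol) \<Rightarrow> bool" where
  "dominant V W F \<longleftrightarrow> rational_map V W F \<and> (\<forall>d. \<forall>f\<in>forms (fst W) d. subst F f \<in> snd V \<longrightarrow> f \<in> snd W)"

lemma dominantD:
  assumes "dominant (N, P) (M, R) F"
  shows "rational_map (N, P) (M, R) F" "f \<in> forms M d \<Longrightarrow> subst F f \<in> P \<Longrightarrow> f \<in> R"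
  using assms by (auto simp: dominant_def)

lemma inverse_maps_sym: "inverse_maps V W F G \<Longrightarrow> inverse_maps W V G F"
  by (auto simp: inverse_maps_def)

lemma inverse_maps_dominant:
  assumes R: "R \<in> proj_points M" and inv: "inverse_maps (N, P) (M, R) F G"
  shows "dominant (N, P) (M, R) F"
proof -
  have s: "same_map (M, R) (M, R) (comp_map F G) Var" and F: "rational_map (N, P) (M, R) F"
    and G: "rational_map (M, R) (N, P) G"
    using inv by (auto simp: inverse_maps_def)
  have "f \<in> R" if f: "f \<in> forms M d" "subst F f \<in> P" for f d
  proof -
    have "subst (comp_map F G) f \<in> R"
      using rational_map_in[OF G f(2)] by (simp add: subst_subst comp_map_def)
    from same_map_in[OF R s f(1) this] show ?thesis by simp
  qed
  with F show ?thesis by (auto simp: dominant_def)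
qed

lemma subst_comp_map: "subst (comp_map G F) f = subst F (subst G f)"
  by (simp add: comp_map_def subst_subst)

lemma comp_map_assoc: "comp_map (comp_map A B) C = comp_map A (comp_map B C)"
  by (simp add: comp_map_def subst_subst)

lemma comp_map_Var [simp]: "comp_map Var F = F" "comp_map F Var = F"
  by (simp_all add: comp_map_def)

lemma dominant_same:
  assumes P: "P \<in> proj_points N" and "dominant (N, P) (M, R) F" and s: "same_map (N, P) (M, R) F F'"
  shows "dominant (N, P) (M, R) F'"
proof -
  have "f \<in> R" if "f \<in> forms M d" "subst F' f \<in> P" for f d
    using dominantD(2)[OF assms(2) that(1) same_map_in[OF P same_map_sym[OF P s] that]] .
  then show ?thesis using same_mapD(2)[OF s] by (auto simp: dominant_def)
qed

lemma rational_map_comp: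
  assumes F: "dominant (N, P) (M, R) F" and G: "rational_map (M, R) (L, S) G"
  shows "rational_map (N, P) (L, S) (comp_map G F)"
proof -
  obtain e where e: "\<And>i. i \<le> M \<Longrightarrow> F i \<in> forms N e" using rational_map_forms[OF dominantD(1)[OF F]] by blast
  obtain e' where e': "\<And>i. i \<le> L \<Longrightarrow> G i \<in> forms M e'" using rational_map_forms[OF G] by blast
  obtain i where i: "i \<le> L" "G i \<notin> R" using rational_map_notin[OF G] by blast
  have "\<forall>i\<le>L. comp_map G F i \<in> forms N (e' * e)"
    using subst_forms[OF e' e] by (auto simp: comp_map_def)
  moreover have "comp_map G F i \<notin> P"
    using dominantD(2)[OF F e'[OF i(1)]] i by (auto simp: comp_map_def)
  moreover have "subst (comp_map G F) g \<in> P" if "g \<in> S" for g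
    unfolding subst_comp_map using rational_map_in[OF dominantD(1)[OF F]] rational_map_in[OF G] that by auto
  ultimately show ?thesis using i by (auto simp: rational_map_def)
qed

lemma dominant_comp:
  assumes F: "dominant (N, P) (M, R) F" and G: "dominant (M, R) (L, S) G"
  shows "dominant (N, P) (L, S) (comp_map G F)"
proof -
  obtain e' where e': "\<And>i. i \<le> L \<Longrightarrow> G i \<in> forms M e'" using rational_map_forms[OF dominantD(1)[OF G]] by blast
  have "f \<in> S" if "f \<in> forms L d" "subst (comp_map G F) f \<in> P" for f d
    using dominantD(2)[OF F subst_forms[OF that(1) e']] dominantD(2)[OF G that(1)] that(2)
    by (simp add: subst_comp_map)
  then show ?thesis using rational_map_comp[OF F dominantD(1)[OF G]] by (auto simp: dominant_def)
qed

lemma same_map_comp: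
  assumes P: "P \<in> proj_points N" and F: "dominant (N, P) (M, R) F"
    and s: "same_map (N, P) (M, R) F F'" and t: "same_map (M, R) (L, S) G G'"
  shows "same_map (N, P) (L, S) (comp_map G F) (comp_map G' F')"
proof (rule same_map_trans[OF P])
  show "same_map (N, P) (L, S) (comp_map G F) (comp_map G' F)"
  proof (rule same_mapI)
    show "prop_mod L P (comp_map G F) (comp_map G' F)"
      unfolding prop_mod_def comp_map_def
    proof (intro allI impI)
      fix i j assume "i \<le> L" "j \<le> L"
      then have "G i * G' j - G j * G' i \<in> R" using same_mapD(3)[OF t] by (auto simp: prop_mod_def)
      from rational_map_in[OF dominantD(1)[OF F] this]
      show "subst F (G i) * subst F (G' j) - subst F (G j) * subst F (G' i) \<in> P"
        by (simp add: subst.mpeval_diff subst.mpeval_mult)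
    qed
  qed (use rational_map_comp[OF F] same_mapD[OF t] in auto)
  show "same_map (N, P) (L, S) (comp_map G' F) (comp_map G' F')"
  proof (rule same_mapI)
    obtain e where e: "\<And>i. i \<le> L \<Longrightarrow> G' i \<in> forms M e" using rational_map_forms[OF same_mapD(2)[OF t]] by blast
    show "prop_mod L P (comp_map G' F) (comp_map G' F')"
      unfolding prop_mod_def comp_map_def using same_map_cross[OF P s e e] by blast
    show "rational_map (N, P) (L, S) (comp_map G' F)" "rational_map (N, P) (L, S) (comp_map G' F')"
      using rational_map_comp[OF F] rational_map_comp[OF dominant_same[OF P F s]] same_mapD(2)[OF t] by auto
  qed
qed

lemma rational_map_Var:
  assumes "P \<in> proj_points N" shows "rational_map (N, P) (N, P) Var"
proof -
  have "\<exists>d. \<forall>i\<le>N. Var i \<in> (forms N d :: 'a mpol set)" by (intro exI[of _ 1]) simp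
  then show ?thesis using pp_Var[OF assms] by (simp add: rational_map_def)
qed

lemma inverse_maps_Var:
  assumes P: "P \<in> proj_points N" shows "inverse_maps (N, P) (N, P) Var Var"
  using same_map_refl[OF P rational_map_Var[OF P]] rational_map_Var[OF P] by (simp add: inverse_maps_def)

lemma inverse_maps_comp_aux:
  assumes P: "P \<in> proj_points N" and R: "R \<in> proj_points M"
    and 1: "inverse_maps (N, P) (M, R) F G" and 2: "inverse_maps (M, R) (L, S) F' G'"
  shows "same_map (N, P) (N, P) (comp_map (comp_map G G') (comp_map F' F)) Var"
proof -
  have dF: "dominant (N, P) (M, R) F" by (rule inverse_maps_dominant[OF R 1])
  have dG: "dominant (M, R) (N, P) G" by (rule inverse_maps_dominant[OF P inverse_maps_sym[OF 1]])
  have F: "rational_map (N, P) (M, R) F" using dF by (rule dominantD)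
  have GF: "same_map (N, P) (N, P) (comp_map G F) Var" using 1 by (simp add: inverse_maps_def)
  have "same_map (M, R) (M, R) (comp_map G' F') Var" using 2 by (simp add: inverse_maps_def)
  from same_map_comp[OF P dF same_map_refl[OF P F] this]
  have c: "same_map (N, P) (M, R) (comp_map (comp_map G' F') F) F" by simp
  have d: "dominant (N, P) (M, R) (comp_map (comp_map G' F') F)"
    by (rule dominant_same[OF P dF same_map_sym[OF P c]])
  have "same_map (N, P) (N, P) (comp_map G (comp_map (comp_map G' F') F)) (comp_map G F)"
    by (rule same_map_comp[OF P d c same_map_refl[OF R dominantD(1)[OF dG]]])
  from same_map_trans[OF P this GF] show ?thesis by (simp add: comp_map_assoc)
qed

lemma inverse_maps_comp:
  assumes P: "P \<in> proj_points N" and R: "R \<in> proj_points M" and S: "S \<in> proj_points L"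
    and 1: "inverse_maps (N, P) (M, R) F G" and 2: "inverse_maps (M, R) (L, S) F' G'"
  shows "inverse_maps (N, P) (L, S) (comp_map F' F) (comp_map G G')"
  unfolding inverse_maps_def
proof (intro conjI)
  show "rational_map (N, P) (L, S) (comp_map F' F)"
    using dominant_comp[OF inverse_maps_dominant[OF R 1] inverse_maps_dominant[OF S 2]] by (rule dominantD)
  show "rational_map (L, S) (N, P) (comp_map G G')"
    using dominant_comp[OF inverse_maps_dominant[OF R inverse_maps_sym[OF 2]] inverse_maps_dominant[OF P inverse_maps_sym[OF 1]]]
    by (rule dominantD)
qed (use inverse_maps_comp_aux[OF P R 1 2] inverse_maps_comp_aux[OF S R inverse_maps_sym[OF 2] inverse_maps_sym[OF 1]] in auto)

lemma inverse_maps_same: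
  assumes P: "P \<in> proj_points N" and R: "R \<in> proj_points M"
    and 1: "inverse_maps (N, P) (M, R) F G" and s: "same_map (N, P) (M, R) F F'"
  shows "inverse_maps (N, P) (M, R) F' G"
proof -
  have dF: "dominant (N, P) (M, R) F" by (rule inverse_maps_dominant[OF R 1])
  have dG: "dominant (M, R) (N, P) G" by (rule inverse_maps_dominant[OF P inverse_maps_sym[OF 1]])
  have "same_map (N, P) (N, P) (comp_map G F') Var"
  proof (rule same_map_trans[OF P same_map_sym[OF P]])
    show "same_map (N, P) (N, P) (comp_map G F) (comp_map G F')"
      by (rule same_map_comp[OF P dF s same_map_refl[OF R dominantD(1)[OF dG]]])
    show "same_map (N, P) (N, P) (comp_map G F) Var" using 1 by (simp add: inverse_maps_def)
  qed
  moreover have "same_map (M, R) (M, R) (comp_map F' G) Var"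
  proof (rule same_map_trans[OF R same_map_sym[OF R]])
    show "same_map (M, R) (M, R) (comp_map F G) (comp_map F' G)"
      by (rule same_map_comp[OF R dG same_map_refl[OF R dominantD(1)[OF dG]] s])
    show "same_map (M, R) (M, R) (comp_map F G) Var" using 1 by (simp add: inverse_maps_def)
  qed
  ultimately show ?thesis using same_mapD(2)[OF s] dominantD(1)[OF dG] by (auto simp: inverse_maps_def)
qed

text \<open>
  The definite description in \<open>pullback\<close> is uniquely satisfiable: for a dominant map, equality of two fractions of forms
  on the target is preserved by substitution.
\<close>

lemma pullback_eq:
  assumes P: "P \<in> proj_points N" and R: "R \<in> proj_points M" and F: "dominant (N, P) (M, R) F"
    and f: "f \<in> forms M d" and g: "g \<in> forms M d" "g \<notin> R"
  shows "pullback (N, P) (M, R) F (rat_fun (M, R) (to_fract f / to_fract g))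
       = rat_fun (N, P) (to_fract (subst F f) / to_fract (subst F g))"
proof -
  obtain e where e: "\<And>i. i \<le> M \<Longrightarrow> F i \<in> forms N e" using rational_map_forms[OF dominantD(1)[OF F]] by blast
  have fe: "subst F h \<in> forms N (c * e)" if "h \<in> forms M c" for h c
    using that e by (rule subst_forms)
  show ?thesis
    unfolding pullback_def
  proof (rule the_equality)
    show "\<exists>d. \<exists>f'\<in>forms (fst (M, R)) d. \<exists>g'\<in>forms (fst (M, R)) d - snd (M, R).
       rat_fun (M, R) (to_fract f / to_fract g) = rat_fun (M, R) (Fraction_Field.Fract f' g') \<and>
       rat_fun (N, P) (to_fract (subst F f) / to_fract (subst F g)) = rat_fun (N, P) (Fraction_Field.Fract (subst F f') (subst F g'))"
      using f g by (auto simp: Fract_conv)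
  next
    fix y assume "\<exists>d. \<exists>f'\<in>forms (fst (M, R)) d. \<exists>g'\<in>forms (fst (M, R)) d - snd (M, R).
       rat_fun (M, R) (to_fract f / to_fract g) = rat_fun (M, R) (Fraction_Field.Fract f' g') \<and>
       y = rat_fun (N, P) (Fraction_Field.Fract (subst F f') (subst F g'))"
    then obtain d' f' g' where *: "f' \<in> forms M d'" "g' \<in> forms M d'" "g' \<notin> R"
      "rat_fun (M, R) (to_fract f / to_fract g) = rat_fun (M, R) (to_fract f' / to_fract g')"
      "y = rat_fun (N, P) (to_fract (subst F f') / to_fract (subst F g'))" by (auto simp: Fract_conv)
    then have "f * g' - f' * g \<in> R" using rat_fun_fract_eq_iff[OF R f g *(1-3)] by simp
    then have "subst F (f * g' - f' * g) \<in> P" by (rule rational_map_in[OF dominantD(1)[OF F]])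
    then have "subst F f * subst F g' - subst F f' * subst F g \<in> P"
      by (simp add: subst.mpeval_diff subst.mpeval_mult)
    then show "y = rat_fun (N, P) (to_fract (subst F f) / to_fract (subst F g))"
    proof -
      assume in_P: "subst F f * subst F g' - subst F f' * subst F g \<in> P"
      have "subst F g \<notin> P" "subst F g' \<notin> P"
        using dominantD(2)[OF F g(1)] dominantD(2)[OF F *(2)] g(2) *(3) by auto
      then have "rat_fun (N, P) (to_fract (subst F f) / to_fract (subst F g))
          = rat_fun (N, P) (to_fract (subst F f') / to_fract (subst F g'))"
        using in_P by (subst rat_fun_fract_eq_iff[OF P fe[OF f] fe[OF g(1)] _ fe[OF *(1)] fe[OF *(2)]])
      then show ?thesis by (simp add: *(5))
    qed
  qed
qed

abbreviation Xn :: "nat \<Rightarrow> 'k::field proj_var" where "Xn n \<equiv> (n, {0})"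

text \<open>
  Elements of the function field of $P^n$ are cosets of the zero ideal, that is, singletons. Unwrapping them, pullback along
  a birational map from $P^n$ to \<open>V\<close> identifies the function field of \<open>V\<close> with \<open>loc n {0}\<close>.
\<close>

definition field_pull :: "nat \<Rightarrow> 'k::field proj_var \<Rightarrow> (nat \<Rightarrow> 'k mpol) \<Rightarrow> 'k mpol fract set \<Rightarrow> 'k mpol fract" where
  "field_pull n V F x = the_elem (pullback (Xn n) V F x)"

lemma field_pull_eq:
  assumes R: "R \<in> proj_points M" and F: "dominant (Xn n) (M, R) F"
    and f: "f \<in> forms M d" and g: "g \<in> forms M d" "g \<notin> R"
  shows "field_pull n (M, R) F (rat_fun (M, R) (to_fract f / to_fract g)) = to_fract (subst F f) / to_fract (subst F g)"
  unfolding field_pull_def pullback_eq[OF zero_pp R F f g] by (simp add: rat_fun_space)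

section \<open>The canonical form modulo squares\<close>

definition pull :: "nat \<Rightarrow> (nat \<Rightarrow> 'k::field mpol) \<Rightarrow> 'k mpol fract \<Rightarrow> 'k mpol fract" where
  "pull n F a = field_pull n (Xn n) F {a}"

lemma pull_eq:
  assumes F: "dominant (Xn n) (Xn n) F" and f: "f \<in> forms n d" and g: "g \<in> forms n d" "g \<noteq> 0"
  shows "pull n F (to_fract f / to_fract g) = to_fract (subst F f) / to_fract (subst F g)"
  using field_pull_eq[OF zero_pp F f g(1)] g(2) by (simp add: pull_def rat_fun_space)

lemma KE:
  assumes "a \<in> loc n {0}"
  obtains f g d where "a = to_fract f / to_fract g" "f \<in> forms n d" "g \<in> forms n d" "g \<noteq> 0"
  using assms by (auto elim!: locE)

lemma KI: "f \<in> forms n d \<Longrightarrow> g \<in> forms n d \<Longrightarrow> g \<noteq> 0 \<Longrightarrow> to_fract f / to_fract g \<in> loc n {0}"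
  by (rule locI) auto

context
  fixes n and F :: "nat \<Rightarrow> 'k::field mpol"
  assumes F: "dominant (Xn n) (Xn n) F"
begin

lemma dom_forms: "\<exists>e. \<forall>i\<le>n. F i \<in> forms n e"
  by (rule rational_map_forms[OF dominantD(1)[OF F]])

lemma dom_subst_nz: "f \<in> forms n d \<Longrightarrow> f \<noteq> 0 \<Longrightarrow> subst F f \<noteq> 0"
  using dominantD(2)[OF F, of f d] by auto

lemma pull_closed: assumes "a \<in> loc n {0}" shows "pull n F a \<in> loc n {0}"
proof -
  obtain e where e: "\<forall>i\<le>n. F i \<in> forms n e" using dom_forms by blast
  from assms obtain f g d where a: "a = to_fract f / to_fract g" "f \<in> forms n d" "g \<in> forms n d" "g \<noteq> 0" by (rule KE)
  have "subst F f \<in> forms n (d * e)" "subst F g \<in> forms n (d * e)" using a e by (auto intro!: subst_forms)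
  then show ?thesis using pull_eq[OF F a(2-4)] dom_subst_nz[OF a(3,4)] a(1) by (auto intro: KI)
qed

lemma pull_hom: "hom_on (loc n {0}) (pull n F)"
  unfolding hom_on_def
proof (intro conjI ballI)
  show "pull n F 1 = 1" using pull_eq[OF F one_forms one_forms] by simp
  fix a b :: "'k mpol fract" assume ab: "a \<in> loc n {0}" "b \<in> loc n {0}"
  obtain f g d where a: "a = to_fract f / to_fract g" "f \<in> forms n d" "g \<in> forms n d" "g \<noteq> 0" using ab(1) by (rule KE)
  obtain f' g' d' where b: "b = to_fract f' / to_fract g'" "f' \<in> forms n d'" "g' \<in> forms n d'" "g' \<noteq> 0" using ab(2) by (rule KE)
  have nz': "subst F g \<noteq> 0" "subst F g' \<noteq> 0" using dom_subst_nz[OF a(3,4)] dom_subst_nz[OF b(3,4)] .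
  have gg: "g * g' \<in> forms n (d + d')" "g * g' \<noteq> 0" using forms_mult[OF a(3) b(3)] a(4) b(4) by simp_all
  have f1: "f * g' + f' * g \<in> forms n (d + d')"
    using forms_mult[OF a(2) b(3)] forms_mult[OF b(2) a(3)] by (simp add: add.commute forms_add)
  have f2: "f * f' \<in> forms n (d + d')" using forms_mult[OF a(2) b(2)] .
  have "a + b = to_fract (f * g' + f' * g) / to_fract (g * g')" using a b by (simp add: field_simps)
  then show "pull n F (a + b) = pull n F a + pull n F b"
    unfolding pull_eq[OF F a(2-4), folded a(1)] pull_eq[OF F b(2-4), folded b(1)]
    using nz' by (simp only: pull_eq[OF F f1 gg]) (simp add: subst.mpeval_add subst.mpeval_mult field_simps)
  have "a * b = to_fract (f * f') / to_fract (g * g')" using a b by simp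
  then show "pull n F (a * b) = pull n F a * pull n F b"
    unfolding pull_eq[OF F a(2-4), folded a(1)] pull_eq[OF F b(2-4), folded b(1)]
    by (simp only: pull_eq[OF F f2 gg]) (simp add: subst.mpeval_mult)
qed

lemma pull_mult: "a \<in> loc n {0} \<Longrightarrow> b \<in> loc n {0} \<Longrightarrow> pull n F (a * b) = pull n F a * pull n F b"
  by (rule ho_mult[OF K_subring pull_hom])

lemma pull_power: "a \<in> loc n {0} \<Longrightarrow> pull n F (a ^ k) = pull n F a ^ k"
  by (rule ho_power[OF K_subring pull_hom])

lemma pull_nonzero: assumes "a \<in> loc n {0}" "a \<noteq> 0" shows "pull n F a \<noteq> 0"
proof -
  have "pull n F a * pull n F (inverse a) = pull n F 1" using pull_mult[OF assms(1) K_inverse[OF assms(1)]] assms(2) by simp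
  then show ?thesis using ho_1[OF K_subring pull_hom] by auto
qed

lemma pull_Const: "pull n F (to_fract (Const c)) = to_fract (Const c)"
  using pull_eq[OF F Const_forms[of c] one_forms] by simp

lemma pull_comp:
  assumes G: "dominant (Xn n) (Xn n) G" and a: "a \<in> loc n {0}"
  shows "pull n F (pull n G a) = pull n (comp_map G F) a"
proof -
  obtain e where e: "\<forall>i\<le>n. G i \<in> forms n e" using rational_map_forms[OF dominantD(1)[OF G]] by blast
  from a obtain f g d where fg: "a = to_fract f / to_fract g" "f \<in> forms n d" "g \<in> forms n d" "g \<noteq> 0" by (rule KE)
  have s: "subst G f \<in> forms n (d * e)" "subst G g \<in> forms n (d * e)" using fg e by (auto intro!: subst_forms)
  have "subst G g \<noteq> 0" using dominantD(2)[OF G fg(3)] fg(4) by auto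
  then show ?thesis
    using pull_eq[OF G fg(2-4)] pull_eq[OF F s] pull_eq[OF dominant_comp[OF F G] fg(2-4)] fg(1) by (simp add: subst_comp_map)
qed

lemma pull_same:
  assumes s: "same_map (Xn n) (Xn n) F F'" and a: "a \<in> loc n {0}"
  shows "pull n F' a = pull n F a"
proof -
  from a obtain f g d where fg: "a = to_fract f / to_fract g" "f \<in> forms n d" "g \<in> forms n d" "g \<noteq> 0" by (rule KE)
  have F': "dominant (Xn n) (Xn n) F'" by (rule dominant_same[OF zero_pp F s])
  have nz': "subst F g \<noteq> 0" "subst F' g \<noteq> 0" using dominantD(2)[OF F fg(3)] dominantD(2)[OF F' fg(3)] fg(4) by auto
  have "subst F f * subst F' g - subst F g * subst F' f \<in> {0}" by (rule same_map_cross[OF zero_pp s fg(2,3)])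
  then have "to_fract (subst F f * subst F' g) = to_fract (subst F g * subst F' f)" by simp
  then show ?thesis using nz' unfolding fg(1) pull_eq[OF F fg(2-4)] pull_eq[OF F' fg(2-4)]
    by (simp add: field_simps)
qed

end

lemma pull_Var: "a \<in> loc n {0} \<Longrightarrow> pull n Var a = a"
  by (elim KE) (simp add: pull_eq[OF inverse_maps_dominant[OF zero_pp inverse_maps_Var[OF zero_pp]]])

lemma inverse_maps_dom: "inverse_maps (Xn n) (Xn n) F G \<Longrightarrow> dominant (Xn n) (Xn n) F"
  by (rule inverse_maps_dominant[OF zero_pp])

lemma pull_inverse_maps:
  assumes i: "inverse_maps (Xn n) (Xn n) F G" and a: "a \<in> loc n {0}"
  shows "pull n F (pull n G a) = a"
proof -
  have F: "dominant (Xn n) (Xn n) F" and G: "dominant (Xn n) (Xn n) G"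
    using inverse_maps_dom[OF i] inverse_maps_dom[OF inverse_maps_sym[OF i]] .
  have "same_map (Xn n) (Xn n) (comp_map G F) Var" using i by (simp add: inverse_maps_def)
  from pull_same[OF dominant_comp[OF F G] this a] show ?thesis using pull_comp[OF F G a] pull_Var[OF a] by simp
qed

text \<open>
  With \<open>G\<close> inverse to \<open>F\<close>, this is the transport of \<open>D\<close> along \<open>F\<close>. Evaluating a form at transported derivations and then
  pulling back the result is pulling back the form.
\<close>

definition conj_der :: "nat \<Rightarrow> (nat \<Rightarrow> 'k::field mpol) \<Rightarrow> (nat \<Rightarrow> 'k mpol) \<Rightarrow> ('k mpol fract \<Rightarrow> 'k mpol fract) \<Rightarrow> 'k mpol fract \<Rightarrow> 'k mpol fract" where
  "conj_der n F G D a = pull n G (D (pull n F a))"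

context
  fixes n and F G :: "nat \<Rightarrow> 'k::field mpol"
  assumes i: "inverse_maps (Xn n) (Xn n) F G"
begin

lemma conj_der_pull: "D \<in> Ders n \<Longrightarrow> a \<in> loc n {0} \<Longrightarrow> pull n F (conj_der n F G D a) = D (pull n F a)"
  unfolding conj_der_def
  by (rule pull_inverse_maps[OF i], rule der_closed[OF K_subring Ders_derivs], assumption, rule pull_closed[OF inverse_maps_dom[OF i]])

lemma conj_der_Ders: assumes D: "D \<in> Ders n" shows "conj_der n F G D \<in> Ders n"
proof -
  note F = inverse_maps_dom[OF i] and G = inverse_maps_dom[OF inverse_maps_sym[OF i]]
  note d = Ders_derivs[OF D]
  have cl: "D (pull n F a) \<in> loc n {0}" if "a \<in> loc n {0}" for a
    using der_closed[OF K_subring d pull_closed[OF F that]] .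
  have "conj_der n F G D \<in> derivs (loc n {0})"
    unfolding derivs_def
  proof (intro CollectI conjI ballI)
    fix a :: "'k mpol fract" assume a: "a \<in> loc n {0}"
    show "conj_der n F G D a \<in> loc n {0}" unfolding conj_der_def by (rule pull_closed[OF G cl[OF a]])
    fix b :: "'k mpol fract" assume b: "b \<in> loc n {0}"
    show "conj_der n F G D (a + b) = conj_der n F G D a + conj_der n F G D b"
      unfolding conj_der_def ho_add[OF K_subring pull_hom[OF F] a b] der_add[OF K_subring d pull_closed[OF F a] pull_closed[OF F b]]
      by (rule ho_add[OF K_subring pull_hom[OF G] cl[OF a] cl[OF b]])
    have e: "pull n G (pull n F b) = b" "pull n G (pull n F a) = a"
      using pull_inverse_maps[OF inverse_maps_sym[OF i] b] pull_inverse_maps[OF inverse_maps_sym[OF i] a] .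
    show "conj_der n F G D (a * b) = conj_der n F G D a * b + a * conj_der n F G D b"
      unfolding conj_der_def ho_mult[OF K_subring pull_hom[OF F] a b] der_mult[OF K_subring d pull_closed[OF F a] pull_closed[OF F b]]
      by (simp add: ho_add[OF K_subring pull_hom[OF G]] ho_mult[OF K_subring pull_hom[OF G]] sr_mult[OF K_subring] cl a b pull_closed[OF F] e)
  qed
  moreover have "conj_der n F G D (to_fract (Const c)) = 0" for c
    using D ho_0[OF K_subring pull_hom[OF G]] by (simp add: conj_der_def pull_Const[OF F] Ders_def)
  ultimately show ?thesis by (simp add: Ders_def)
qed

lemma conj_Dtuple: "Dtuple n D \<Longrightarrow> Dtuple n (\<lambda>j. conj_der n F G (D j))"
  using conj_der_Ders by (simp add: Dtuple_def)

lemma pull_wronsk: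
  assumes D: "Dtuple n D" and z: "\<And>j. j \<le> n \<Longrightarrow> z j \<in> loc n {0}"
  shows "pull n F (wronsk n (\<lambda>j. conj_der n F G (D j)) z) = wronsk n D (\<lambda>j. pull n F (z j))"
  by (rule wronsk_hom[OF K_subring pull_hom[OF inverse_maps_dom[OF i]]])
     (use D z conj_Dtuple[OF D] in \<open>auto simp: Dtuple_def Ders_derivs conj_der_pull\<close>)

lemma pull_jac:
  assumes D: "Dtuple n D" and z: "\<And>j. j < n \<Longrightarrow> z j \<in> loc n {0}"
  shows "pull n F (jac n (\<lambda>j. conj_der n F G (D j)) z) = jac n D (\<lambda>j. pull n F (z j))"
  by (rule jac_hom[OF K_subring pull_hom[OF inverse_maps_dom[OF i]]])
     (use D z conj_Dtuple[OF D] in \<open>auto simp: Dtuple_def Ders_derivs conj_der_pull\<close>)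

end

lemma wronsk_K:
  fixes z :: "nat \<Rightarrow> 'k::field mpol fract"
  assumes D: "Dtuple n D" and z: "\<And>j. j \<le> n \<Longrightarrow> z j \<in> loc n {0}"
  shows "wronsk n D z \<in> loc n {0}"
proof -
  have d: "D i a \<in> loc n {0}" if "i < n" "a \<in> loc n {0}" for i a
    using D that der_closed[OF K_subring Ders_derivs, of "D i" n a] by (simp add: Dtuple_def)
  have "(if i = 0 then z j else D (i - 1) (z j)) \<in> loc n {0}" if "i < Suc n" "j < Suc n" for i j
    using that d[of "i - 1" "z j"] z[of j] by auto
  then show ?thesis unfolding wronsk_def wronsk_mat_def by (rule sr_det[OF K_subring])
qed

text \<open>
  The pullback of the form $W(x/x_0)$ is a constant times a square times the form itself.
\<close>

definition square_jac :: "nat \<Rightarrow> (nat \<Rightarrow> 'k::field mpol) \<Rightarrow> bool" where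
  "square_jac n F \<longleftrightarrow> (\<exists>c h. c \<noteq> 0 \<and> h \<in> loc n {0} \<and> h \<noteq> 0 \<and>
     (\<forall>D. Dtuple n D \<longrightarrow> wronsk n D (\<lambda>k. pull n F (aff 0 k)) = to_fract (Const c) * h\<^sup>2 * wronsk n D (aff 0)))"

lemma square_jac_Var: "square_jac n Var"
  unfolding square_jac_def
  by (intro exI[of _ 1] conjI allI impI)
     (auto simp: sr_1[OF K_subring] pull_Var aff_K intro!: wronsk_cong)

text \<open>
  The multiplier of a composition is the product of one multiplier and the pullback of the other, and pullback preserves
  constants and squares.
\<close>

lemma square_jac_comp:
  assumes i: "inverse_maps (Xn n) (Xn n) F F'" and j: "inverse_maps (Xn n) (Xn n) G G'"
    and "square_jac n F" "square_jac n G"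
  shows "square_jac n (comp_map G F)"
proof -
  note F = inverse_maps_dom[OF i] and G = inverse_maps_dom[OF j]
  obtain c h where c: "c \<noteq> 0" "h \<in> loc n {0}" "h \<noteq> 0"
    "\<And>D. Dtuple n D \<Longrightarrow> wronsk n D (\<lambda>k. pull n F (aff 0 k)) = to_fract (Const c) * h\<^sup>2 * wronsk n D (aff 0)"
    using \<open>square_jac n F\<close> unfolding square_jac_def by blast
  obtain c' h' where c': "c' \<noteq> 0" "h' \<in> loc n {0}" "h' \<noteq> 0"
    "\<And>D. Dtuple n D \<Longrightarrow> wronsk n D (\<lambda>k. pull n G (aff 0 k)) = to_fract (Const c') * h'\<^sup>2 * wronsk n D (aff 0)"
    using \<open>square_jac n G\<close> unfolding square_jac_def by blast
  have "wronsk n D (\<lambda>k. pull n (comp_map G F) (aff 0 k)) = to_fract (Const (c' * c)) * (pull n F h' * h)\<^sup>2 * wronsk n D (aff 0)"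
    if D: "Dtuple n D" for D
  proof -
    let ?D = "\<lambda>j. conj_der n F F' (D j)"
    note D' = conj_Dtuple[OF i D]
    have a0: "aff 0 k \<in> loc n {0}" if "k \<le> n" for k using that by (intro aff_K) auto
    have wK: "wronsk n ?D (aff 0) \<in> loc n {0}" by (rule wronsk_K[OF D' a0])
    have "wronsk n D (\<lambda>k. pull n (comp_map G F) (aff 0 k)) = wronsk n D (\<lambda>k. pull n F (pull n G (aff 0 k)))"
      by (rule wronsk_cong) (simp add: pull_comp[OF F G a0])
    also have "\<dots> = pull n F (wronsk n ?D (\<lambda>k. pull n G (aff 0 k)))"
      by (rule pull_wronsk[OF i D, symmetric]) (rule pull_closed[OF G a0])
    also have "\<dots> = pull n F (to_fract (Const c') * h'\<^sup>2 * wronsk n ?D (aff 0))" by (simp add: c'(4)[OF D'])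
    also have "\<dots> = to_fract (Const c') * (pull n F h')\<^sup>2 * pull n F (wronsk n ?D (aff 0))"
      using c'(2) wK by (simp add: pull_mult[OF F] pull_power[OF F] pull_Const[OF F] sr_mult[OF K_subring] sr_power[OF K_subring] loc_Const[OF zero_pp])
    also have "pull n F (wronsk n ?D (aff 0)) = wronsk n D (\<lambda>k. pull n F (aff 0 k))" by (rule pull_wronsk[OF i D a0])
    finally show ?thesis by (simp add: c(4)[OF D] Const_mult power_mult_distrib mult_ac)
  qed
  moreover have "pull n F h' * h \<in> loc n {0}" "pull n F h' * h \<noteq> 0"
    using sr_mult[OF K_subring pull_closed[OF F c'(2)] c(2)] pull_nonzero[OF F c'(2,3)] c(3) by simp_all
  moreover have "c' * c \<noteq> 0" using c c' by simp
  ultimately show ?thesis unfolding square_jac_def by blast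
qed

lemma std_involution_forms: "i \<le> n \<Longrightarrow> std_involution n i \<in> forms n n"
proof -
  assume i: "i \<le> n"
  have "std_involution n i \<in> forms n (\<Sum>j\<in>{..n}-{i}. 1)"
    unfolding std_involution_def by (rule forms_prod) auto
  then show ?thesis using i by simp
qed

lemma std_involution_nz: "std_involution n i \<noteq> 0"
  by (simp add: std_involution_def)

lemma std_involution_Var: "i \<le> n \<Longrightarrow> std_involution n i * Var i = (\<Prod>j\<le>n. Var j)"
  unfolding std_involution_def by (subst (2) prod.remove[of _ i]) (auto simp: mult.commute)

lemma std_involution_inverse: "inverse_maps (Xn n) (Xn n) (std_involution n) (std_involution n)"
proof -
  let ?s = "std_involution n :: nat \<Rightarrow> 'a mpol"
  have rm: "rational_map (Xn n) (Xn n) ?s"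
    using std_involution_forms by (auto simp: rational_map_def std_involution_nz)
  have cs: "comp_map ?s ?s i = (\<Prod>j\<in>{..n}-{i}. ?s j)" for i
    by (simp add: comp_map_def std_involution_def[of n i] subst.mpeval_prod)
  have nz': "comp_map ?s ?s i \<noteq> 0" for i by (simp add: cs std_involution_nz)
  have rm2: "rational_map (Xn n) (Xn n) (comp_map ?s ?s)"
  proof -
    have "comp_map ?s ?s i \<in> forms n (n * n)" if "i \<le> n" for i
      unfolding comp_map_def by (rule subst_forms) (use that std_involution_forms in auto)
    then show ?thesis using nz' by (auto simp: rational_map_def)
  qed
  have "same_map (Xn n) (Xn n) (comp_map ?s ?s) Var"
  proof (rule same_mapI[OF rm2 rational_map_Var[OF zero_pp]], unfold prop_mod_def, intro allI impI)
    fix i j assume ij: "i \<le> n" "j \<le> n"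
    have r: "comp_map ?s ?s k * ?s k = (\<Prod>j\<le>n. ?s j)" if "k \<le> n" for k
      unfolding cs using that by (subst (2) prod.remove[of _ k]) (auto simp: mult.commute)
    have "(comp_map ?s ?s i * Var j) * (?s i * ?s j) = (comp_map ?s ?s i * ?s i) * (?s j * Var j)" by (simp add: mult_ac)
    also have "\<dots> = (comp_map ?s ?s j * ?s j) * (?s i * Var i)" using ij by (simp add: r std_involution_Var)
    also have "\<dots> = (comp_map ?s ?s j * Var i) * (?s i * ?s j)" by (simp add: mult_ac)
    finally show "comp_map ?s ?s i * Var j - comp_map ?s ?s j * Var i \<in> {0}" by (simp add: std_involution_nz)
  qed
  then show ?thesis using rm by (simp add: inverse_maps_def)
qed

lemma square_jac_std_involution: "square_jac n (std_involution n)"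
proof -
  let ?s = "std_involution n :: nat \<Rightarrow> 'a mpol"
  note dom = inverse_maps_dom[OF std_involution_inverse[of n]]
  have pba: "pull n ?s (aff 0 k) = inverse (aff 0 k)" if k: "k \<le> n" for k
  proof -
    have "pull n ?s (aff 0 k) = to_fract (?s k) / to_fract (?s 0)"
      unfolding aff_def using pull_eq[OF dom, of "Var k" 1 "Var 0"] k by simp
    moreover have "to_fract (?s k) * to_fract (Var k) = to_fract (?s 0) * to_fract (Var 0)"
      using std_involution_Var[of k n] std_involution_Var[of 0 n] k by (metis le0 to_fract_mult)
    then have "to_fract (?s k) / to_fract (?s 0) = to_fract (Var 0) / to_fract (Var k)"
      by (simp add: frac_eq_eq std_involution_nz mult.commute)
    ultimately show ?thesis by (simp add: aff_def)
  qed
  let ?p = "\<Prod>j\<le>n. inverse (aff 0 j) :: 'a mpol fract"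
  have an: "aff 0 j \<noteq> (0 :: 'a mpol fract)" for j by (simp add: aff_def)
  have pK: "?p \<in> loc n {0}" by (rule sr_prod[OF K_subring]) (auto intro: K_inverse aff_K)
  have "wronsk n D (\<lambda>k. pull n ?s (aff 0 k)) = to_fract (Const ((-1) ^ n)) * ?p\<^sup>2 * wronsk n D (aff 0)"
    if D: "Dtuple n D" for D
  proof -
    have "wronsk n D (\<lambda>k. pull n ?s (aff 0 k)) = wronsk n D (\<lambda>k. inverse (aff 0 k))"
      by (rule wronsk_cong) (rule pba)
    also have "\<dots> = (-1) ^ n * ?p\<^sup>2 * wronsk n D (aff 0)"
      by (rule wronsk_inverse[OF K_subring[of n]])
         (use D in \<open>auto simp: Dtuple_def Ders_derivs aff_K K_inverse an\<close>)
    also have "(-1) ^ n = to_fract (Const ((-1::'a) ^ n))"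
    proof -
      have "Const (-1 :: 'a) = -1" using Const_add[of "1::'a" "-1"] by (simp add: eq_neg_iff_add_eq_0 add.commute)
      then have "to_fract (Const (-1 :: 'a)) = -1" by simp
      moreover have "Const ((-1::'a) ^ n) = Const (-1) ^ n" by (induction n) (simp, simp only: power_Suc Const_mult)
      ultimately show ?thesis by (simp add: to_fract_power)
    qed
    finally show ?thesis .
  qed
  moreover have "?p \<noteq> 0" using an by simp
  moreover have "(-1 :: 'a) ^ n \<noteq> 0" by simp
  ultimately show ?thesis unfolding square_jac_def using pK by blast
qed

section \<open>Automorphisms\<close>

lemma homogeneous_part:
  fixes q :: "'k::field mpol set"
  assumes q_0: "0 \<in> q" and q_add: "\<And>f g. f \<in> q \<Longrightarrow> g \<in> q \<Longrightarrow> f + g \<in> q"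
    and q_mult: "\<And>f g. f \<in> q \<Longrightarrow> g \<in> polys n \<Longrightarrow> f * g \<in> q"
    and q_prime: "\<And>f g. f \<in> polys n \<Longrightarrow> g \<in> polys n \<Longrightarrow> f * g \<in> q \<Longrightarrow> f \<in> q \<or> g \<in> q"
    and i: "i \<le> n" "Var i \<notin> q"
  shows "\<exists>Q\<in>proj_points n. \<forall>f d. f \<in> forms n d \<longrightarrow> (f \<in> Q \<longleftrightarrow> f \<in> q)"
proof -
  define I where "I = {f. (\<exists>d. f \<in> forms n d) \<and> f \<in> q}"
  have iff: "f \<in> I \<longleftrightarrow> f \<in> q" if "f \<in> forms n d" for f d using that by (auto simp: I_def)
  have c1: "\<exists>d. f \<in> forms n d" if "f \<in> I" for f using that by (simp add: I_def)
  have c2: "0 \<in> I" by (simp add: I_def q_0)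
  have c3: "f + g \<in> I" if "f \<in> I" "g \<in> I" "f \<in> forms n d" "g \<in> forms n d" for f g d
    using that q_add iff[OF forms_add[OF that(3,4)]] iff[OF that(3)] iff[OF that(4)] by simp
  have c4: "f * g \<in> I" if "f \<in> I" "f \<in> forms n d" "g \<in> forms n e" for f g d e
    using that q_mult[OF _ forms_polys[OF that(3)]] iff[OF forms_mult[OF that(2,3)]] iff[OF that(2)] by simp
  have c5: "f \<in> I \<or> g \<in> I" if "f * g \<in> I" "f \<in> forms n d" "g \<in> forms n e" for f g d e
    using that q_prime[OF forms_polys[OF that(2)] forms_polys[OF that(3)]] iff[OF forms_mult[OF that(2,3)]]
      iff[OF that(2)] iff[OF that(3)] by simp
  have c6: "Var i \<notin> I" using i by (simp add: I_def)
  have "{f \<in> polys n. \<forall>d. hcomp d f \<in> I} \<in> proj_points n"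
    by (rule homogeneous_prime(1)[OF c1 c2 c3 c4 c5 i(1) c6])
  moreover have "f \<in> {f \<in> polys n. \<forall>d. hcomp d f \<in> I} \<longleftrightarrow> f \<in> q" if "f \<in> forms n d" for f d
    using homogeneous_prime(2)[OF c1 c2 c3 c4 c5 i(1) c6 that] iff[OF that] by simp
  ultimately show ?thesis by blast
qed

lemma mprime_point:
  assumes "mprime q" and "i \<le> n" "Var i \<notin> q"
  shows "\<exists>Q\<in>proj_points n. \<forall>f d. f \<in> forms n d \<longrightarrow> (f \<in> Q \<longleftrightarrow> f \<in> q)"
  by (rule homogeneous_part[OF _ _ _ _ assms(2,3)]) (use assms(1) in \<open>simp_all add: mprime_def\<close>)

text \<open>
  The image under \<open>F\<close> of a point \<open>Q\<close> at which the tuple does not vanish.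
\<close>

lemma image_prime:
  fixes F :: "nat \<Rightarrow> 'k::field mpol"
  assumes Q: "Q \<in> proj_points N" and F: "\<And>k. k \<le> n \<Longrightarrow> F k \<in> forms N e" and i: "i \<le> n" "F i \<notin> Q"
  shows "\<exists>Q'\<in>proj_points n. \<forall>f d. f \<in> forms n d \<longrightarrow> (f \<in> Q' \<longleftrightarrow> subst F f \<in> Q)"
proof -
  define q where "q = {f \<in> polys n. subst F f \<in> Q}"
  have pol: "subst F f \<in> polys N" if "f \<in> polys n" for f
    using subst_polys[OF that forms_polys[OF F]] .
  have "\<exists>Q'\<in>proj_points n. \<forall>f d. f \<in> forms n d \<longrightarrow> (f \<in> Q' \<longleftrightarrow> f \<in> q)"
  proof (rule homogeneous_part[OF _ _ _ _ i(1)])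
    show "f \<in> q \<or> g \<in> q" if "f \<in> polys n" "g \<in> polys n" "f * g \<in> q" for f g
      using that pp_prime[OF Q pol[OF that(1)] pol[OF that(2)]] by (simp add: q_def subst.mpeval_mult)
    show "f * g \<in> q" if "f \<in> q" "g \<in> polys n" for f g
      using that pp_mult[OF Q _ pol[OF that(2)]] by (simp add: q_def subst.mpeval_mult polys_mult)
  qed (use i in \<open>simp_all add: q_def pp_zero[OF Q] pp_add[OF Q] polys_add subst.mpeval_add\<close>)
  moreover have "f \<in> q \<longleftrightarrow> subst F f \<in> Q" if "f \<in> forms n d" for f d
    using forms_polys[OF that] by (simp add: q_def)
  ultimately show ?thesis by auto
qed

lemma wronsk_mult:
  assumes "Dtuple n D" "a \<in> loc n {0}" "\<And>k. k \<le> n \<Longrightarrow> z k \<in> loc n {0}"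
  shows "wronsk n D (\<lambda>k. a * z k) = a ^ Suc n * wronsk n D z"
  by (rule wronsk_scale[OF K_subring[of n]]) (use assms in \<open>simp_all add: Dtuple_def Ders_derivs\<close>)

text \<open>
  Let \<open>Q'\<close> be the image of \<open>Q\<close>. The pullback of a local generator at \<open>Q'\<close> is \<open>r\<close> times a local generator at \<open>Q\<close>, and
  likewise for the inverse with some \<open>r'\<close>; composing the two shows that \<open>r\<close> is a unit. Passing between the coordinates
  $x_0$, $x_i$ and $x_l$ costs powers of exponent $n + 1$, which are squares for odd \<open>n\<close>.
\<close>

lemma aut_local:
  fixes F G :: "nat \<Rightarrow> 'k::field mpol" and D0 :: "nat \<Rightarrow> 'k mpol fract \<Rightarrow> 'k mpol fract"
  assumes odd: "odd n" and inv: "inverse_maps (Xn n) (Xn n) F G"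
    and mF: "morphism (Xn n) (Xn n) F" and mG: "morphism (Xn n) (Xn n) G"
    and nzD: "Dtuple n D0" "wronsk n D0 (aff 0) \<noteq> 0" and Q: "Q \<in> proj_points n"
  shows "\<exists>r h. r \<in> loc n Q - locm n Q \<and> h \<in> loc n {0} \<and> h \<noteq> 0 \<and>
     (\<forall>D. Dtuple n D \<longrightarrow> wronsk n D (\<lambda>k. pull n F (aff 0 k)) = r * h\<^sup>2 * wronsk n D (aff 0))"
proof -
  note dF = inverse_maps_dom[OF inv] and dG = inverse_maps_dom[OF inverse_maps_sym[OF inv]]
  have "Q \<in> points (Xn n)" using Q pp_zero[OF Q] by (simp add: points_def)
  then obtain F' i where F': "same_map (Xn n) (Xn n) F F'" "i \<le> n" "F' i \<notin> Q"
    using mF unfolding morphism_def fst_conv by blast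
  note dF' = dominant_same[OF zero_pp dF F'(1)]
  obtain e where e: "\<forall>k\<le>n. F' k \<in> forms n e" using dom_forms[OF dF'] by blast
  obtain Q' where Q': "Q' \<in> proj_points n" "\<And>f d. f \<in> forms n d \<Longrightarrow> f \<in> Q' \<longleftrightarrow> subst F' f \<in> Q"
    using image_prime[OF Q, of n F' e i] e F' by blast
  have "Q' \<in> points (Xn n)" using Q' pp_zero[OF Q'(1)] by (simp add: points_def)
  then obtain G' l where G': "same_map (Xn n) (Xn n) G G'" "l \<le> n" "G' l \<notin> Q'"
    using mG unfolding morphism_def fst_conv by blast
  note dG' = dominant_same[OF zero_pp dG G'(1)]
  obtain e' where e': "\<forall>k\<le>n. G' k \<in> forms n e'" using dom_forms[OF dG'] by blast
  have xi: "Var i \<notin> Q'" using Q'(2)[of "Var i" 1] F' by simp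
  have FG: "subst F' (G' k) \<in> forms n (e' * e)" if "k \<le> n" for k using e e' that by (intro subst_forms) auto
  have FGl: "subst F' (G' l) \<notin> Q" using Q'(2)[of "G' l" e'] e' G' by simp
  \<comment> \<open>The inverse sends \<open>Q'\<close> back to \<open>Q\<close>, so the coordinate that does not vanish there does not vanish at \<open>Q\<close>.\<close>
  have xl: "Var l \<notin> Q"
  proof
    assume xlQ: "Var l \<in> Q"
    obtain k where k: "k \<le> n" "Var k \<notin> Q" using pp_Var[OF Q] by blast
    have "same_map (Xn n) (Xn n) (comp_map G' F') (comp_map G F)"
      by (rule same_map_sym[OF zero_pp same_map_comp[OF zero_pp dF F'(1) G'(1)]])
    moreover have "same_map (Xn n) (Xn n) (comp_map G F) Var" using inv by (simp add: inverse_maps_def)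
    ultimately have "same_map (Xn n) (Xn n) (comp_map G' F') Var" by (rule same_map_trans[OF zero_pp])
    then have "subst F' (G' k) * Var l - subst F' (G' l) * Var k \<in> {0}"
      using same_mapD(3) k G'(2) unfolding prop_mod_def comp_map_def by blast
    then have "subst F' (G' l) * Var k = subst F' (G' k) * Var l" by simp
    also have "\<dots> \<in> Q" by (rule pp_mult'[OF Q xlQ forms_polys[OF FG[OF k(1)]]])
    finally show False
      using pp_prime[OF Q forms_polys[OF FG[OF G'(2)]] Var_in_polys[OF k(1)]] FGl k by blast
  qed
  define b where "b = (\<lambda>k. pull n F (aff i k))"
  define b' where "b' = (\<lambda>k. pull n G (aff l k))"
  have bQ: "b k \<in> loc n Q" if "k \<le> n" for k
  proof -
    have "F' i \<noteq> 0" using F'(3) pp_zero[OF Q] by auto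
    have "b k = pull n F' (aff i k)" unfolding b_def using pull_same[OF dF F'(1) aff_K] that F'(2) by simp
    also have "\<dots> = to_fract (F' k) / to_fract (F' i)"
      unfolding aff_def using pull_eq[OF dF', of "Var k" 1 "Var i"] that F'(2) by simp
    also have "\<dots> \<in> loc n Q" using e that F' by (intro locI[of _ n e]) auto
    finally show ?thesis .
  qed
  have b'Q: "b' k \<in> loc n Q'" if "k \<le> n" for k
  proof -
    have "b' k = pull n G' (aff l k)" unfolding b'_def using pull_same[OF dG G'(1) aff_K] that G'(2) by simp
    also have "\<dots> = to_fract (G' k) / to_fract (G' l)"
      unfolding aff_def using pull_eq[OF dG', of "Var k" 1 "Var l"] that G'(2) by simp
    also have "\<dots> \<in> loc n Q'" using e' that G' by (intro locI[of _ n e']) auto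
    finally show ?thesis .
  qed
  obtain r where r: "r \<in> loc n Q" "\<And>D. Dtuple n D \<Longrightarrow> wronsk n D b = r * wronsk n D (aff l)"
    using frame_wronsk[OF Q G'(2) xl, of b] bQ by blast
  obtain r' where r': "r' \<in> loc n Q'" "\<And>D. Dtuple n D \<Longrightarrow> wronsk n D b' = r' * wronsk n D (aff i)"
    using frame_wronsk[OF Q'(1) F'(2) xi, of b'] b'Q by blast
  have r'K: "r' \<in> loc n {0}" using r'(1) loc_subset_K[OF Q'(1)] by blast
  have pr': "pull n F r' \<in> loc n Q"
  proof -
    obtain f g d where fg: "r' = to_fract f / to_fract g" "f \<in> forms n d" "g \<in> forms n d" "g \<notin> Q'"
      using r'(1) by (rule locE)
    have g0: "g \<noteq> 0" using fg(4) pp_zero[OF Q'(1)] by auto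
    have "pull n F r' = to_fract (subst F' f) / to_fract (subst F' g)"
      using pull_same[OF dF F'(1) r'K] pull_eq[OF dF' fg(2,3) g0] fg(1) by simp
    moreover have "subst F' f \<in> forms n (d * e)" "subst F' g \<in> forms n (d * e)"
      using subst_forms[of _ n d F' n e] fg e by auto
    moreover have "subst F' g \<notin> Q" using Q'(2)[OF fg(3)] fg(4) by simp
    ultimately show ?thesis by (auto intro: locI)
  qed
  have K: "aff j k \<in> loc n {0}" if "j \<le> n" "k \<le> n" for j k using that by (rule aff_K)
  have key: "wronsk n D (aff l) = pull n F r' * r * wronsk n D (aff l)" if D: "Dtuple n D" for D
  proof -
    let ?D = "\<lambda>j. conj_der n F G (D j)"
    note D' = conj_Dtuple[OF inv D]
    have "wronsk n D (aff l) = wronsk n D (\<lambda>k. pull n F (b' k))"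
      by (rule wronsk_cong) (simp add: b'_def pull_inverse_maps[OF inv] K G'(2))
    also have "\<dots> = pull n F (wronsk n ?D b')"
      by (rule pull_wronsk[OF inv D, symmetric]) (simp add: b'_def pull_closed[OF dG] K G'(2))
    also have "wronsk n ?D b' = r' * wronsk n ?D (aff i)" by (rule r'(2)[OF D'])
    also have "pull n F (r' * wronsk n ?D (aff i)) = pull n F r' * pull n F (wronsk n ?D (aff i))"
      by (rule pull_mult[OF dF r'K wronsk_K[OF D']]) (simp add: K F'(2))
    also have "pull n F (wronsk n ?D (aff i)) = wronsk n D b"
      unfolding b_def by (rule pull_wronsk[OF inv D]) (simp add: K F'(2))
    also have "wronsk n D b = r * wronsk n D (aff l)" by (rule r(2)[OF D])
    finally show ?thesis by (simp add: mult_ac)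
  qed
  have al0: "aff l 0 \<noteq> (0 :: 'k mpol fract)" "aff 0 l \<noteq> (0 :: 'k mpol fract)" by (simp_all add: aff_def)
  have "wronsk n D0 (aff l) \<noteq> 0"
    using wronsk_aff_change[OF _ G'(2) nzD(1), of 0] nzD(2) al0 by simp
  then have one: "pull n F r' * r = 1" using key[OF nzD(1)] by simp
  have rm: "r \<notin> locm n Q"
  proof
    assume "r \<in> locm n Q"
    then have "r * pull n F r' \<in> locm n Q" using pr' by (rule locm_mult[OF Q])
    then show False using one one_notin_locm[OF Q] by (simp add: mult.commute)
  qed
  define A where "A = pull n F (aff 0 i)"
  define h where "h = (A * aff l 0) ^ (Suc n div 2)"
  have AK: "A \<in> loc n {0}" unfolding A_def using F'(2) by (intro pull_closed[OF dF] K) auto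
  have "A \<noteq> 0" unfolding A_def using F'(2) by (intro pull_nonzero[OF dF] K) (auto simp: aff_def)
  then have h: "h \<in> loc n {0}" "h \<noteq> 0"
    unfolding h_def using al0 AK K[of l 0] G'(2) by (auto intro!: sr_power[OF K_subring] sr_mult[OF K_subring])
  have h2: "h\<^sup>2 = (A * aff l 0) ^ Suc n"
  proof -
    have "2 dvd Suc n" using odd by simp
    then have "Suc n div 2 * 2 = Suc n" by (rule dvd_div_mult_self)
    then show ?thesis unfolding h_def power_mult[symmetric] by simp
  qed
  have "wronsk n D (\<lambda>k. pull n F (aff 0 k)) = r * h\<^sup>2 * wronsk n D (aff 0)" if D: "Dtuple n D" for D
  proof -
    have "wronsk n D (\<lambda>k. pull n F (aff 0 k)) = wronsk n D (\<lambda>k. A * b k)"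
    proof (rule wronsk_cong)
      fix k assume "k \<le> n"
      then show "pull n F (aff 0 k) = A * b k"
        unfolding A_def b_def aff_change[of 0 k i] using F'(2) by (intro pull_mult[OF dF] K) auto
    qed
    also have "\<dots> = A ^ Suc n * wronsk n D b"
      using D AK by (rule wronsk_mult) (simp add: b_def pull_closed[OF dF] K F'(2))
    also have "\<dots> = A ^ Suc n * (r * (aff l 0 ^ Suc n * wronsk n D (aff 0)))"
      unfolding r(2)[OF D] using wronsk_aff_change[of 0 n l D] G'(2) D by simp
    also have "\<dots> = r * h\<^sup>2 * wronsk n D (aff 0)" unfolding h2 power_mult_distrib by (simp only: mult_ac)
    finally show ?thesis .
  qed
  then show ?thesis using r(1) rm h by blast
qed

text \<open>
  The multiplier is a quotient $f/g$ of forms, and up to the square of $g$ it is $f g$, a form that is locally a square by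
  \<open>aut_local\<close>. Comparing degrees turns the resulting square roots into a function on $P^n$.
\<close>

lemma square_jac_aut:
  fixes F G :: "nat \<Rightarrow> 'k::field mpol"
  assumes odd: "odd n" and inv: "inverse_maps (Xn n) (Xn n) F G"
    and mF: "morphism (Xn n) (Xn n) F" and mG: "morphism (Xn n) (Xn n) G"
  shows "square_jac n F"
proof -
  note dF = inverse_maps_dom[OF inv]
  have n1: "n \<ge> 1" using odd by (cases n) auto
  have bK: "pull n F (aff 0 k) \<in> loc n {0}" if "k \<le> n" for k using that by (intro pull_closed[OF dF] aff_K) auto
  obtain u where u: "u \<in> loc n {0}" "\<And>D. Dtuple n D \<Longrightarrow> wronsk n D (\<lambda>k. pull n F (aff 0 k)) = u * wronsk n D (aff 0)"
    using frame_wronsk[OF zero_pp, of 0 n "\<lambda>k. pull n F (aff 0 k)"] bK by auto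
  show ?thesis
  proof (cases "\<exists>D0. Dtuple n D0 \<and> wronsk n D0 (aff 0) \<noteq> (0 :: 'k mpol fract)")
    case False
    \<comment> \<open>If $W(x/x_0)$ vanishes identically, every multiplier serves.\<close>
    then have "wronsk n D (\<lambda>k. pull n F (aff 0 k)) = to_fract (Const 1) * 1\<^sup>2 * wronsk n D (aff 0)" if "Dtuple n D" for D
      using u(2)[OF that] that by auto
    then show ?thesis unfolding square_jac_def using sr_1[OF K_subring[of n]] by (metis zero_neq_one)
  next
    case True
    then obtain D0 where D0: "Dtuple n D0" "wronsk n D0 (aff 0) \<noteq> (0 :: 'k mpol fract)" by blast
    have loc_u: "\<exists>r h. r \<in> loc n Q - locm n Q \<and> h \<in> loc n {0} \<and> h \<noteq> 0 \<and> u = r * h\<^sup>2"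
      if Q: "Q \<in> proj_points n" for Q
    proof -
      from aut_local[OF odd inv mF mG D0 Q] obtain r h where
        rh: "r \<in> loc n Q - locm n Q" "h \<in> loc n {0}" "h \<noteq> 0"
         "wronsk n D0 (\<lambda>k. pull n F (aff 0 k)) = r * h\<^sup>2 * wronsk n D0 (aff 0)" using D0(1) by blast
      then have "u = r * h\<^sup>2" using u(2)[OF D0(1)] D0(2) by simp
      then show ?thesis using rh by blast
    qed
    from u(1) obtain f g d where fg: "u = to_fract f / to_fract g" "f \<in> forms n d" "g \<in> forms n d" "g \<noteq> 0" by (rule KE)
    have u0: "u \<noteq> 0"
    proof -
      obtain r h where "r \<in> loc n {0}" "r \<notin> locm n {0}" "h \<noteq> 0" "u = r * h\<^sup>2" using loc_u[OF zero_pp] by blast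
      then show ?thesis using loc_unit_inverse(3)[OF zero_pp, of r n] by simp
    qed
    then have f0: "f \<noteq> 0" using fg by auto
    have fgf: "f * g \<in> forms n (d + d)" "f * g \<noteq> 0" using forms_mult[OF fg(2,3)] f0 fg(4) by auto
    have "loc_square n (f * g)"
      unfolding loc_square_def
    proof (intro allI impI)
      fix q :: "'k mpol set" assume "mprime q \<and> (\<exists>i\<le>n. Var i \<notin> q)"
      then obtain Q where Q: "Q \<in> proj_points n" "\<And>f d. f \<in> forms n d \<Longrightarrow> f \<in> Q \<longleftrightarrow> f \<in> q"
        using mprime_point by blast
      obtain r h where rh: "r \<in> loc n Q" "r \<notin> locm n Q" "h \<in> loc n {0}" "h \<noteq> 0" "u = r * h\<^sup>2"
        using loc_u[OF Q(1)] by blast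
      obtain s' s e where s: "r = to_fract s' / to_fract s" "s' \<in> forms n e" "s \<in> forms n e" "s \<notin> Q" using rh(1) by (rule locE)
      have "s' \<notin> Q" using rh(2) s fract_in_locm_iff[OF Q(1) s(2-4)] by simp
      then have nq: "s \<notin> q" "s' \<notin> q" using Q(2) s by auto
      have s0: "s \<noteq> 0" using s(4) pp_zero[OF Q(1)] by auto
      obtain a b e' where ab: "h = to_fract a / to_fract b" "b \<noteq> 0" using rh(3) by (rule KE)
      have a0: "a \<noteq> 0" using rh(4) ab by auto
      have "to_fract f / to_fract g = (to_fract s' * to_fract a * to_fract a) / (to_fract s * to_fract b * to_fract b)"
        using rh(5) unfolding fg(1) s(1) ab(1) by (simp add: power2_eq_square mult.assoc)
      then have "to_fract (f * (s * b * b)) = to_fract (s' * a * a * g)"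
        using fg(4) s0 ab(2) by (simp add: frac_eq_eq)
      then have "f * (s * b * b) = s' * a * a * g" by (simp only: to_fract_eq_iff)
      then have "f * (s * b * b) * g = s' * a * a * g * g" by simp
      then have "s * (f * g) * b\<^sup>2 = s' * (a * g)\<^sup>2" by (simp add: power2_eq_square mult_ac)
      moreover have "a * g \<noteq> 0" using a0 fg(4) by simp
      ultimately show "\<exists>s s' a b. s \<notin> q \<and> s' \<notin> q \<and> a \<noteq> 0 \<and> b \<noteq> 0 \<and> s * (f * g) * b\<^sup>2 = s' * a\<^sup>2"
        using nq ab(2) by blast
    qed
    from loc_square_form_imp_square[OF n1 fgf this] obtain c a b e1 e2 where
      sq: "c \<noteq> 0" "a \<noteq> 0" "b \<noteq> 0" "a \<in> forms n e1" "b \<in> forms n e2" "f * g * b\<^sup>2 = Const c * a\<^sup>2" by blast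
    have m1: "f * g * b\<^sup>2 \<in> forms n (d + d + 2 * e2)" by (rule forms_mult[OF fgf(1) forms_power[OF sq(5)]])
    have m2: "f * g * b\<^sup>2 \<in> forms n (0 + 2 * e1)"
      unfolding sq(6) by (rule forms_mult[OF Const_forms forms_power[OF sq(4)]])
    have "d + d + 2 * e2 = 0 + 2 * e1" using fgf(2) sq(3) by (intro forms_degree_unique[OF m1 m2]) simp
    then have e1: "e1 = d + e2" by simp
    define h where "h = to_fract a / to_fract (g * b)"
    have "h \<in> loc n {0}"
      unfolding h_def by (rule KI[of _ n "d + e2"]) (use sq(3,4) fg(4) forms_mult[OF fg(3) sq(5)] e1 in simp_all)
    moreover have "h \<noteq> 0" using sq(2,3) fg(4) by (simp add: h_def)
    ultimately have hK: "h \<in> loc n {0}" "h \<noteq> 0" .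
    have "to_fract (f * g * b\<^sup>2) = to_fract (Const c * a\<^sup>2)" by (simp only: sq(6))
    then have "to_fract f * to_fract g * (to_fract b)\<^sup>2 = to_fract (Const c) * (to_fract a)\<^sup>2"
      by (simp add: to_fract_power)
    then have "u = to_fract (Const c) * h\<^sup>2"
      using fg(4) sq(3) by (simp add: fg(1) h_def power_divide power_mult_distrib field_simps power2_eq_square)
    then show ?thesis unfolding square_jac_def using sq(1) hK u(2) by blast
  qed
qed

section \<open>The group generated by the involution and the automorphisms\<close>

abbreviation cls :: "nat \<Rightarrow> (nat \<Rightarrow> 'k::field mpol) \<Rightarrow> (nat \<Rightarrow> 'k mpol) set" where
  "cls n \<equiv> map_class (Xn n) (Xn n)"

lemma cls_iff: "F' \<in> cls n F \<longleftrightarrow> same_map (Xn n) (Xn n) F F'"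
  by (simp add: map_class_def)

lemma cls_eq:
  assumes s: "same_map (Xn n) (Xn n) F F'"
  shows "cls n F = cls n F'"
proof (rule Set.set_eqI)
  fix E
  show "E \<in> cls n F \<longleftrightarrow> E \<in> cls n F'"
    unfolding cls_iff using same_map_trans[OF zero_pp s, of E] same_map_trans[OF zero_pp same_map_sym[OF zero_pp s], of E] by auto
qed

lemma cls_self: "rational_map (Xn n) (Xn n) F \<Longrightarrow> F \<in> cls n F"
  by (simp add: cls_iff same_map_refl[OF zero_pp])

lemma cls_mult:
  assumes F: "inverse_maps (Xn n) (Xn n) F F1" and G: "inverse_maps (Xn n) (Xn n) G G1"
  shows "cls n G \<otimes>\<^bsub>Bir (Xn n)\<^esub> cls n F = cls n (comp_map G F)"
proof -
  note dF = inverse_maps_dom[OF F] and dG = inverse_maps_dom[OF G]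
  have e: "cls n (comp_map G' F') = cls n (comp_map G F)" if "G' \<in> cls n G" "F' \<in> cls n F" for G' F'
    using cls_eq[OF same_map_comp[OF zero_pp dF, of F' n "{0}" G G']] that by (simp add: cls_iff)
  have ne: "cls n G \<noteq> {}" "cls n F \<noteq> {}"
    using cls_self[OF dominantD(1)[OF dG]] cls_self[OF dominantD(1)[OF dF]] by auto
  have "(\<Union>G'\<in>cls n G. \<Union>F'\<in>cls n F. cls n (comp_map G' F')) =
     (\<Union>G'\<in>cls n G. \<Union>F'\<in>cls n F. cls n (comp_map G F))"
    by (intro SUP_cong refl e)
  also have "\<dots> = cls n (comp_map G F)" using ne by simp
  finally have "(\<Union>G'\<in>cls n G. \<Union>F'\<in>cls n F. cls n (comp_map G' F')) = cls n (comp_map G F)" .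
  then show ?thesis by (simp add: Bir_def)
qed

lemma Bir_carrier: "x \<in> carrier (Bir (Xn n)) \<longleftrightarrow> (\<exists>F G. inverse_maps (Xn n) (Xn n) F G \<and> x = cls n F)"
  by (auto simp: Bir_def birational_map_def)

lemma Bir_one: "\<one>\<^bsub>Bir (Xn n)\<^esub> = cls n Var"
  by (simp add: Bir_def)

lemma cls_inverse:
  assumes "inverse_maps (Xn n) (Xn n) F G"
  shows "cls n F \<otimes>\<^bsub>Bir (Xn n)\<^esub> cls n G = \<one>\<^bsub>Bir (Xn n)\<^esub>"
  unfolding cls_mult[OF inverse_maps_sym[OF assms] assms] Bir_one
  by (rule cls_eq) (use assms in \<open>simp add: inverse_maps_def\<close>)

text \<open>
  Inverses in the group are unique, by associativity of composition up to equality of rational maps; therefore the inverse is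
  represented by the inverse tuple.
\<close>

lemma Bir_inv:
  assumes FG: "inverse_maps (Xn n) (Xn n) F G"
  shows "inv\<^bsub>Bir (Xn n)\<^esub> (cls n F) = cls n G"
  unfolding m_inv_def
proof (rule the_equality)
  show "cls n G \<in> carrier (Bir (Xn n)) \<and> cls n F \<otimes>\<^bsub>Bir (Xn n)\<^esub> cls n G = \<one>\<^bsub>Bir (Xn n)\<^esub> \<and>
     cls n G \<otimes>\<^bsub>Bir (Xn n)\<^esub> cls n F = \<one>\<^bsub>Bir (Xn n)\<^esub>"
    using cls_inverse[OF FG] cls_inverse[OF inverse_maps_sym[OF FG]] inverse_maps_sym[OF FG] by (auto simp: Bir_carrier)
next
  fix y assume y: "y \<in> carrier (Bir (Xn n)) \<and> cls n F \<otimes>\<^bsub>Bir (Xn n)\<^esub> y = \<one>\<^bsub>Bir (Xn n)\<^esub> \<and>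
     y \<otimes>\<^bsub>Bir (Xn n)\<^esub> cls n F = \<one>\<^bsub>Bir (Xn n)\<^esub>"
  then obtain E E' where E: "inverse_maps (Xn n) (Xn n) E E'" "y = cls n E" by (auto simp: Bir_carrier)
  note GF = inverse_maps_sym[OF FG]
  have EF: "inverse_maps (Xn n) (Xn n) (comp_map E F) (comp_map G E')" by (rule inverse_maps_comp[OF zero_pp zero_pp zero_pp FG E(1)])
  have "same_map (Xn n) (Xn n) Var (comp_map E F)"
  proof -
    have "cls n (comp_map E F) = cls n Var" using y cls_mult[OF FG E(1)] E(2) by (simp add: Bir_one)
    then have "comp_map E F \<in> cls n Var" using cls_self[OF dominantD(1)[OF inverse_maps_dom[OF EF]]] by simp
    then show ?thesis by (simp add: cls_iff)
  qed
  from same_map_comp[OF zero_pp inverse_maps_dom[OF GF] same_map_refl[OF zero_pp dominantD(1)[OF inverse_maps_dom[OF GF]]] this]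
  have 1: "same_map (Xn n) (Xn n) G (comp_map E (comp_map F G))" by (simp add: comp_map_assoc)
  have FGV: "same_map (Xn n) (Xn n) (comp_map F G) Var" using FG by (simp add: inverse_maps_def)
  have "dominant (Xn n) (Xn n) (comp_map F G)"
    by (rule dominant_comp[OF inverse_maps_dom[OF GF] inverse_maps_dom[OF FG]])
  from same_map_comp[OF zero_pp this FGV same_map_refl[OF zero_pp dominantD(1)[OF inverse_maps_dom[OF E(1)]]]]
  have "same_map (Xn n) (Xn n) (comp_map E (comp_map F G)) E" by simp
  from same_map_trans[OF zero_pp 1 this] show "y = cls n G" unfolding E(2) by (rule cls_eq[symmetric])
qed

text \<open>
  Inverses of generators are covered because an involution and an inverse of an automorphism are again of the same kind.
\<close>

lemma Gn_square_jac:
  fixes g :: "(nat \<Rightarrow> 'k::field mpol) set"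
  assumes odd: "odd n" and g: "g \<in> Gn n"
  shows "\<exists>F G. inverse_maps (Xn n) (Xn n) F G \<and> square_jac n F \<and> g = cls n F"
proof -
  let ?S = "insert (cls n (std_involution n)) (Aut (Xn n)) :: (nat \<Rightarrow> 'k mpol) set set"
  have aut: "\<exists>F G. inverse_maps (Xn n) (Xn n) F G \<and> square_jac n F \<and> square_jac n G \<and> x = cls n F" if "x \<in> ?S" for x
  proof (cases "x = cls n (std_involution n)")
    case True
    then show ?thesis
      by (intro exI[of _ "std_involution n"] conjI std_involution_inverse square_jac_std_involution)
  next
    case False
    then have "x \<in> Aut (Xn n)" using that by (simp only: insert_iff simp_thms)
    then obtain F G where FG: "inverse_maps (Xn n) (Xn n) F G" "morphism (Xn n) (Xn n) F" "morphism (Xn n) (Xn n) G" "x = cls n F"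
      unfolding Aut_def by blast
    show ?thesis
      by (intro exI[of _ F] exI[of _ G] conjI FG(1,4) square_jac_aut[OF odd FG(1-3)]
            square_jac_aut[OF odd inverse_maps_sym[OF FG(1)] FG(3,2)])
  qed
  have "g \<in> generate (Bir (Xn n)) ?S" using g by (simp add: Gn_def proj_space_def)
  then show ?thesis
  proof (induction rule: generate.induct)
    case one
    show ?case unfolding Bir_one
      by (intro exI[of _ Var] conjI inverse_maps_Var[OF zero_pp] square_jac_Var refl)
  next
    case (incl h)
    then show ?case using aut[of h] by auto
  next
    case (inv h)
    then obtain F G where "inverse_maps (Xn n) (Xn n) F G" "square_jac n G" "h = cls n F" using aut[of h] by auto
    then have "inv\<^bsub>Bir (Xn n)\<^esub> h = cls n G" "inverse_maps (Xn n) (Xn n) G F"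
      using Bir_inv[of n F G] by (simp_all add: inverse_maps_sym)
    then show ?case using \<open>square_jac n G\<close> by auto
  next
    case (eng h1 h2)
    then obtain F F' G G' where *: "inverse_maps (Xn n) (Xn n) F F'" "square_jac n F" "h2 = cls n F"
      "inverse_maps (Xn n) (Xn n) G G'" "square_jac n G" "h1 = cls n G" by blast
    have "h1 \<otimes>\<^bsub>Bir (Xn n)\<^esub> h2 = cls n (comp_map G F)" unfolding *(3,6) by (rule cls_mult[OF *(1,4)])
    moreover have "square_jac n (comp_map G F)" by (rule square_jac_comp[OF *(1,4,2,5)])
    moreover have "inverse_maps (Xn n) (Xn n) (comp_map G F) (comp_map F' G')"
      by (rule inverse_maps_comp[OF zero_pp zero_pp zero_pp *(1,4)])
    ultimately show ?case by (intro exI[of _ "comp_map G F"] exI[of _ "comp_map F' G'"] conjI)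
  qed
qed

lemma Gn_rep_square_jac:
  assumes odd: "odd n" and g: "g \<in> Gn n" and F: "F \<in> g"
  shows "square_jac n F" "\<exists>G. inverse_maps (Xn n) (Xn n) F G"
proof -
  obtain F0 G0 where *: "inverse_maps (Xn n) (Xn n) F0 G0" "square_jac n F0" "g = cls n F0" using Gn_square_jac[OF odd g] by blast
  have s: "same_map (Xn n) (Xn n) F0 F" using F *(3) by (simp add: cls_iff)
  show "\<exists>G. inverse_maps (Xn n) (Xn n) F G" using inverse_maps_same[OF zero_pp zero_pp *(1) s] by blast
  have "pull n F (aff 0 k) = pull n F0 (aff 0 k)" if "k \<le> n" for k
    using that by (intro pull_same[OF inverse_maps_dom[OF *(1)] s] aff_K) auto
  then have "wronsk n D (\<lambda>k. pull n F (aff 0 k)) = wronsk n D (\<lambda>k. pull n F0 (aff 0 k))" for D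
    by (rule wronsk_cong)
  then show "square_jac n F" using *(2) by (simp add: square_jac_def)
qed

section \<open>Canonical stalks as multiples of a Wronskian\<close>

text \<open>
  A generator of a canonical stalk is an arbitrary function on tuples of derivations, so its values may be sets \<open>x\<close> that are not
  cosets. Multiplication in the quotient ring only sees the sums and products of elements, so that multiplying by \<open>x\<close>
  is the same as multiplying by the coset obtained from \<open>x\<close> by multiplication with $1$.
\<close>

lemma rf_mult_one:
  fixes P :: "'k::field mpol set"
  assumes P: "P \<in> proj_points N"
  defines "K \<equiv> function_field (N, P)"
  assumes a: "a \<in> carrier K" and x: "\<one>\<^bsub>K\<^esub> \<otimes>\<^bsub>K\<^esub> x \<in> carrier K"
  shows "a \<otimes>\<^bsub>K\<^esub> x = a \<otimes>\<^bsub>K\<^esub> (\<one>\<^bsub>K\<^esub> \<otimes>\<^bsub>K\<^esub> x)"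
proof -
  note rf = rat_fun_eq[OF P]
  have m: "y \<otimes>\<^bsub>K\<^esub> z = (\<Union>a\<in>y. \<Union>b\<in>z. rat_fun (N, P) (a * b))" for y z
    unfolding K_def function_field_eq[OF P] FactRing_def by (simp add: rcoset_mult_def rat_fun_eq'[OF P])
  obtain c where c: "c \<in> loc N P" "\<one>\<^bsub>K\<^esub> \<otimes>\<^bsub>K\<^esub> x = rat_fun (N, P) c" using x by (auto simp: K_def ff_carrier[OF P])
  obtain a0 where a0: "a0 \<in> loc N P" "a = rat_fun (N, P) a0" using a by (auto simp: K_def ff_carrier[OF P])
  note z = locm_0[OF P]
  have one: "\<one>\<^bsub>K\<^esub> = rat_fun (N, P) 1" by (simp add: K_def rf_one[OF P])
  have self: "y \<in> rat_fun (N, P) y" for y unfolding rf using z by force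
  have sub: "b \<in> rat_fun (N, P) c" if "b \<in> x" for b
    unfolding c(2)[symmetric] m one using that self[of 1] self[of b] by (intro UN_I[of 1] UN_I[of b]) auto
  have ne: "x \<noteq> {}"
  proof
    assume "x = {}"
    then have "rat_fun (N, P) c = {}" using c(2) m by auto
    then show False using self[of c] by auto
  qed
  have e: "rat_fun (N, P) (a' * b) = rat_fun (N, P) (a0 * c)" if ab: "a' \<in> a" "b \<in> x" for a' b
  proof -
    obtain h1 h2 where h: "h1 \<in> locm N P" "a' = h1 + a0" "h2 \<in> locm N P" "b = h2 + c"
      using ab sub[OF ab(2)] a0(2) by (auto simp: rf)
    have l: "h1 \<in> loc N P" "h2 \<in> loc N P" using h locm_subset[OF P] by auto
    note sr = loc_subring[OF P]
    have "a' * b - a0 * c = h1 * (h2 + c) + h2 * a0" using h by (simp add: algebra_simps)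
    also have "\<dots> \<in> locm N P" by (intro locm_add[OF P] locm_mult[OF P] h sr_add[OF sr] l c a0)
    finally show ?thesis
      using h l c a0 by (subst rat_fun_eq_iff[OF P]) (auto intro!: sr_add[OF sr] sr_mult[OF sr])
  qed
  have ane: "a \<noteq> {}" using self[of a0] a0 by auto
  have "a \<otimes>\<^bsub>K\<^esub> x = (\<Union>a'\<in>a. \<Union>b\<in>x. rat_fun (N, P) (a0 * c))"
    unfolding m by (intro SUP_cong refl e)
  also have "\<dots> = rat_fun (N, P) (a0 * c)" using ne ane by simp
  also have "\<dots> = a \<otimes>\<^bsub>K\<^esub> rat_fun (N, P) c" using rf_mult[OF P a0(1) c(1)] by (simp add: a0(2) K_def)
  finally show ?thesis by (simp add: c(2))
qed

text \<open>
  A copy of the function field of a variety inside the field of fractions, equal to the function field of $P^n$. It is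
  used for the variety \<open>Z\<close>, by means of a birational map from $P^n$, and for $P^n$ itself, by means of the identity.
\<close>

locale ff_model =
  fixes N :: nat and P :: "'k::field mpol set" and n :: nat and \<phi> :: "'k mpol fract set \<Rightarrow> 'k mpol fract"
  assumes P: "P \<in> proj_points N"
    and m_mult: "x \<in> carrier (function_field (N, P)) \<Longrightarrow> y \<in> carrier (function_field (N, P)) \<Longrightarrow>
          \<phi> (x \<otimes>\<^bsub>function_field (N, P)\<^esub> y) = \<phi> x * \<phi> y"
    and m_add: "x \<in> carrier (function_field (N, P)) \<Longrightarrow> y \<in> carrier (function_field (N, P)) \<Longrightarrow>
          \<phi> (x \<oplus>\<^bsub>function_field (N, P)\<^esub> y) = \<phi> x + \<phi> y"
    and m_one: "\<phi> \<one>\<^bsub>function_field (N, P)\<^esub> = 1"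
    and m_bij: "bij_betw \<phi> (carrier (function_field (N, P))) (loc n {0})"
    and m_const: "\<phi> (rat_fun (N, P) (to_fract (Const c))) = to_fract (Const c)"
begin

abbreviation "V \<equiv> (N, P)"
abbreviation "K \<equiv> function_field (N, P)"

sublocale R: cring K by (rule ff_cring[OF P])

definition \<psi> where "\<psi> = inv_into (carrier K) \<phi>"

lemma phi_closed: "x \<in> carrier K \<Longrightarrow> \<phi> x \<in> loc n {0}"
  using m_bij by (auto simp: bij_betw_def)

lemma phi_inj: "x \<in> carrier K \<Longrightarrow> y \<in> carrier K \<Longrightarrow> \<phi> x = \<phi> y \<longleftrightarrow> x = y"
  using m_bij by (auto simp: bij_betw_def inj_on_def)

lemma psi_closed: "a \<in> loc n {0} \<Longrightarrow> \<psi> a \<in> carrier K"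
  unfolding \<psi>_def using m_bij by (metis bij_betw_def inv_into_into)

lemma phi_psi [simp]: "a \<in> loc n {0} \<Longrightarrow> \<phi> (\<psi> a) = a"
  unfolding \<psi>_def using m_bij by (simp add: bij_betw_def f_inv_into_f)

lemma psi_phi [simp]: "x \<in> carrier K \<Longrightarrow> \<psi> (\<phi> x) = x"
  unfolding \<psi>_def using m_bij by (simp add: bij_betw_def)

lemma phi_eqI: "x \<in> carrier K \<Longrightarrow> y \<in> carrier K \<Longrightarrow> \<phi> x = \<phi> y \<Longrightarrow> x = y"
  by (simp add: phi_inj)

lemma m_zero: "\<phi> \<zero>\<^bsub>K\<^esub> = 0"
  using m_add[OF R.zero_closed R.zero_closed] unfolding R.l_zero[OF R.zero_closed]
  by (metis add_cancel_right_right)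

lemma m_uminus: assumes "x \<in> carrier K" shows "\<phi> (\<ominus>\<^bsub>K\<^esub> x) = - \<phi> x"
proof -
  have "\<phi> x + \<phi> (\<ominus>\<^bsub>K\<^esub> x) = 0" using m_add[of x "\<ominus>\<^bsub>K\<^esub> x"] assms by (simp add: R.r_neg m_zero)
  then show ?thesis by (simp add: eq_neg_iff_add_eq_0 add.commute)
qed

lemma m_finsum: "finite S \<Longrightarrow> (\<And>s. s \<in> S \<Longrightarrow> f s \<in> carrier K) \<Longrightarrow> \<phi> (finsum K f S) = (\<Sum>s\<in>S. \<phi> (f s))"
proof (induction rule: finite_induct)
  case (insert x S)
  then show ?case by (subst R.finsum_insert) (auto simp: m_add Pi_def)
qed (simp add: m_zero)

lemma m_finprod: "finite S \<Longrightarrow> (\<And>s. s \<in> S \<Longrightarrow> f s \<in> carrier K) \<Longrightarrow> \<phi> (finprod K f S) = (\<Prod>s\<in>S. \<phi> (f s))"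
proof (induction rule: finite_induct)
  case (insert x S)
  then show ?case by (subst R.finprod_insert) (auto simp: m_mult Pi_def)
qed (simp add: m_one)

lemma m_sign:
  assumes "x \<in> carrier K"
  shows "[sign p] \<cdot>\<^bsub>K\<^esub> x \<in> carrier K" "\<phi> ([sign p] \<cdot>\<^bsub>K\<^esub> x) = of_int (sign p) * \<phi> x"
proof -
  show "[sign p] \<cdot>\<^bsub>K\<^esub> x \<in> carrier K" using assms by simp
  consider "sign p = 1" | "sign p = - 1" by (cases "evenperm p") (auto simp: sign_def)
  then show "\<phi> ([sign p] \<cdot>\<^bsub>K\<^esub> x) = of_int (sign p) * \<phi> x"
  proof cases
    case 1
    then show ?thesis using assms R.add.int_pow_1[of x] by simp
  next
    case 2
    have "[(- 1 :: int)] \<cdot>\<^bsub>K\<^esub> x = \<ominus>\<^bsub>K\<^esub> x"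
      using R.add.int_pow_neg[of x 1] R.add.int_pow_1[of x] assms by simp
    then show ?thesis using 2 assms by (simp add: m_uminus)
  qed
qed

lemma m_det:
  assumes A: "\<And>i j. i < c \<Longrightarrow> j < c \<Longrightarrow> A i j \<in> carrier K"
  shows "ring_det K c A \<in> carrier K" "\<phi> (ring_det K c A) = det (mat c c (\<lambda>(i, j). \<phi> (A i j)))"
proof -
  have fin: "finite {p. p permutes {..<c}}" by (rule finite_permutations) simp
  have pr: "finprod K (\<lambda>i. A i (p i)) {..<c} \<in> carrier K" "\<phi> (finprod K (\<lambda>i. A i (p i)) {..<c}) = (\<Prod>i<c. \<phi> (A i (p i)))"
    if "p permutes {..<c}" for p
  proof -
    have "A i (p i) \<in> carrier K" if "i < c" for i
      using A[of i "p i"] permutes_in_image[OF \<open>p permutes {..<c}\<close>, of i] that by auto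
    then show "finprod K (\<lambda>i. A i (p i)) {..<c} \<in> carrier K" "\<phi> (finprod K (\<lambda>i. A i (p i)) {..<c}) = (\<Prod>i<c. \<phi> (A i (p i)))"
      by (auto intro!: R.finprod_closed m_finprod)
  qed
  show "ring_det K c A \<in> carrier K"
    unfolding ring_det_def by (rule R.finsum_closed) (auto intro: m_sign(1) pr)
  have "\<phi> (ring_det K c A) = (\<Sum>p\<in>{p. p permutes {..<c}}. of_int (sign p) * (\<Prod>i<c. \<phi> (A i (p i))))"
    unfolding ring_det_def by (subst m_finsum[OF fin]) (auto intro!: sum.cong m_sign(1) pr simp: m_sign(2) pr)
  also have "\<dots> = det (mat c c (\<lambda>(i, j). \<phi> (A i j)))"
    by (subst det_def'[of _ c])
       (auto simp: lessThan_atLeast0 intro!: sum.cong prod.cong arg_cong2[where f="(*)"] dest: permutes_in_image)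
  finally show "\<phi> (ring_det K c A) = det (mat c c (\<lambda>(i, j). \<phi> (A i j)))" .
qed

definition der :: "('k mpol fract \<Rightarrow> 'k mpol fract) \<Rightarrow> 'k mpol fract set \<Rightarrow> 'k mpol fract set" where
  "der D = (\<lambda>x\<in>carrier K. \<psi> (D (\<phi> x)))"

lemma const_closed: "rat_fun V (to_fract (Const c)) \<in> carrier K"
  by (rule rf_closed[OF P loc_Const[OF P]])

lemma phi_der:
  assumes "D \<in> Ders n" "x \<in> carrier K" shows "der D x \<in> carrier K" "\<phi> (der D x) = D (\<phi> x)"
proof -
  have "D (\<phi> x) \<in> loc n {0}" by (rule der_closed[OF K_subring Ders_derivs[OF assms(1)] phi_closed[OF assms(2)]])
  then show "der D x \<in> carrier K" "\<phi> (der D x) = D (\<phi> x)" using assms psi_closed by (simp_all add: der_def)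
qed

lemma der_derivations:
  assumes D: "D \<in> Ders n" shows "der D \<in> derivations V"
proof -
  note d = Ders_derivs[OF D]
  have c1: "der D \<in> carrier K \<rightarrow>\<^sub>E carrier K"
  proof (rule PiE_I)
    show "der D x \<in> carrier K" if "x \<in> carrier K" for x using phi_der(1)[OF D that] .
    show "der D x = undefined" if "x \<notin> carrier K" for x using that by (simp add: der_def)
  qed
  have c2: "der D (a \<oplus>\<^bsub>K\<^esub> b) = der D a \<oplus>\<^bsub>K\<^esub> der D b" if "a \<in> carrier K" "b \<in> carrier K" for a b
    by (rule phi_eqI) (use that in \<open>simp_all add: phi_der[OF D] m_add der_add[OF K_subring d phi_closed phi_closed]\<close>)
  have c3: "der D (a \<otimes>\<^bsub>K\<^esub> b) = (der D a \<otimes>\<^bsub>K\<^esub> b) \<oplus>\<^bsub>K\<^esub> (a \<otimes>\<^bsub>K\<^esub> der D b)" if "a \<in> carrier K" "b \<in> carrier K" for a b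
    by (rule phi_eqI) (use that in \<open>simp_all add: phi_der[OF D] m_add m_mult der_mult[OF K_subring d phi_closed phi_closed]\<close>)
  have c4: "der D (rat_fun V (Fraction_Field.Fract (Const c) 1)) = \<zero>\<^bsub>K\<^esub>" for c
    by (rule phi_eqI) (use D const_closed in \<open>simp_all add: Fract_conv phi_der[OF D] m_const m_zero Ders_def\<close>)
  show ?thesis unfolding derivations_def Let_def
    by (intro CollectI conjI ballI allI c1 c2 c3 c4)
qed

definition ders :: "(nat \<Rightarrow> 'k mpol fract \<Rightarrow> 'k mpol fract) \<Rightarrow> nat \<Rightarrow> 'k mpol fract set \<Rightarrow> 'k mpol fract set" where
  "ders D = (\<lambda>i\<in>{..<n}. der (D i))"

lemma ders_PiE: "Dtuple n D \<Longrightarrow> ders D \<in> {..<n} \<rightarrow>\<^sub>E derivations V"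
  unfolding ders_def by (auto simp: Dtuple_def der_derivations)

lemma dform_ders:
  assumes D: "Dtuple n D" and g: "g \<in> carrier K" and a: "\<And>j. j < n \<Longrightarrow> a j \<in> carrier K"
  shows "dform n V g a (ders D) \<in> carrier K" "\<phi> (dform n V g a (ders D)) = \<phi> g * jac n D (\<lambda>j. \<phi> (a j))"
proof -
  have e: "dform n V g a (ders D) = g \<otimes>\<^bsub>K\<^esub> ring_det K n (\<lambda>i j. ders D i (a j))"
    using ders_PiE[OF D] by (simp add: dform_def)
  have A: "ders D i (a j) \<in> carrier K" "\<phi> (ders D i (a j)) = D i (\<phi> (a j))" if "i < n" "j < n" for i j
    using D a[OF that(2)] that by (simp_all add: ders_def Dtuple_def phi_der)
  have "mat n n (\<lambda>(i, j). \<phi> (ders D i (a j))) = mat n n (\<lambda>(i, j). D i (\<phi> (a j)))"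
    by (rule eq_matI) (simp_all add: A)
  then show "dform n V g a (ders D) \<in> carrier K" "\<phi> (dform n V g a (ders D)) = \<phi> g * jac n D (\<lambda>j. \<phi> (a j))"
    unfolding e using m_det[of n "\<lambda>i j. ders D i (a j)", OF A(1)] g by (simp_all add: m_mult jac_def)
qed

lemma stalk_carrier: "Q \<in> points V \<Longrightarrow> stalk V Q \<subseteq> carrier K"
  using loc_mono[of Q N P] by (auto simp: stalk_def points_def intro!: rf_closed[OF P])

lemma stalk_one: assumes "Q \<in> points V" shows "\<one>\<^bsub>K\<^esub> \<in> stalk V Q"
proof -
  have "1 \<in> loc N Q" using assms by (intro sr_1 loc_subring) (simp add: points_def)
  then show ?thesis by (simp add: stalk_def rf_one[OF P])
qed

lemma jac_wronsk:
  fixes a :: "nat \<Rightarrow> 'k mpol fract"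
  assumes "Dtuple n D" shows "jac n D a = wronsk n D (\<lambda>k. case k of 0 \<Rightarrow> 1 | Suc j \<Rightarrow> a j)"
proof -
  have "wronsk n D (\<lambda>k. case k of 0 \<Rightarrow> 1 | Suc j \<Rightarrow> a j) = jac n D (\<lambda>j. (case Suc j of 0 \<Rightarrow> 1 | Suc j \<Rightarrow> a j))"
    by (rule wronsk_one) (use assms in \<open>auto simp: Dtuple_def intro!: der_1[OF K_subring Ders_derivs]\<close>)
  then show ?thesis by simp
qed

context
  fixes Q Q0 :: "'k mpol set" and i :: nat
  assumes Q: "Q \<in> points V" and Q0: "Q0 \<in> proj_points n" and st: "\<phi> ` stalk V Q = loc n Q0"
    and i: "i \<le> n" "Var i \<notin> Q0"
begin

lemma st_loc: "x \<in> stalk V Q \<Longrightarrow> \<phi> x \<in> loc n Q0"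
  using st by blast

lemma st_car: "x \<in> stalk V Q \<Longrightarrow> x \<in> carrier K"
  using stalk_carrier[OF Q] by blast

text \<open>
  Through \<open>\<phi>\<close>, every element $g\, da_0 \wedge \dots \wedge da_{n-1}$ of the stalk is \<open>g\<close> times
  $W(1, a_0, \dots, a_{n-1})$, to which \<open>frame_wronsk\<close> applies.
\<close>

lemma canonical_stalk_wronsk:
  assumes "\<omega> \<in> canonical_stalk n V Q"
  shows "\<exists>r\<in>loc n Q0. \<forall>D. Dtuple n D \<longrightarrow> \<omega> (ders D) \<in> carrier K \<and> \<phi> (\<omega> (ders D)) = r * wronsk n D (aff i)"
  using assms
proof (induction rule: canonical_stalk.induct)
  case (wedge g a)
  let ?b = "\<lambda>k. case k of 0 \<Rightarrow> 1 | Suc j \<Rightarrow> \<phi> (a j)"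
  have "?b j \<in> loc n Q0" if "j \<le> n" for j
    using that sr_1[OF loc_subring[OF Q0]] st_loc[OF wedge(2)] by (auto split: nat.split)
  then obtain r where r: "r \<in> loc n Q0" "\<And>D. Dtuple n D \<Longrightarrow> wronsk n D ?b = r * wronsk n D (aff i)"
    using frame_wronsk[OF Q0 i, of ?b] by blast
  have "dform n V g a (ders D) \<in> carrier K \<and> \<phi> (dform n V g a (ders D)) = \<phi> g * r * wronsk n D (aff i)"
    if D: "Dtuple n D" for D
    using dform_ders[OF D st_car[OF wedge(1)] st_car[OF wedge(2)]] r(2)[OF D] jac_wronsk[OF D, of "\<lambda>j. \<phi> (a j)"]
    by (simp add: mult.assoc)
  moreover have "\<phi> g * r \<in> loc n Q0" using sr_mult[OF loc_subring[OF Q0] st_loc[OF wedge(1)] r(1)] .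
  ultimately show ?case by blast
next
  case (add \<omega> \<omega>')
  then obtain r r' where r: "r \<in> loc n Q0" "r' \<in> loc n Q0"
    "\<And>D. Dtuple n D \<Longrightarrow> \<omega> (ders D) \<in> carrier K \<and> \<phi> (\<omega> (ders D)) = r * wronsk n D (aff i)"
    "\<And>D. Dtuple n D \<Longrightarrow> \<omega>' (ders D) \<in> carrier K \<and> \<phi> (\<omega>' (ders D)) = r' * wronsk n D (aff i)" by blast
  have "dform_add n V \<omega> \<omega>' (ders D) \<in> carrier K \<and> \<phi> (dform_add n V \<omega> \<omega>' (ders D)) = (r + r') * wronsk n D (aff i)"
    if D: "Dtuple n D" for D
    using ders_PiE[OF D] r(3,4)[OF D] by (simp add: dform_add_def m_add distrib_right)
  moreover have "r + r' \<in> loc n Q0" using sr_add[OF loc_subring[OF Q0] r(1,2)] .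
  ultimately show ?case by blast
qed

text \<open>
  The given generator of the stalk is a multiple of $W(x/x_i)$ by \<open>canonical_stalk_wronsk\<close>. The stalk also contains the form
  $d(x_0/x_i) \wedge \dots \wedge d(x_n/x_i)$ with the $i$-th factor left out, which is $W(x/x_i)$ up to sign, so the two generators differ by
  a unit \<open>b\<close>.
\<close>

lemma local_equation_wronsk:
  fixes D0 :: "nat \<Rightarrow> 'k mpol fract \<Rightarrow> 'k mpol fract"
  assumes le: "local_equation n V Q (dform n V g a) h" and g: "g \<in> carrier K" and a: "\<And>j. j < n \<Longrightarrow> a j \<in> carrier K"
    and D0: "Dtuple n D0" "wronsk n D0 (aff i) \<noteq> 0"
  shows "\<exists>b\<in>loc n Q0 - locm n Q0. \<forall>D. Dtuple n D \<longrightarrow> \<phi> g * jac n D (\<lambda>j. \<phi> (a j)) = \<phi> h * b * wronsk n D (aff i)"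
proof -
  from le obtain \<omega> where h: "h \<in> carrier K"
    and can: "canonical_stalk n V Q = (\<lambda>a. dform_smult n V a \<omega>) ` stalk V Q"
    and eq: "dform n V g a = dform_smult n V h \<omega>" unfolding local_equation_def by blast
  have sm: "dform_smult n V s \<omega> (ders D) = s \<otimes>\<^bsub>K\<^esub> \<omega> (ders D)" if "Dtuple n D" for s D
    using ders_PiE[OF that] by (simp add: dform_smult_def)
  have "dform_smult n V \<one>\<^bsub>K\<^esub> \<omega> \<in> canonical_stalk n V Q" using can stalk_one[OF Q] by blast
  from canonical_stalk_wronsk[OF this] obtain r where r: "r \<in> loc n Q0"
    "\<And>D. Dtuple n D \<Longrightarrow> \<one>\<^bsub>K\<^esub> \<otimes>\<^bsub>K\<^esub> \<omega> (ders D) \<in> carrier K \<and> \<phi> (\<one>\<^bsub>K\<^esub> \<otimes>\<^bsub>K\<^esub> \<omega> (ders D)) = r * wronsk n D (aff i)"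
    using sm by auto
  have sw: "\<phi> (s \<otimes>\<^bsub>K\<^esub> \<omega> (ders D)) = \<phi> s * r * wronsk n D (aff i)" if "Dtuple n D" "s \<in> carrier K" for s D
    using r(2)[OF that(1)] rf_mult_one[OF P that(2), of "\<omega> (ders D)"] that by (simp add: m_mult mult.assoc)
  have "\<exists>x\<in>stalk V Q. \<phi> x = aff i k" if "k \<le> n" for k
  proof -
    have "aff i k \<in> \<phi> ` stalk V Q" unfolding st aff_def by (rule aff_loc[OF Q0 i that])
    then show ?thesis by auto
  qed
  then have "\<forall>k. \<exists>x. k \<le> n \<longrightarrow> x \<in> stalk V Q \<and> \<phi> x = aff i k" by blast
  from choice[OF this] obtain y where y: "\<And>k. k \<le> n \<Longrightarrow> y k \<in> stalk V Q \<and> \<phi> (y k) = aff i k" by blast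
  \<comment> \<open>The transposition moves the constant coordinate $x_i/x_i$ to the front, where \<open>wronsk_one\<close> expects it.\<close>
  let ?\<tau> = "Transposition.transpose 0 i"
  have \<tau>: "?\<tau> k \<le> n" if "k \<le> n" for k using that i by (auto simp: Transposition.transpose_def)
  define a' where "a' = (\<lambda>j. y (?\<tau> (Suc j)))"
  have a': "a' j \<in> stalk V Q" "\<phi> (a' j) = aff i (?\<tau> (Suc j))" if "j < n" for j
    using y[OF \<tau>[of "Suc j"]] that by (simp_all add: a'_def)
  have "dform n V \<one>\<^bsub>K\<^esub> a' \<in> canonical_stalk n V Q"
    by (rule canonical_stalk.wedge[OF stalk_one[OF Q] a'(1)])
  then obtain s where s: "s \<in> stalk V Q" "dform n V \<one>\<^bsub>K\<^esub> a' = dform_smult n V s \<omega>" using can by auto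
  have "\<phi> s * r * wronsk n D0 (aff i) = \<phi> (dform n V \<one>\<^bsub>K\<^esub> a' (ders D0))"
    using sw[OF D0(1) st_car[OF s(1)]] sm[OF D0(1)] s(2) by simp
  also have "\<dots> = jac n D0 (\<lambda>j. \<phi> (a' j))"
    using dform_ders(2)[OF D0(1) R.one_closed st_car[OF a'(1)]] by (simp add: m_one)
  also have "\<dots> = jac n D0 (\<lambda>j. (aff i \<circ> ?\<tau>) (Suc j))" by (rule jac_cong) (simp add: a'(2))
  also have "\<dots> = wronsk n D0 (aff i \<circ> ?\<tau>)"
    by (rule wronsk_one[symmetric]) (use D0(1) in \<open>auto simp: Dtuple_def intro!: der_1[OF K_subring Ders_derivs]\<close>)
  also have "\<dots> = (if i = 0 then 1 else - 1) * wronsk n D0 (aff i)" by (rule wronsk_swap[OF i(1)])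
  finally have sr1: "\<phi> s * r = (if i = 0 then 1 else - 1)" using D0(2) by (simp only: mult_cancel_right) simp
  have "r \<notin> locm n Q0"
  proof
    assume "r \<in> locm n Q0"
    then have "r * \<phi> s \<in> locm n Q0" using st_loc[OF s(1)] by (rule locm_mult[OF Q0])
    then have "r * \<phi> s * (r * \<phi> s) \<in> locm n Q0" using locm_mult[OF Q0] locm_subset[OF Q0] by (metis subsetD)
    moreover have "r * \<phi> s * (r * \<phi> s) = 1" using sr1 by (simp add: mult.commute)
    ultimately show False using one_notin_locm[OF Q0] by simp
  qed
  moreover have "\<phi> g * jac n D (\<lambda>j. \<phi> (a j)) = \<phi> h * r * wronsk n D (aff i)" if D: "Dtuple n D" for D
  proof -
    have "\<phi> (dform n V g a (ders D)) = \<phi> g * jac n D (\<lambda>j. \<phi> (a j))" by (rule dform_ders(2)[OF D g a])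
    then show ?thesis using sw[OF D h] sm[OF D, of h] eq by simp
  qed
  ultimately show ?thesis using r(1) by blast
qed

end

lemma derivations_der:
  assumes D: "D \<in> derivations V"
  shows "\<exists>D'\<in>Ders n. der D' = D"
proof -
  define D' where "D' = (\<lambda>a. \<phi> (D (\<psi> a)))"
  have DD: "D \<in> carrier K \<rightarrow>\<^sub>E carrier K"
    and Da: "\<And>a b. a \<in> carrier K \<Longrightarrow> b \<in> carrier K \<Longrightarrow> D (a \<oplus>\<^bsub>K\<^esub> b) = D a \<oplus>\<^bsub>K\<^esub> D b"
    and Dm: "\<And>a b. a \<in> carrier K \<Longrightarrow> b \<in> carrier K \<Longrightarrow>
         D (a \<otimes>\<^bsub>K\<^esub> b) = (D a \<otimes>\<^bsub>K\<^esub> b) \<oplus>\<^bsub>K\<^esub> (a \<otimes>\<^bsub>K\<^esub> D b)"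
    and Dc: "\<And>c. D (rat_fun V (Fraction_Field.Fract (Const c) 1)) = \<zero>\<^bsub>K\<^esub>"
    using D unfolding derivations_def Let_def by auto
  have Dcl: "D x \<in> carrier K" if "x \<in> carrier K" for x using DD that by (rule PiE_mem)
  have psi_add: "\<psi> (a + b) = \<psi> a \<oplus>\<^bsub>K\<^esub> \<psi> b" if "a \<in> loc n {0}" "b \<in> loc n {0}" for a b
    by (rule phi_eqI) (use that sr_add[OF K_subring that] in \<open>simp_all add: psi_closed m_add\<close>)
  have psi_mult: "\<psi> (a * b) = \<psi> a \<otimes>\<^bsub>K\<^esub> \<psi> b" if "a \<in> loc n {0}" "b \<in> loc n {0}" for a b
    by (rule phi_eqI) (use that sr_mult[OF K_subring that] in \<open>simp_all add: psi_closed m_mult\<close>)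
  have psi_const: "\<psi> (to_fract (Const c)) = rat_fun V (to_fract (Const c))" for c
    using psi_phi[OF const_closed[of c]] by (simp add: m_const)
  have "D' \<in> derivs (loc n {0})"
    unfolding derivs_def
  proof (intro CollectI conjI ballI)
    fix a :: "'k mpol fract" assume a: "a \<in> loc n {0}"
    show "D' a \<in> loc n {0}" unfolding D'_def by (rule phi_closed[OF Dcl[OF psi_closed[OF a]]])
    fix b :: "'k mpol fract" assume b: "b \<in> loc n {0}"
    show "D' (a + b) = D' a + D' b"
      unfolding D'_def psi_add[OF a b] Da[OF psi_closed[OF a] psi_closed[OF b]]
      by (rule m_add[OF Dcl[OF psi_closed[OF a]] Dcl[OF psi_closed[OF b]]])
    show "D' (a * b) = D' a * b + a * D' b"
      unfolding D'_def psi_mult[OF a b] Dm[OF psi_closed[OF a] psi_closed[OF b]]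
      using a b by (simp add: m_add m_mult Dcl psi_closed)
  qed
  moreover have "D' (to_fract (Const c)) = 0" for c
    unfolding D'_def psi_const using Dc[of c] by (simp add: Fract_conv m_zero)
  ultimately have D': "D' \<in> Ders n" by (simp add: Ders_def)
  have "der D' x = D x" for x
  proof (cases "x \<in> carrier K")
    case True
    then show ?thesis by (simp add: der_def D'_def Dcl)
  next
    case False
    then show ?thesis using PiE_arb[OF DD] by (simp add: der_def)
  qed
  then have "der D' = D" by (rule ext)
  with D' show ?thesis by blast
qed

lemma PiE_ders:
  assumes D: "D \<in> {..<n} \<rightarrow>\<^sub>E derivations V"
  shows "\<exists>D'. Dtuple n D' \<and> ders D' = D"
proof -
  have "\<forall>i. \<exists>D'. i < n \<longrightarrow> D' \<in> Ders n \<and> der D' = D i" using derivations_der PiE_mem[OF D] by blast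
  from choice[OF this] obtain D' where D': "\<And>i. i < n \<Longrightarrow> D' i \<in> Ders n \<and> der (D' i) = D i" by blast
  have "ders D' i = D i" for i
    using D' PiE_arb[OF D, of i] by (cases "i < n") (simp_all add: ders_def)
  then have "ders D' = D" by (rule ext)
  then show ?thesis using D' unfolding Dtuple_def by blast
qed

text \<open>
  Every form is a multiple of $W(x/x_0)$ by \<open>frame_wronsk\<close>, so a nonzero one forces $W(x/x_0)$ to be nonzero.
\<close>

lemma dform_nonzero:
  assumes nzf: "dform n V g a \<noteq> dform_zero n V" and g: "g \<in> carrier K" and a: "\<And>j. j < n \<Longrightarrow> a j \<in> carrier K"
  shows "\<exists>D. Dtuple n D \<and> wronsk n D (aff 0) \<noteq> (0 :: 'k mpol fract)"
proof (rule ccontr)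
  assume "\<not> ?thesis"
  then have z: "wronsk n D (aff 0) = (0 :: 'k mpol fract)" if "Dtuple n D" for D using that by blast
  let ?b = "\<lambda>k. case k of 0 \<Rightarrow> 1 | Suc j \<Rightarrow> \<phi> (a j)"
  have "?b j \<in> loc n {0}" if "j \<le> n" for j
    using that sr_1[OF K_subring] phi_closed[OF a] by (auto split: nat.split)
  then obtain r where r: "\<And>D. Dtuple n D \<Longrightarrow> wronsk n D ?b = r * wronsk n D (aff 0)"
    using frame_wronsk[OF zero_pp, of 0 n ?b] by auto
  have "dform n V g a D = dform_zero n V D" for D
  proof (cases "D \<in> {..<n} \<rightarrow>\<^sub>E derivations V")
    case True
    then obtain D' where D': "Dtuple n D'" "ders D' = D" using PiE_ders by blast
    have "\<phi> (dform n V g a D) = 0"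
      using dform_ders(2)[OF D'(1) g a] r[OF D'(1)] z[OF D'(1)] jac_wronsk[OF D'(1), of "\<lambda>j. \<phi> (a j)"] D'(2) by simp
    then have "dform n V g a D = \<zero>\<^bsub>K\<^esub>"
      using dform_ders(1)[OF D'(1) g a] D'(2) by (intro phi_eqI) (simp_all add: m_zero)
    then show ?thesis using True by (simp add: dform_zero_def)
  next
    case False
    then show ?thesis by (simp add: dform_def dform_zero_def)
  qed
  then have "dform n V g a = dform_zero n V" by (rule ext)
  with nzf show False by simp
qed

lemma m_nat_pow: "x \<in> carrier K \<Longrightarrow> \<phi> (x [^]\<^bsub>K\<^esub> (k::nat)) = \<phi> x ^ k"
  by (induction k) (simp_all add: m_one m_mult mult.commute)

lemma m_inv:
  assumes "x \<in> carrier K" "x \<noteq> \<zero>\<^bsub>K\<^esub>"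
  shows "inv\<^bsub>K\<^esub> x \<in> carrier K" "\<phi> (inv\<^bsub>K\<^esub> x) = inverse (\<phi> x)"
proof -
  have nz': "\<phi> x \<noteq> 0" using phi_inj[OF assms(1) R.zero_closed] assms(2) by (simp add: m_zero)
  have y: "\<psi> (inverse (\<phi> x)) \<in> carrier K" "\<phi> (\<psi> (inverse (\<phi> x))) = inverse (\<phi> x)"
    using K_inverse[OF phi_closed[OF assms(1)]] psi_closed by auto
  have "x \<otimes>\<^bsub>K\<^esub> \<psi> (inverse (\<phi> x)) = \<one>\<^bsub>K\<^esub>"
    by (rule phi_eqI) (use assms y nz' in \<open>simp_all add: m_mult m_one\<close>)
  then have "inv\<^bsub>K\<^esub> x = \<psi> (inverse (\<phi> x))" by (rule R.comm_inv_char[OF assms(1) y(1)])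
  then show "inv\<^bsub>K\<^esub> x \<in> carrier K" "\<phi> (inv\<^bsub>K\<^esub> x) = inverse (\<phi> x)" using y by auto
qed

lemma m_int_pow:
  assumes "x \<in> carrier K" "x \<noteq> \<zero>\<^bsub>K\<^esub>"
  shows "x [^]\<^bsub>K\<^esub> (k::int) \<in> carrier K" "\<phi> (x [^]\<^bsub>K\<^esub> k) = \<phi> x powi k"
proof -
  have nz': "\<phi> x \<noteq> 0" using phi_inj[OF assms(1) R.zero_closed] assms(2) by (simp add: m_zero)
  have p: "x [^]\<^bsub>K\<^esub> (j::nat) \<in> carrier K" "x [^]\<^bsub>K\<^esub> j \<noteq> \<zero>\<^bsub>K\<^esub>" for j
  proof -
    show "x [^]\<^bsub>K\<^esub> j \<in> carrier K" using assms by simp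
    have "\<phi> (x [^]\<^bsub>K\<^esub> j) \<noteq> 0" using nz' assms by (simp add: m_nat_pow)
    then show "x [^]\<^bsub>K\<^esub> j \<noteq> \<zero>\<^bsub>K\<^esub>" using m_zero by auto
  qed
  have "x [^]\<^bsub>K\<^esub> k \<in> carrier K \<and> \<phi> (x [^]\<^bsub>K\<^esub> k) = \<phi> x powi k"
  proof (cases "k < 0")
    case True
    then have e: "x [^]\<^bsub>K\<^esub> k = inv\<^bsub>K\<^esub> (x [^]\<^bsub>K\<^esub> nat (- k))" by (simp only: int_pow_def2 if_True)
    show ?thesis
      unfolding e m_inv(2)[OF p] m_nat_pow[OF assms(1)] using True
      by (intro conjI, intro m_inv(1)[OF p]) (simp add: power_int_def power_inverse)
  next
    case False
    then have e: "x [^]\<^bsub>K\<^esub> k = x [^]\<^bsub>K\<^esub> nat k" by (simp only: int_pow_def2 if_False)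
    show ?thesis
      unfolding e m_nat_pow[OF assms(1)] using False by (intro conjI, intro p(1)) (simp add: power_int_def)
  qed
  then show "x [^]\<^bsub>K\<^esub> k \<in> carrier K" "\<phi> (x [^]\<^bsub>K\<^esub> k) = \<phi> x powi k" by auto
qed

lemma has_order_phi:
  assumes ho: "has_order V E h m" and E: "E \<in> points V"
  shows "\<exists>t u. t \<in> \<phi> ` stalk V E \<and> t \<noteq> 0 \<and> \<phi> ` stalk_max V E = (\<lambda>a. a * t) ` (\<phi> ` stalk V E) \<and>
     u \<in> \<phi> ` (stalk V E - stalk_max V E) \<and> \<phi> h = u * t powi m"
proof -
  from ho obtain t u where tu: "t \<in> stalk V E" "u \<in> stalk V E - stalk_max V E" "t \<noteq> \<zero>\<^bsub>K\<^esub>"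
    "stalk_max V E = (\<lambda>a. a \<otimes>\<^bsub>K\<^esub> t) ` stalk V E" "h = u \<otimes>\<^bsub>K\<^esub> t [^]\<^bsub>K\<^esub> m"
    unfolding has_order_def Let_def by blast
  have car: "x \<in> carrier K" if "x \<in> stalk V E" for x using that stalk_carrier[OF E] by auto
  have "\<phi> t \<noteq> 0" using phi_inj[OF car[OF tu(1)] R.zero_closed] tu(3) by (simp add: m_zero)
  moreover have "\<phi> ` stalk_max V E = (\<lambda>a. a * \<phi> t) ` (\<phi> ` stalk V E)"
    unfolding tu(4) image_image by (rule image_cong) (use car tu(1) in \<open>auto simp: m_mult\<close>)
  moreover have "\<phi> h = \<phi> u * \<phi> t powi m"
    using tu(2) car m_int_pow[OF car[OF tu(1)] tu(3)] by (simp add: tu(5) m_mult)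
  ultimately show ?thesis using tu(1,2) by blast
qed

end

text \<open>
  Surjectivity comes from the inverse tuple \<open>G\<close>: pulling a function back along \<open>G\<close> gives its preimage.
\<close>

lemma field_pull_model:
  fixes P :: "'k::field mpol set"
  assumes P: "P \<in> proj_points N" and inv: "inverse_maps (Xn n) (N, P) F G"
  shows "ff_model N P n (field_pull n (N, P) F)"
proof -
  have dF: "dominant (Xn n) (N, P) F" by (rule inverse_maps_dominant[OF P inv])
  have dG: "dominant (N, P) (Xn n) G" by (rule inverse_maps_dominant[OF zero_pp inverse_maps_sym[OF inv]])
  let ?K = "function_field (N, P)" and ?p = "field_pull n (N, P) F"
  obtain e where e: "\<forall>i\<le>N. F i \<in> forms n e" using rational_map_forms[OF dominantD(1)[OF dF]] by blast
  obtain e' where e': "\<forall>i\<le>n. G i \<in> forms N e'" using rational_map_forms[OF dominantD(1)[OF dG]] by blast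
  have sF: "subst F f \<in> forms n (d * e)" if "f \<in> forms N d" for f d using that e by (auto intro!: subst_forms)
  have sG: "subst G f \<in> forms N (d * e')" if "f \<in> forms n d" for f d using that e' by (auto intro!: subst_forms)
  have nzF: "subst F f \<noteq> 0" if "f \<in> forms N d" "f \<notin> P" for f d using dominantD(2)[OF dF that(1)] that(2) by auto
  note pe = field_pull_eq[OF P dF]
  have rmem: "to_fract f / to_fract g \<in> loc N P" if "f \<in> forms N d" "g \<in> forms N d" "g \<notin> P" for f g d
    using that by (rule locI)
  show ?thesis
  proof
    show "P \<in> proj_points N" by (rule P)
    show "?p \<one>\<^bsub>?K\<^esub> = 1" using pe[OF one_forms one_forms pp_one[OF P]] by (simp add: rf_one[OF P])
    show "?p (rat_fun (N, P) (to_fract (Const c))) = to_fract (Const c)" for c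
      using pe[OF Const_forms[of c] one_forms pp_one[OF P]] by simp
  next
    fix x y assume xy: "x \<in> carrier ?K" "y \<in> carrier ?K"
    obtain f g d where x: "x = rat_fun (N, P) (to_fract f / to_fract g)" "f \<in> forms N d" "g \<in> forms N d" "g \<notin> P"
      using xy(1) by (rule ffE[OF P])
    obtain f' g' d' where y: "y = rat_fun (N, P) (to_fract f' / to_fract g')" "f' \<in> forms N d'" "g' \<in> forms N d'" "g' \<notin> P"
      using xy(2) by (rule ffE[OF P])
    have g0: "g \<noteq> 0" "g' \<noteq> 0" using x y nz[OF P] by auto
    have gg: "g * g' \<in> forms N (d + d')" "g * g' \<notin> P" using forms_mult[OF x(3) y(3)] notin_mult[OF P x(4) y(4) x(3) y(3)] .
    have f1: "f * g' + f' * g \<in> forms N (d + d')"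
      using forms_mult[OF x(2) y(3)] forms_mult[OF y(2) x(3)] by (simp add: add.commute forms_add)
    have f2: "f * f' \<in> forms N (d + d')" using forms_mult[OF x(2) y(2)] .
    have s0: "subst F g \<noteq> 0" "subst F g' \<noteq> 0" using nzF x y by auto
    have "x \<oplus>\<^bsub>?K\<^esub> y = rat_fun (N, P) (to_fract (f * g' + f' * g) / to_fract (g * g'))"
      unfolding x(1) y(1) rf_add[OF P rmem[OF x(2-4)] rmem[OF y(2-4)]] using g0 by (simp add: field_simps)
    then have "?p (x \<oplus>\<^bsub>?K\<^esub> y) = to_fract (subst F (f * g' + f' * g)) / to_fract (subst F (g * g'))"
      by (simp only: pe[OF f1 gg])
    also have "\<dots> = ?p x + ?p y"
      unfolding x(1) y(1) pe[OF x(2-4)] pe[OF y(2-4)]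
      using s0 by (simp add: subst.mpeval_add subst.mpeval_mult field_simps)
    finally show "?p (x \<oplus>\<^bsub>?K\<^esub> y) = ?p x + ?p y" .
    have "x \<otimes>\<^bsub>?K\<^esub> y = rat_fun (N, P) (to_fract (f * f') / to_fract (g * g'))"
      unfolding x(1) y(1) rf_mult[OF P rmem[OF x(2-4)] rmem[OF y(2-4)]] by simp
    then have "?p (x \<otimes>\<^bsub>?K\<^esub> y) = to_fract (subst F (f * f')) / to_fract (subst F (g * g'))"
      by (simp only: pe[OF f2 gg])
    also have "\<dots> = ?p x * ?p y"
      unfolding x(1) y(1) pe[OF x(2-4)] pe[OF y(2-4)] by (simp add: subst.mpeval_mult)
    finally show "?p (x \<otimes>\<^bsub>?K\<^esub> y) = ?p x * ?p y" .
  next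
    have inj: "x = y" if xy: "x \<in> carrier ?K" "y \<in> carrier ?K" "?p x = ?p y" for x y
    proof -
      obtain f g d where x: "x = rat_fun (N, P) (to_fract f / to_fract g)" "f \<in> forms N d" "g \<in> forms N d" "g \<notin> P"
        using xy(1) by (rule ffE[OF P])
      obtain f' g' d' where y: "y = rat_fun (N, P) (to_fract f' / to_fract g')" "f' \<in> forms N d'" "g' \<in> forms N d'" "g' \<notin> P"
        using xy(2) by (rule ffE[OF P])
      have s0: "subst F g \<noteq> 0" "subst F g' \<noteq> 0" using nzF x y by auto
      have "to_fract (subst F f) / to_fract (subst F g) = to_fract (subst F f') / to_fract (subst F g')"
        using xy(3) unfolding x(1) y(1) pe[OF x(2-4)] pe[OF y(2-4)] .
      then have "to_fract (subst F f * subst F g') = to_fract (subst F f' * subst F g)"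
        using s0 by (simp add: frac_eq_eq)
      then have "subst F (f * g' - f' * g) \<in> {0}"
        unfolding to_fract_eq_iff by (simp add: subst.mpeval_diff subst.mpeval_mult)
      moreover have "f * g' - f' * g \<in> forms N (d + d')"
        using forms_mult[OF x(2) y(3)] forms_mult[OF y(2) x(3)] by (simp add: add.commute forms_diff)
      ultimately have "f * g' - f' * g \<in> P" using dominantD(2)[OF dF] by blast
      then show "x = y" unfolding x(1) y(1) using rat_fun_fract_eq_iff[OF P x(2-4) y(2-4)] by simp
    qed
    have sub: "?p x \<in> loc n {0}" if x: "x \<in> carrier ?K" for x
    proof -
      obtain f g d where f: "x = rat_fun (N, P) (to_fract f / to_fract g)" "f \<in> forms N d" "g \<in> forms N d" "g \<notin> P"
        using x by (rule ffE[OF P])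
      show "?p x \<in> loc n {0}" unfolding f(1) pe[OF f(2-4)] by (rule KI[OF sF[OF f(2)] sF[OF f(3)] nzF[OF f(3,4)]])
    qed
    have surj: "a \<in> ?p ` carrier ?K" if "a \<in> loc n {0}" for a
    proof -
      from that obtain f g d where a: "a = to_fract f / to_fract g" "f \<in> forms n d" "g \<in> forms n d" "g \<noteq> 0" by (rule KE)
      have gP: "subst G g \<notin> P" using dominantD(2)[OF dG a(3)] a(4) by auto
      have "same_map (Xn n) (Xn n) (comp_map G F) Var" using inv by (simp add: inverse_maps_def)
      from same_map_cross[OF zero_pp this a(2,3)]
      have "subst F (subst G f) * g = f * subst F (subst G g)" by (simp add: subst_comp_map mult.commute)
      then have "to_fract (subst F (subst G f) * g) = to_fract (f * subst F (subst G g))" by (rule arg_cong)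
      then have t: "to_fract (subst F (subst G f)) * to_fract g = to_fract f * to_fract (subst F (subst G g))"
        by (simp only: to_fract_mult)
      have "?p (rat_fun (N, P) (to_fract (subst G f) / to_fract (subst G g))) = a"
        unfolding pe[OF sG[OF a(2)] sG[OF a(3)] gP] a(1)
        using t a(4) nzF[OF sG[OF a(3)] gP] by (simp add: frac_eq_eq)
      moreover have "rat_fun (N, P) (to_fract (subst G f) / to_fract (subst G g)) \<in> carrier ?K"
        by (rule rf_closed[OF P rmem[OF sG[OF a(2)] sG[OF a(3)] gP]])
      ultimately show "a \<in> ?p ` carrier ?K" by blast
    qed
    show "bij_betw ?p (carrier ?K) (loc n {0})"
    proof (rule bij_betw_imageI)
      show "inj_on ?p (carrier ?K)" by (rule inj_onI) (rule inj)
      show "?p ` carrier ?K = loc n {0}" using sub surj by blast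
    qed
  qed
qed

section \<open>The local ring at a hypersurface\<close>

text \<open>
  A local ring whose maximal ideal is generated by a nonzero element \<open>t\<close>.
\<close>

locale uniformizer =
  fixes B m :: "'a::field set" and t :: 'a
  assumes B: "subring_set B" and t: "t \<in> B" "t \<noteq> 0" and m: "m = (\<lambda>a. a * t) ` B"
    and unit: "\<And>b. b \<in> B \<Longrightarrow> b \<notin> m \<Longrightarrow> inverse b \<in> B" and one: "1 \<notin> m"
begin

lemma m_ideal: "a \<in> m \<Longrightarrow> b \<in> B \<Longrightarrow> a * b \<in> m"
proof -
  assume "a \<in> m" and b: "b \<in> B"
  then obtain c where c: "c \<in> B" "a = c * t" by (auto simp: m)
  have "c * b * t \<in> m" using sr_mult[OF B c(1) b] by (auto simp: m)
  then show "a * b \<in> m" by (simp add: c(2) mult_ac)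
qed

lemma unit_nonzero: "u \<in> B - m \<Longrightarrow> u \<noteq> 0"
proof
  assume "u \<in> B - m" "u = 0"
  moreover have "0 * t \<in> m" unfolding m by (rule imageI) (rule sr_0[OF B])
  ultimately show False by simp
qed

lemma unit_mult: "u \<in> B - m \<Longrightarrow> v \<in> B - m \<Longrightarrow> u * v \<in> B - m"
proof -
  assume u: "u \<in> B - m" and v: "v \<in> B - m"
  have "u * v \<notin> m"
  proof
    assume "u * v \<in> m"
    from m_ideal[OF this unit[of v]] have "u * v * inverse v \<in> m" using v by simp
    then show False using u unit_nonzero[OF v] by (simp add: mult.assoc)
  qed
  then show "u * v \<in> B - m" using sr_mult[OF B] u v by simp
qed

lemma unit_inverse: "u \<in> B - m \<Longrightarrow> inverse u \<in> B - m"
proof -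
  assume u: "u \<in> B - m"
  have "inverse u \<notin> m"
  proof
    assume "inverse u \<in> m"
    from m_ideal[OF this, of u] have "inverse u * u \<in> m" using u by simp
    then show False using unit_nonzero[OF u] one by simp
  qed
  then show ?thesis using unit[of u] u by simp
qed

lemma unit_powi: "u \<in> B - m \<Longrightarrow> u powi (k::int) \<in> B - m"
proof -
  assume u: "u \<in> B - m"
  have p: "v ^ j \<in> B - m" if "v \<in> B - m" for v and j :: nat
    by (induction j) (use that unit_mult sr_1[OF B] one in auto)
  show ?thesis using p[OF u] p[OF unit_inverse[OF u]] by (simp add: power_int_def)
qed

lemma factor_or_deep:
  assumes b: "b \<in> B" and nd: "\<not> (\<forall>i::nat. \<exists>c\<in>B. b = c * t ^ i)"
  shows "\<exists>i u. u \<in> B - m \<and> b = u * t ^ i"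
proof (rule ccontr)
  assume c: "\<not> ?thesis"
  have "\<exists>c\<in>B. b = c * t ^ i" for i :: nat
  proof (induction i)
    case 0
    then show ?case using b by auto
  next
    case (Suc i)
    then obtain c where c': "c \<in> B" "b = c * t ^ i" by blast
    then have "c \<in> m" using c by blast
    then obtain c2 where "c2 \<in> B" "c = c2 * t" by (auto simp: m)
    then have "b = c2 * t ^ Suc i" using c' by simp
    then show ?case using \<open>c2 \<in> B\<close> by blast
  qed
  then show False using nd by blast
qed

lemma t_powi_unit: "t powi k \<in> B - m \<Longrightarrow> k = 0"
proof -
  have pos: "t powi k \<notin> B - m" if "k > 0" for k :: int
  proof -
    have "t powi k = t ^ (nat k - 1) * t"
      using that by (metis One_nat_def Suc_pred nat_0_less_mult_iff power_Suc2 power_int_def less_imp_le zero_less_nat_eq)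
    also have "\<dots> \<in> m" unfolding m by (rule imageI) (rule sr_power[OF B t(1)])
    finally show ?thesis by simp
  qed
  assume u: "t powi k \<in> B - m"
  have "inverse (t powi k) \<in> B - m" using u by (rule unit_inverse)
  then have "t powi (- k) \<in> B - m" by (simp add: power_int_minus)
  then show "k = 0" using pos[of k] pos[of "- k"] u by (cases k "0::int" rule: linorder_cases) auto
qed

lemma other_uniformizer:
  assumes t2: "t2 \<in> B" "m = (\<lambda>a. a * t2) ` B"
  shows "\<exists>a\<in>B - m. t2 = a * t"
proof -
  have "1 * t2 \<in> m" unfolding t2(2) by (rule imageI) (rule sr_1[OF B])
  then obtain a where a: "a \<in> B" "t2 = a * t" by (auto simp: m)
  have "1 * t \<in> m" unfolding m by (rule imageI) (rule sr_1[OF B])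
  then obtain a' where a': "a' \<in> B" "t = a' * t2" by (auto simp: t2(2))
  have "a * a' = 1" using a(2) a'(2) t(2) by (metis mult.assoc mult.commute mult_cancel_right1)
  then have "a \<notin> m" using m_ideal[of a a'] a'(1) one by auto
  then show ?thesis using a by blast
qed

end

text \<open>
  The condition \<open>inter\<close> says that the powers of the maximal ideal intersect in $0$. It makes
  dividing by \<open>t\<close> come to an end, so that every nonzero fraction has an order.
\<close>

locale dvr = uniformizer B m t for B m :: "'a::field set" and t +
  fixes L :: "'a set"
  assumes inter: "\<And>b. b \<in> B \<Longrightarrow> (\<forall>i::nat. \<exists>c\<in>B. b = c * t ^ i) \<Longrightarrow> b = 0"
    and frac: "\<And>x. x \<in> L \<Longrightarrow> \<exists>b\<in>B. \<exists>c\<in>B. c \<noteq> 0 \<and> x = b / c"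
begin

lemma factor: "x \<in> L \<Longrightarrow> x \<noteq> 0 \<Longrightarrow> \<exists>u k. u \<in> B - m \<and> x = u * t powi k"
proof -
  assume "x \<in> L" "x \<noteq> 0"
  then obtain b c where bc: "b \<in> B" "c \<in> B" "b \<noteq> 0" "c \<noteq> 0" "x = b / c" using frac[of x] by auto
  obtain i u where u: "u \<in> B - m" "b = u * t ^ i" using factor_or_deep[OF bc(1)] inter[OF bc(1)] bc(3) by blast
  obtain j v where v: "v \<in> B - m" "c = v * t ^ j" using factor_or_deep[OF bc(2)] inter[OF bc(2)] bc(4) by blast
  have "x = (u * inverse v) * t powi (int i - int j)"
    using t(2) unit_nonzero[OF v(1)] by (simp add: bc(5) u(2) v(2) power_int_diff field_simps)
  moreover have "u * inverse v \<in> B - m" using unit_mult[OF u(1) unit_inverse[OF v(1)]] .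
  ultimately show ?thesis by blast
qed

lemma square_even:
  assumes u: "u \<in> B - m" and s: "s \<in> L" "s \<noteq> 0" and eq: "u * t powi k = s\<^sup>2"
  shows "even k"
proof -
  obtain v j where v: "v \<in> B - m" "s = v * t powi j" using factor[OF s] by blast
  have "t powi (k - 2 * j) = inverse u * (v * v)"
  proof -
    have "t powi k = inverse u * s\<^sup>2" using eq unit_nonzero[OF u] by (simp add: field_simps)
    also have "s\<^sup>2 = v * v * t powi (2 * j)"
      using power_int_add[of t j j] t(2) by (simp add: v(2) power2_eq_square mult_ac flip: mult_2)
    finally show ?thesis using t(2) by (simp add: power_int_diff field_simps)
  qed
  also have "\<dots> \<in> B - m" by (intro unit_mult unit_inverse u v)
  finally have "k - 2 * j = 0" by (rule t_powi_unit)
  then show ?thesis by presburger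
qed

text \<open>
  An element outside \<open>B\<close> has negative order, so its inverse lies in the maximal ideal of \<open>B\<close>; in a local
  ring that dominates \<open>B\<close> both cannot be present. Hence discrete valuation rings are maximal for domination.
\<close>

lemma dominating_eq:
  assumes L: "O1 \<subseteq> L" and BO: "B \<subseteq> O1" and mm: "m \<subseteq> M"
    and M: "\<And>a b. a \<in> M \<Longrightarrow> b \<in> O1 \<Longrightarrow> a * b \<in> M" and oneM: "1 \<notin> M" and MO: "M \<subseteq> O1"
  shows "O1 = B" "M = m"
proof -
  have "x \<in> B" if x: "x \<in> O1" for x
  proof (cases "x = 0")
    case True
    then show ?thesis using sr_0[OF B] by simp
  next
    case False
    then obtain u k where u: "u \<in> B - m" "x = u * t powi k" using factor[of x] L x by blast
    show ?thesis
    proof (cases "k \<ge> 0")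
      case True
      then have "t powi k = t ^ nat k" by (simp add: power_int_def)
      then show ?thesis using u sr_mult[OF B] sr_power[OF B t(1)] by simp
    next
      case k: False
      have "inverse x = inverse u * t ^ (nat (- k) - 1) * t"
      proof -
        have "inverse (t powi k) = t powi (- k)" by (simp add: power_int_minus)
        also have "\<dots> = t ^ nat (- k)" using k by (simp add: power_int_def)
        also have "\<dots> = t ^ (nat (- k) - 1) * t" using k by (simp flip: power_Suc2)
        finally show ?thesis by (simp add: u(2) mult_ac)
      qed
      also have "\<dots> \<in> m" unfolding m
        using unit_inverse[OF u(1)] by (intro imageI sr_mult[OF B] sr_power[OF B] t) auto
      finally have "inverse x * x \<in> M" using mm M x by blast
      then show ?thesis using False oneM by simp
    qed
  qed
  then show O: "O1 = B" using BO by blast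
  have "x \<in> m" if x: "x \<in> M" for x
  proof (rule ccontr)
    assume "x \<notin> m"
    then have u: "x \<in> B - m" using x MO O by blast
    have "x * inverse x \<in> M" using M[OF x, of "inverse x"] unit_inverse[OF u] O by blast
    then show False using unit_nonzero[OF u] oneM by simp
  qed
  then show "M = m" using mm by blast
qed

end

context ff_model
begin

text \<open>
  The restriction of a rational function on $P^N$ to the variety, viewed inside the function field of $P^n$.
\<close>

definition chi :: "'k mpol fract \<Rightarrow> 'k mpol fract" where "chi a = \<phi> (rat_fun V a)"

lemma chi_hom: "a \<in> loc N P \<Longrightarrow> b \<in> loc N P \<Longrightarrow> chi (a + b) = chi a + chi b"
  "a \<in> loc N P \<Longrightarrow> b \<in> loc N P \<Longrightarrow> chi (a * b) = chi a * chi b"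
  using m_add[OF rf_closed[OF P] rf_closed[OF P]] m_mult[OF rf_closed[OF P] rf_closed[OF P]]
  by (simp_all add: chi_def rf_add[OF P] rf_mult[OF P])

lemma chi_1: "chi 1 = 1"
  using m_one by (simp add: chi_def rf_one[OF P])

lemma chi_eq_iff: "a \<in> loc N P \<Longrightarrow> b \<in> loc N P \<Longrightarrow> chi a = chi b \<longleftrightarrow> a - b \<in> locm N P"
  unfolding chi_def by (simp add: phi_inj rf_closed[OF P] rat_fun_eq_iff[OF P])

lemma chi_0: "chi 0 = 0"
  using m_zero by (simp add: chi_def rf_zero[OF P])

lemma phi_stalk: "\<phi> ` stalk V E = chi ` loc N E" "\<phi> ` stalk_max V E = chi ` locm N E"
  by (simp_all add: stalk_def stalk_max_def chi_def image_image ps_local_max_eq)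

lemma K_chi: "x \<in> loc n {0} \<Longrightarrow> \<exists>a\<in>loc N P. x = chi a"
  using psi_closed[of x] phi_psi[of x] unfolding ff_carrier[OF P] chi_def by (metis imageE)

context
  fixes E :: "'k mpol set"
  assumes E: "E \<in> points V"
begin

lemma Epp: "E \<in> proj_points N" and PE: "P \<subseteq> E"
  using E by (auto simp: points_def)

lemma locEP: "a \<in> loc N E \<Longrightarrow> a \<in> loc N P"
  using loc_mono[OF Epp PE] by blast

lemma chi_locm: assumes a: "a \<in> loc N E" and c: "chi a \<in> chi ` locm N E" shows "a \<in> locm N E"
proof -
  obtain a' where a': "a' \<in> locm N E" "chi a = chi a'" using c by blast
  have a'E: "a' \<in> loc N E" using a' locm_subset[OF Epp] by blast
  have d: "a - a' \<in> loc N E" by (rule sr_diff[OF loc_subring[OF Epp] a a'E])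
  have dP: "a - a' \<in> locm N P" using chi_eq_iff[OF locEP[OF a] locEP[OF a'E]] a'(2) by simp
  obtain f g d where fg: "a - a' = to_fract f / to_fract g" "f \<in> forms N d" "g \<in> forms N d" "g \<notin> E" using d by (rule locE)
  have "g \<notin> P" using fg(4) PE by blast
  then have "f \<in> P" using dP fg(1) fract_in_locm_iff[OF P fg(2,3)] by simp
  then have "a - a' \<in> locm N E" using fg(1) fract_in_locm_iff[OF Epp fg(2-4)] PE by auto
  from locm_add[OF Epp this a'(1)] show ?thesis by simp
qed

lemma chi_subring: "subring_set (chi ` loc N E)"
proof -
  note sr = loc_subring[OF Epp]
  have u: "chi (- a) = - chi a" if "a \<in> loc N E" for a
    using chi_hom(1)[OF locEP[OF that] locEP[OF sr_uminus[OF sr that]]] chi_0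
    by (simp add: eq_neg_iff_add_eq_0 add.commute)
  have "0 \<in> chi ` loc N E" "1 \<in> chi ` loc N E"
    using sr_0[OF sr] sr_1[OF sr] chi_0 chi_1 by (metis image_eqI)+
  moreover have "- x \<in> chi ` loc N E" if x: "x \<in> chi ` loc N E" for x
    using x u sr_uminus[OF sr] by force
  moreover have "x + y \<in> chi ` loc N E" "x * y \<in> chi ` loc N E" if xy: "x \<in> chi ` loc N E" "y \<in> chi ` loc N E" for x y
  proof -
    obtain a b where ab: "a \<in> loc N E" "b \<in> loc N E" "x = chi a" "y = chi b" using xy by blast
    show "x + y \<in> chi ` loc N E" "x * y \<in> chi ` loc N E"
      unfolding ab chi_hom[OF locEP[OF ab(1)] locEP[OF ab(2)], symmetric]
      by (intro imageI sr_add[OF sr] sr_mult[OF sr] ab)+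
  qed
  ultimately show ?thesis by (simp add: subring_set_def)
qed

lemma chi_unit:
  assumes b: "b \<in> chi ` loc N E" "b \<notin> chi ` locm N E" shows "inverse b \<in> chi ` loc N E"
proof -
  obtain a where a: "a \<in> loc N E" "b = chi a" using b by blast
  have "a \<notin> locm N E" using a b by blast
  note u = loc_unit_inverse[OF Epp a(1) this]
  have "b * chi (inverse a) = 1"
    using chi_hom(2)[OF locEP[OF a(1)] locEP[OF u(1)]] u(3) by (simp add: a(2) chi_1)
  then have "inverse b = chi (inverse a)" by (rule inverse_unique)
  then show ?thesis using u(1) by blast
qed

lemma chi_one_notin: "1 \<notin> chi ` locm N E"
  using chi_locm[OF sr_1[OF loc_subring[OF Epp]]] one_notin_locm[OF Epp] chi_1 by auto

lemma chi_frac: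
  assumes x: "x \<in> loc n {0}" shows "\<exists>b\<in>chi ` loc N E. \<exists>c\<in>chi ` loc N E. c \<noteq> 0 \<and> x = b / c"
proof -
  obtain a where a: "a \<in> loc N P" "x = chi a" using K_chi[OF x] by blast
  obtain f g d where fg: "a = to_fract f / to_fract g" "f \<in> forms N d" "g \<in> forms N d" "g \<notin> P" using a(1) by (rule locE)
  obtain i where i: "i \<le> N" "Var i \<notin> E" using pp_Var[OF Epp] by blast
  define y where "y = (Var i :: 'k mpol) ^ d"
  have y: "y \<in> forms N d" "y \<notin> E" unfolding y_def using forms_power[OF Var_forms(1)[OF i(1)], of d] notin_power[OF Epp i(2) Var_forms(1)[OF i(1)], of d] by simp_all
  have yP: "y \<notin> P" using y(2) PE by blast
  have l: "to_fract f / to_fract y \<in> loc N E" "to_fract g / to_fract y \<in> loc N E"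
    by (rule locI[OF fg(2) y], rule locI[OF fg(3) y])
  have nz': "y \<noteq> 0" "g \<noteq> 0" using nz[OF P] yP fg(4) by auto
  have ea: "a * (to_fract g / to_fract y) = to_fract f / to_fract y" using nz' by (simp add: fg(1))
  have e: "x * chi (to_fract g / to_fract y) = chi (to_fract f / to_fract y)"
    unfolding a(2) chi_hom(2)[OF a(1) locEP[OF l(2)], symmetric] ea ..
  have "to_fract g / to_fract y \<notin> locm N P" using fract_in_locm_iff[OF P fg(3) y(1) yP] fg(4) by simp
  then have "chi (to_fract g / to_fract y) \<noteq> 0"
    using chi_eq_iff[OF locEP[OF l(2)] sr_0[OF loc_subring[OF P]]] chi_0 by simp
  then show ?thesis using e l by (intro bexI[of _ "chi (to_fract f / to_fract y)"] bexI[of _ "chi (to_fract g / to_fract y)"]) (auto simp: field_simps)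
qed

lemma chi_uniformizer:
  assumes t: "t \<in> chi ` loc N E" "t \<noteq> 0" and m: "chi ` locm N E = (\<lambda>a. a * t) ` (chi ` loc N E)"
  shows "uniformizer (chi ` loc N E) (chi ` locm N E) t"
  by unfold_locales (rule chi_subring t m chi_unit chi_one_notin; assumption?)+

end

text \<open>
  The intersection \<open>J\<close> of the powers of the maximal ideal is a prime ideal of the local ring at \<open>E\<close>. The forms
  whose restriction lies in \<open>J\<close> generate a homogeneous prime between \<open>P\<close> and \<open>E\<close>, which is one of the two as \<open>E\<close> has
  codimension one. It is not \<open>E\<close> since \<open>t\<close> is not in \<open>J\<close>; so it is \<open>P\<close>, and \<open>J\<close> vanishes.
\<close>

lemma hypersurface_dvr:
  assumes EH: "E \<in> hypersurfaces V" and t: "t \<in> chi ` loc N E" "t \<noteq> 0"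
    and m: "chi ` locm N E = (\<lambda>a. a * t) ` (chi ` loc N E)"
  shows "dvr (chi ` loc N E) (chi ` locm N E) t (loc n {0})"
proof -
  have E: "E \<in> points V" and EP: "E \<noteq> P" and min: "\<And>Q. Q \<in> points V \<Longrightarrow> Q \<subseteq> E \<Longrightarrow> Q = P \<or> Q = E"
    using EH by (auto simp: hypersurfaces_def)
  let ?B = "chi ` loc N E" and ?m = "chi ` locm N E"
  interpret U: uniformizer ?B ?m t by (rule chi_uniformizer[OF E t m])
  note Epp = Epp[OF E] and PE = PE[OF E] and lEP = locEP[OF E]
  note srB = chi_subring[OF E]
  define J where "J = {b \<in> ?B. \<forall>i::nat. \<exists>c\<in>?B. b = c * t ^ i}"
  have J_B: "b \<in> ?B" if "b \<in> J" for b using that by (simp add: J_def)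
  have JI: "b \<in> J" if "b \<in> ?B" "\<And>i. \<exists>c\<in>?B. b = c * t ^ i" for b using that by (simp add: J_def)
  have JE: "\<exists>c\<in>?B. b = c * t ^ i" if "b \<in> J" for b i using that by (simp add: J_def)
  have J_0: "0 \<in> J" using sr_0[OF srB] by (intro JI) auto
  have J_add: "x + y \<in> J" if xy: "x \<in> J" "y \<in> J" for x y
  proof (rule JI)
    show "x + y \<in> ?B" using sr_add[OF srB J_B[OF xy(1)] J_B[OF xy(2)]] .
    fix i
    obtain c d where "c \<in> ?B" "x = c * t ^ i" "d \<in> ?B" "y = d * t ^ i" using JE[OF xy(1)] JE[OF xy(2)] by blast
    then show "\<exists>c\<in>?B. x + y = c * t ^ i" using sr_add[OF srB, of c d] by (intro bexI[of _ "c + d"]) (auto simp: distrib_right)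
  qed
  have J_mult: "x * y \<in> J" if xy: "x \<in> J" "y \<in> ?B" for x y
  proof (rule JI)
    show "x * y \<in> ?B" using sr_mult[OF srB J_B[OF xy(1)] xy(2)] .
    fix i
    obtain c where "c \<in> ?B" "x = c * t ^ i" using JE[OF xy(1)] by blast
    then show "\<exists>c\<in>?B. x * y = c * t ^ i" using sr_mult[OF srB, of c y] xy(2) by (intro bexI[of _ "c * y"]) (auto simp: mult_ac)
  qed
  have J_prime: "y \<in> J" if xy: "x \<in> ?B" "y \<in> ?B" "x * y \<in> J" "x \<notin> J" for x y
  proof (rule JI[OF xy(2)])
    fix k
    have "\<not> (\<forall>i. \<exists>c\<in>?B. x = c * t ^ i)" using xy(1,4) by (simp add: J_def)
    then obtain i u where u: "u \<in> ?B - ?m" "x = u * t ^ i" using U.factor_or_deep[OF xy(1)] by blast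
    obtain c where c: "c \<in> ?B" "x * y = c * t ^ (k + i)" using JE[OF xy(3)] by blast
    have "u * y * t ^ i = c * t ^ k * t ^ i" using c(2) u(2) by (simp add: power_add mult_ac)
    then have "u * y = c * t ^ k" using t(2) by simp
    then have "y = inverse u * c * t ^ k" using U.unit_nonzero[OF u(1)] by (simp add: field_simps)
    moreover have "inverse u * c \<in> ?B" using sr_mult[OF srB _ c(1)] U.unit_inverse[OF u(1)] by blast
    ultimately show "\<exists>c\<in>?B. y = c * t ^ k" by blast
  qed
  have J_m: "b \<in> ?m" if "b \<in> J" for b
    using JE[OF that, of 1] m by auto
  have t_J: "t \<notin> J"
  proof
    assume "t \<in> J"
    then obtain c where c: "c \<in> ?B" "t = c * t ^ 2" using JE[of t 2] by blast
    then have "1 = c * t" using t(2) by (simp add: power2_eq_square)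
    moreover have "c * t \<in> ?m" using c(1) m by auto
    ultimately show False using U.one by simp
  qed
  obtain i0 where i0: "i0 \<le> N" "Var i0 \<notin> E" using pp_Var[OF Epp] by blast
  define y where "y d = (Var i0 :: 'k mpol) ^ d" for d
  have y: "y d \<in> forms N d" "y d \<notin> E" for d
    unfolding y_def using forms_power[OF Var_forms(1)[OF i0(1)], of d] notin_power[OF Epp i0(2) Var_forms(1)[OF i0(1)], of d] by simp_all
  have yP: "y d \<notin> P" and y0: "y d \<noteq> 0" for d using y(2)[of d] PE pp_zero[OF Epp] by auto
  \<comment> \<open>Dividing by a power of a variable outside \<open>E\<close> turns forms into elements of the local ring.\<close>
  define \<theta> where "\<theta> d f = chi (to_fract f / to_fract (y d))" for d f
  have l: "to_fract f / to_fract (y d) \<in> loc N E" if "f \<in> forms N d" for f d by (rule locI[OF that y])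
  have \<theta>_B: "\<theta> d f \<in> ?B" if "f \<in> forms N d" for f d unfolding \<theta>_def by (rule imageI[OF l[OF that]])
  have \<theta>_add: "\<theta> d (f + g) = \<theta> d f + \<theta> d g" if fg: "f \<in> forms N d" "g \<in> forms N d" for f g d
    unfolding \<theta>_def chi_hom(1)[OF lEP[OF l[OF fg(1)]] lEP[OF l[OF fg(2)]], symmetric] by (simp add: add_divide_distrib)
  have \<theta>_mult: "\<theta> (d + e) (f * g) = \<theta> d f * \<theta> e g" if fg: "f \<in> forms N d" "g \<in> forms N e" for f g d e
    unfolding \<theta>_def chi_hom(2)[OF lEP[OF l[OF fg(1)]] lEP[OF l[OF fg(2)]], symmetric] by (simp add: y_def power_add)
  have \<theta>_P: "\<theta> d f = 0 \<longleftrightarrow> f \<in> P" if f: "f \<in> forms N d" for f d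
    using chi_eq_iff[OF lEP[OF l[OF f]] sr_0[OF loc_subring[OF P]]] fract_in_locm_iff[OF P f y(1) yP]
    by (simp add: \<theta>_def chi_0)
  have \<theta>_E: "f \<in> E" if f: "f \<in> forms N d" "\<theta> d f \<in> ?m" for f d
    using chi_locm[OF E l[OF f(1)]] f(2) fract_in_locm_iff[OF Epp f(1) y] by (simp add: \<theta>_def)
  have \<theta>_unit: "\<theta> d g \<in> ?B - ?m" if g: "g \<in> forms N d" "g \<notin> E" for g d
    using \<theta>_B[OF g(1)] \<theta>_E[OF g(1)] g(2) by blast
  have \<theta>_frac: "\<exists>f g d. f \<in> forms N d \<and> g \<in> forms N d \<and> g \<notin> E \<and> b * \<theta> d g = \<theta> d f \<and> (b \<in> ?m \<longrightarrow> f \<in> E)"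
    if b: "b \<in> ?B" for b
  proof -
    obtain a where a: "a \<in> loc N E" "b = chi a" using b by blast
    obtain f g d where fg: "a = to_fract f / to_fract g" "f \<in> forms N d" "g \<in> forms N d" "g \<notin> E" using a(1) by (rule locE)
    have g0: "g \<noteq> 0" using fg(4) pp_zero[OF Epp] by auto
    have ea: "a * (to_fract g / to_fract (y d)) = to_fract f / to_fract (y d)" using g0 by (simp add: fg(1))
    have e: "b * \<theta> d g = \<theta> d f"
      unfolding a(2) \<theta>_def chi_hom(2)[OF lEP[OF a(1)] lEP[OF l[OF fg(3)]], symmetric] ea ..
    have "f \<in> E" if "b \<in> ?m"
      using chi_locm[OF E a(1)] that a(2) fract_in_locm_iff[OF Epp fg(2-4)] fg(1) by simp
    then show ?thesis using fg e by blast
  qed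
  define I where "I = {f. \<exists>d. f \<in> forms N d \<and> \<theta> d f \<in> J}"
  have I_iff: "f \<in> I \<longleftrightarrow> \<theta> d f \<in> J" if f: "f \<in> forms N d" for f d
  proof (cases "f = 0")
    case True
    then have "\<theta> d f = 0" using \<theta>_P[OF f] pp_zero[OF P] by simp
    moreover from this have "f \<in> I" unfolding I_def using f J_0 by (intro CollectI exI[of _ d]) simp
    ultimately show ?thesis using J_0 by simp
  next
    case False
    show ?thesis
    proof
      assume "f \<in> I"
      then obtain d' where d': "f \<in> forms N d'" "\<theta> d' f \<in> J" by (auto simp: I_def)
      then show "\<theta> d f \<in> J" using forms_degree_unique[OF f d'(1) False] by simp
    qed (use f in \<open>auto simp: I_def\<close>)
  qed
  have c1: "\<exists>d. f \<in> forms N d" if "f \<in> I" for f using that by (auto simp: I_def)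
  have c2: "0 \<in> I" using I_iff[of 0 0] \<theta>_P[of 0 0] pp_zero[OF P] J_0 by simp
  have c3: "f + g \<in> I" if "f \<in> I" "g \<in> I" "f \<in> forms N d" "g \<in> forms N d" for f g d
    using that J_add I_iff[OF forms_add[OF that(3,4)]] I_iff[OF that(3)] I_iff[OF that(4)] \<theta>_add[OF that(3,4)] by simp
  have c4: "f * g \<in> I" if "f \<in> I" "f \<in> forms N d" "g \<in> forms N e" for f g d e
    using that J_mult[OF _ \<theta>_B[OF that(3)]] I_iff[OF forms_mult[OF that(2,3)]] I_iff[OF that(2)] \<theta>_mult[OF that(2,3)] by simp
  have c5: "f \<in> I \<or> g \<in> I" if "f * g \<in> I" "f \<in> forms N d" "g \<in> forms N e" for f g d e
    using that J_prime[OF \<theta>_B[OF that(2)] \<theta>_B[OF that(3)]] I_iff[OF forms_mult[OF that(2,3)]] I_iff[OF that(2)] I_iff[OF that(3)]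
      \<theta>_mult[OF that(2,3)] by auto
  have c6: "Var i0 \<notin> I"
  proof
    assume "Var i0 \<in> I"
    then have "\<theta> 1 (Var i0) \<in> ?m" using I_iff[OF Var_forms(1)[OF i0(1)]] J_m by blast
    then show False using \<theta>_E[OF Var_forms(1)[OF i0(1)]] i0(2) by blast
  qed
  let ?Q = "{f \<in> polys N. \<forall>d. hcomp d f \<in> I}"
  have Q: "?Q \<in> proj_points N" by (rule homogeneous_prime(1)[OF c1 c2 c3 c4 c5 i0(1) c6])
  have Qf: "f \<in> ?Q \<longleftrightarrow> f \<in> I" if "f \<in> forms N d" for f d
    by (rule homogeneous_prime(2)[OF c1 c2 c3 c4 c5 i0(1) c6 that])
  have "P \<subseteq> ?Q"
  proof (rule pp_subset[OF P Q])
    fix f d assume f: "f \<in> forms N d" "f \<in> P"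
    then have "\<theta> d f = 0" using \<theta>_P[OF f(1)] by simp
    then have "f \<in> I" using I_iff[OF f(1)] J_0 by simp
    then show "f \<in> ?Q" using Qf[OF f(1)] by blast
  qed
  then have "?Q \<in> points V" using Q by (simp add: points_def)
  moreover have "?Q \<subseteq> E"
    by (rule pp_subset[OF Q Epp]) (use Qf I_iff J_m \<theta>_E in blast)
  ultimately consider "?Q = P" | "?Q = E" using min by blast
  then have J0: "b = 0" if b: "b \<in> J" for b
  proof cases
    case 1
    obtain f g d where fg: "f \<in> forms N d" "g \<in> forms N d" "g \<notin> E" "b * \<theta> d g = \<theta> d f" using \<theta>_frac[OF J_B[OF b]] by blast
    have "\<theta> d f \<in> J" using J_mult[OF b \<theta>_B[OF fg(2)]] fg(4) by simp
    then have "f \<in> P" using I_iff[OF fg(1)] Qf[OF fg(1)] 1 by simp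
    then have "b * \<theta> d g = 0" using \<theta>_P[OF fg(1)] fg(4) by simp
    then show ?thesis using U.unit_nonzero[OF \<theta>_unit[OF fg(2,3)]] by simp
  next
    case 2
    have "1 * t \<in> ?m" unfolding m by (rule imageI) (rule sr_1[OF srB])
    then obtain f g d where fg: "f \<in> forms N d" "g \<in> forms N d" "g \<notin> E" "t * \<theta> d g = \<theta> d f" "f \<in> E"
      using \<theta>_frac[OF t(1)] by auto
    have "\<theta> d f \<in> J" using I_iff[OF fg(1)] Qf[OF fg(1)] 2 fg(5) by simp
    then have "\<theta> d g * t \<in> J" using fg(4) by (simp add: mult.commute)
    moreover have "\<theta> d g \<notin> J" using \<theta>_unit[OF fg(2,3)] J_m by blast
    ultimately have "t \<in> J" using J_prime[OF \<theta>_B[OF fg(2)] t(1)] by blast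
    then show ?thesis using t_J by blast
  qed
  show ?thesis
  proof (intro dvr.intro dvr_axioms.intro U.uniformizer_axioms)
    show "b = 0" if "b \<in> ?B" "\<forall>i::nat. \<exists>c\<in>?B. b = c * t ^ i" for b using J0[OF JI] that by blast
    show "\<exists>b\<in>?B. \<exists>c\<in>?B. c \<noteq> 0 \<and> x = b / c" if "x \<in> loc n {0}" for x using chi_frac[OF E that] .
  qed
qed

end

section \<open>Parity of discrepancies\<close>

theorem proposition3p5:
  fixes n :: nat
    and g :: "(nat \<Rightarrow> 'k::field mpol) set"
    and H :: "'k mpol set"
    and m :: int
  assumes "n \<ge> 3" and "odd n"
    and "g \<in> Gn n"
    and "H \<in> hypersurfaces (proj_space n)"
    and "has_discrepancy n (proj_space n) (proj_space n) g H m"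
  shows "even m"
proof -
  note odd = assms(2)
  have Y: "proj_space n = (Xn n :: 'k proj_var)" by (simp add: proj_space_def)
  have H: "H \<in> proj_points n" using assms(4) by (simp add: Y hypersurfaces_def points_def)
  from assms(5) obtain \<psi> Z \<pi> \<rho> E F where \<psi>: "\<psi> \<in> g"
    and Z: "smooth_projective n Z" and "inverse_maps Z (Xn n) \<pi> \<rho>" and E: "E \<in> hypersurfaces Z"
    and "same_map (Xn n) Z F (comp_map \<rho> \<psi>)" and "birational_map (fst (Xn n :: 'k proj_var), H) (fst Z, E) F"
    and "relative_canonical_coeff n Z (Xn n) \<pi> E m"
    unfolding has_discrepancy_def Y by (elim bexE exE conjE) (rule that)
  moreover obtain N P where NP: "Z = (N, P)" by (cases Z)
  ultimately have inv\<pi>: "inverse_maps (N, P) (Xn n) \<pi> \<rho>" and sF: "same_map (Xn n) (N, P) F (comp_map \<rho> \<psi>)"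
    and bF: "birational_map (n, H) (N, E) F" and rcc: "relative_canonical_coeff n (N, P) (Xn n) \<pi> E m"
    and Eh: "E \<in> hypersurfaces (N, P)" and P: "P \<in> proj_points N"
    by (simp_all add: smooth_projective_def projective_variety_def)
  have Ep: "E \<in> points (N, P)" using Eh by (simp add: hypersurfaces_def)
  then have Epp: "E \<in> proj_points N" by (simp add: points_def)
  have square_jac\<psi>: "square_jac n \<psi>" and "\<exists>\<theta>. inverse_maps (Xn n) (Xn n) \<psi> \<theta>" using Gn_rep_square_jac[OF odd assms(3) \<psi>] by auto
  then obtain \<theta> where inv\<psi>: "inverse_maps (Xn n) (Xn n) \<psi> \<theta>" by blast
  note d\<psi> = inverse_maps_dom[OF inv\<psi>]
  have invF: "inverse_maps (Xn n) (N, P) F (comp_map \<theta> \<pi>)"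
    by (rule inverse_maps_same[OF zero_pp P inverse_maps_comp[OF zero_pp zero_pp P inv\<psi> inverse_maps_sym[OF inv\<pi>]] same_map_sym[OF zero_pp sF]])
  have dF: "dominant (Xn n) (N, P) F" by (rule inverse_maps_dominant[OF P invF])
  have d\<pi>: "dominant (N, P) (Xn n) \<pi>" by (rule inverse_maps_dominant[OF zero_pp inv\<pi>])
  have dFE: "dominant (n, H) (N, E) F" using bF inverse_maps_dominant[OF Epp] unfolding birational_map_def by blast
  have r\<pi>: "same_map (N, P) (Xn n) \<pi> \<pi>" by (rule same_map_refl[OF P dominantD(1)[OF d\<pi>]])
  have sF\<pi>: "same_map (Xn n) (Xn n) (comp_map \<pi>' F) \<psi>" if "same_map (N, P) (Xn n) \<pi> \<pi>'" for \<pi>'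
  proof -
    have 1: "same_map (Xn n) (Xn n) (comp_map \<pi>' F) (comp_map \<pi> (comp_map \<rho> \<psi>))"
      by (rule same_map_comp[OF zero_pp dF sF same_map_sym[OF P that]])
    have "same_map (Xn n) (Xn n) (comp_map \<pi> \<rho>) Var" using inv\<pi> by (simp add: inverse_maps_def)
    from same_map_comp[OF zero_pp d\<psi> same_map_refl[OF zero_pp dominantD(1)[OF d\<psi>]] this]
    have 2: "same_map (Xn n) (Xn n) (comp_map \<pi> (comp_map \<rho> \<psi>)) \<psi>" by (simp add: comp_map_assoc)
    show ?thesis by (rule same_map_trans[OF zero_pp 1 2])
  qed
  have pull\<psi>: "pull n \<psi> (to_fract f / to_fract h) = to_fract (subst F (subst \<pi>' f)) / to_fract (subst F (subst \<pi>' h))"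
    if "same_map (N, P) (Xn n) \<pi> \<pi>'" "f \<in> forms n d" "h \<in> forms n d" "h \<noteq> 0" for \<pi>' f h d
  proof -
    note s = sF\<pi>[OF that(1)]
    have dd: "dominant (Xn n) (Xn n) (comp_map \<pi>' F)" by (rule dominant_same[OF zero_pp d\<psi> same_map_sym[OF zero_pp s]])
    show ?thesis
      using pull_same[OF dd s KI[OF that(2-4)]] pull_eq[OF dd that(2-4)] by (simp add: subst_comp_map)
  qed
  let ?\<phi> = "field_pull n (N, P) F"
  let ?\<chi> = "field_pull n (Xn n) Var :: 'k mpol fract set \<Rightarrow> 'k mpol fract"
  interpret MZ: ff_model N P n ?\<phi> by (rule field_pull_model[OF P invF])
  interpret MY: ff_model n "{0}" n ?\<chi> by (rule field_pull_model[OF zero_pp inverse_maps_Var[OF zero_pp]])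
  let ?KY = "function_field (Xn n :: 'k proj_var)"
  let ?KZ = "function_field (N, P)"
  have \<phi>0: "?\<chi> {a} = a" if "a \<in> loc n {0}" for a using pull_Var[OF that] by (simp add: pull_def)
  have KY: "?\<chi> x \<in> loc n {0}" "x = {?\<chi> x}" if x: "x \<in> carrier ?KY" for x
  proof -
    obtain a where "a \<in> loc n {0}" "x = {a}" using x by (auto simp: ff_carrier[OF zero_pp] rat_fun_space)
    then show "?\<chi> x \<in> loc n {0}" "x = {?\<chi> x}" using \<phi>0 by simp_all
  qed
  have pull_Z: "pullback (N, P) (Xn n) \<pi> x \<in> carrier ?KZ" "?\<phi> (pullback (N, P) (Xn n) \<pi> x) = pull n \<psi> (?\<chi> x)"
    if x: "x \<in> carrier ?KY" for x
  proof -
    obtain f h d where f: "?\<chi> x = to_fract f / to_fract h" "f \<in> forms n d" "h \<in> forms n d" "h \<noteq> 0" using KY(1)[OF x] by (rule KE)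
    have h0: "h \<notin> {0}" using f(4) by simp
    have xr: "x = rat_fun (Xn n) (to_fract f / to_fract h)" using KY(2)[OF x] f(1) by (simp add: rat_fun_space)
    obtain e where e: "\<forall>i\<le>n. \<pi> i \<in> forms N e" using rational_map_forms[OF dominantD(1)[OF d\<pi>]] by blast
    have s: "subst \<pi> f \<in> forms N (d * e)" "subst \<pi> h \<in> forms N (d * e)" using f e by (auto intro!: subst_forms)
    have hP: "subst \<pi> h \<notin> P" using dominantD(2)[OF d\<pi> f(3)] f(4) by auto
    have e1: "pullback (N, P) (Xn n) \<pi> x = rat_fun (N, P) (to_fract (subst \<pi> f) / to_fract (subst \<pi> h))"
      unfolding xr by (rule pullback_eq[OF P zero_pp d\<pi> f(2,3) h0])
    show "pullback (N, P) (Xn n) \<pi> x \<in> carrier ?KZ" unfolding e1 by (rule rf_closed[OF P locI[OF s hP]])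
    show "?\<phi> (pullback (N, P) (Xn n) \<pi> x) = pull n \<psi> (?\<chi> x)"
      unfolding e1 field_pull_eq[OF P dF s hP] f(1) by (rule pull\<psi>[OF r\<pi> f(2-4), symmetric])
  qed
  from rcc obtain g0 a0 hZ hY Q k l where
    g0: "g0 \<in> carrier ?KY" and a0: "\<forall>i<n. a0 i \<in> carrier ?KY" and dn: "dform n (Xn n) g0 a0 \<noteq> dform_zero n (Xn n)"
    and leZ: "local_equation n (N, P) E (dform n (N, P) (pullback (N, P) (Xn n) \<pi> g0) (\<lambda>i. pullback (N, P) (Xn n) \<pi> (a0 i))) hZ"
    and hoZ: "has_order (N, P) E hZ k" and im: "image_point (N, P) (Xn n) \<pi> E Q"
    and leY: "local_equation n (Xn n) Q (dform n (Xn n) g0 a0) hY"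
    and hoY: "has_order (N, P) E (pullback (N, P) (Xn n) \<pi> hY) l" and mkl: "m = k - l"
    unfolding relative_canonical_coeff_def by (elim exE conjE) (rule that)
  have a0': "a0 j \<in> carrier ?KY" if "j < n" for j using a0 that by blast
  have hY: "hY \<in> carrier ?KY" and hZ: "hZ \<in> carrier ?KZ" using leY leZ by (simp_all add: local_equation_def)
  obtain D0 where D0: "Dtuple n D0" "wronsk n D0 (aff 0) \<noteq> (0 :: 'k mpol fract)"
    using MY.dform_nonzero[OF dn g0 a0'] by blast
  \<comment> \<open>The two orders come with uniformizers \<open>t\<close> and \<open>t2\<close> of their own; they differ by a unit.\<close>
  from MZ.has_order_phi[OF hoZ Ep] obtain t u where
    t: "t \<in> ?\<phi> ` stalk (N, P) E" "t \<noteq> 0" "?\<phi> ` stalk_max (N, P) E = (\<lambda>a. a * t) ` (?\<phi> ` stalk (N, P) E)"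
    and u: "u \<in> ?\<phi> ` (stalk (N, P) E - stalk_max (N, P) E)" "?\<phi> hZ = u * t powi k" by blast
  from MZ.has_order_phi[OF hoY Ep] obtain t2 u2 where
    t2: "t2 \<in> ?\<phi> ` stalk (N, P) E" "?\<phi> ` stalk_max (N, P) E = (\<lambda>a. a * t2) ` (?\<phi> ` stalk (N, P) E)"
    and u2: "u2 \<in> ?\<phi> ` (stalk (N, P) E - stalk_max (N, P) E)" "?\<phi> (pullback (N, P) (Xn n) \<pi> hY) = u2 * t2 powi l" by blast
  let ?B = "?\<phi> ` stalk (N, P) E" and ?m = "?\<phi> ` stalk_max (N, P) E"
  interpret dvr ?B ?m t "loc n {0}"
    unfolding MZ.phi_stalk by (rule MZ.hypersurface_dvr[OF Eh]) (use t in \<open>simp_all add: MZ.phi_stalk\<close>)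
  obtain eF where eF: "\<forall>i\<le>N. F i \<in> forms n eF" using rational_map_forms[OF dominantD(1)[OF dF]] by blast
  have chiF: "MZ.chi (to_fract f / to_fract h) = to_fract (subst F f) / to_fract (subst F h) \<and>
     subst F f \<in> forms n (d * eF) \<and> subst F h \<in> forms n (d * eF) \<and> subst F h \<notin> H"
    if "f \<in> forms N d" "h \<in> forms N d" "h \<notin> E" for f h d
  proof -
    have "h \<notin> P" using that(3) Ep by (auto simp: points_def)
    then show ?thesis
      using field_pull_eq[OF P dF that(1,2)] subst_forms[OF that(1), of F n eF] subst_forms[OF that(2), of F n eF] eF
        dominantD(2)[OF dFE that(2)] that(3) by (auto simp: MZ.chi_def)
  qed
  have sub: "?B \<subseteq> loc n H"
  proof
    fix x assume "x \<in> ?B"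
    then obtain a where a: "a \<in> loc N E" "x = MZ.chi a" unfolding MZ.phi_stalk by blast
    from a(1) obtain f h d where "a = to_fract f / to_fract h" "f \<in> forms N d" "h \<in> forms N d" "h \<notin> E" by (rule locE)
    then show "x \<in> loc n H" using chiF[of f d h] a(2) by (auto intro: locI)
  qed
  have subm: "?m \<subseteq> locm n H"
  proof
    fix x assume "x \<in> ?m"
    then obtain a where a: "a \<in> locm N E" "x = MZ.chi a" unfolding MZ.phi_stalk by blast
    from a(1) obtain f h d where f: "a = to_fract f / to_fract h" "f \<in> forms N d" "h \<in> forms N d" "h \<notin> E" "f \<in> E" by (rule locmE)
    have "subst F f \<in> H" by (rule rational_map_in[OF dominantD(1)[OF dFE] f(5)])
    then show "x \<in> locm n H" using chiF[OF f(2-4)] a(2) f(1) by (auto intro: locmI)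
  qed
  have BH: "loc n H = ?B" "locm n H = ?m"
    using dominating_eq[OF loc_subset_K[OF H] sub subm locm_mult[OF H] one_notin_locm[OF H] locm_subset[OF H]] by blast+
  \<comment> \<open>The local ring of \<open>Z\<close> at \<open>E\<close> has become the local ring of $P^n$ at \<open>H\<close>, where the frame $x/x_j$ is available.\<close>
  have Qp: "Q \<in> points (Xn n)" using im by (simp add: image_point_def)
  then have Qpp: "Q \<in> proj_points n" by (simp add: points_def)
  obtain i where i: "i \<le> n" "Var i \<notin> Q" using pp_Var[OF Qpp] by blast
  obtain j where j: "j \<le> n" "Var j \<notin> H" using pp_Var[OF H] by blast
  have affnz: "aff a b \<noteq> (0 :: 'k mpol fract)" for a b by (simp add: aff_def)
  have D0': "wronsk n D0 (aff a) \<noteq> (0 :: 'k mpol fract)" if "a \<le> n" for a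
    using wronsk_aff_change[of 0 n a D0] that D0 affnz by simp
  have stQ: "?\<chi> ` stalk (Xn n) Q = loc n Q"
  proof -
    have "MY.chi a = a" if "a \<in> loc n Q" for a
      using \<phi>0 loc_subset_K[OF Qpp] that by (auto simp: MY.chi_def rat_fun_space)
    then show ?thesis unfolding MY.phi_stalk by force
  qed
  define \<gamma> \<alpha> \<eta> where "\<gamma> = ?\<chi> g0" and "\<alpha> = (\<lambda>j. ?\<chi> (a0 j))" and "\<eta> = ?\<chi> hY"
  have \<gamma>K: "\<gamma> \<in> loc n {0}" and \<eta>K: "\<eta> \<in> loc n {0}" using KY(1) g0 hY by (simp_all add: \<gamma>_def \<eta>_def)
  have \<alpha>K: "\<alpha> j \<in> loc n {0}" if "j < n" for j using KY(1)[OF a0'[OF that]] by (simp add: \<alpha>_def)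
  obtain b where b: "b \<in> loc n Q - locm n Q"
    "\<And>D. Dtuple n D \<Longrightarrow> \<gamma> * jac n D \<alpha> = \<eta> * b * wronsk n D (aff i)"
    using MY.local_equation_wronsk[OF Qp Qpp stQ i leY g0 a0' D0(1) D0'[OF i(1)]]
    unfolding \<gamma>_def \<alpha>_def \<eta>_def by blast
  obtain b2 where b2: "b2 \<in> loc n H - locm n H"
    "\<And>D. Dtuple n D \<Longrightarrow> ?\<phi> (pullback (N, P) (Xn n) \<pi> g0) * jac n D (\<lambda>j. ?\<phi> (pullback (N, P) (Xn n) \<pi> (a0 j)))
       = ?\<phi> hZ * b2 * wronsk n D (aff j)"
    using MZ.local_equation_wronsk[OF Ep H BH(1)[symmetric] j leZ pull_Z(1)[OF g0] pull_Z(1)[OF a0'] D0(1) D0'[OF j(1)]] by blast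
  obtain c h where ch: "c \<noteq> 0" "h \<in> loc n {0}" "h \<noteq> 0"
    "\<And>D. Dtuple n D \<Longrightarrow> wronsk n D (\<lambda>k. pull n \<psi> (aff 0 k)) = to_fract (Const c) * h\<^sup>2 * wronsk n D (aff 0)"
    using square_jac\<psi> unfolding square_jac_def by blast
  \<comment> \<open>The local equation on the target is evaluated at the transported derivations, the one on \<open>Z\<close> at \<open>D0\<close>.\<close>
  let ?D = "\<lambda>j. conj_der n \<psi> \<theta> (D0 j)"
  note D' = conj_Dtuple[OF inv\<psi> D0(1)]
  have bK: "b \<in> loc n {0}" using b(1) loc_subset_K[OF Qpp] by blast
  have affK: "aff a k \<in> loc n {0}" if "a \<le> n" "k \<le> n" for a k using that by (rule aff_K)
  define A where "A = pull n \<psi> (aff i 0)"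
  have AK: "A \<in> loc n {0}" unfolding A_def by (rule pull_closed[OF d\<psi> affK]) (use i in auto)
  have A0: "A \<noteq> 0" unfolding A_def by (rule pull_nonzero[OF d\<psi> affK]) (use i affnz in auto)
  let ?w = "wronsk n D0 (aff j)"
  have wi: "pull n \<psi> (wronsk n ?D (aff i)) = A ^ Suc n * (to_fract (Const c) * h\<^sup>2 * (aff 0 j ^ Suc n * ?w))"
  proof -
    have "pull n \<psi> (wronsk n ?D (aff i)) = wronsk n D0 (\<lambda>k. pull n \<psi> (aff i k))"
      by (rule pull_wronsk[OF inv\<psi> D0(1) affK[OF i(1)]])
    also have "\<dots> = wronsk n D0 (\<lambda>k. A * pull n \<psi> (aff 0 k))"
    proof (rule wronsk_cong)
      fix k assume "k \<le> n"
      then show "pull n \<psi> (aff i k) = A * pull n \<psi> (aff 0 k)"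
        unfolding A_def aff_change[of i k 0] using i by (intro pull_mult[OF d\<psi>] affK) auto
    qed
    also have "\<dots> = A ^ Suc n * wronsk n D0 (\<lambda>k. pull n \<psi> (aff 0 k))"
      using D0(1) AK by (rule wronsk_mult) (intro pull_closed[OF d\<psi>] affK, auto)
    also have "wronsk n D0 (\<lambda>k. pull n \<psi> (aff 0 k)) = to_fract (Const c) * h\<^sup>2 * (aff 0 j ^ Suc n * ?w)"
      unfolding ch(4)[OF D0(1)] using wronsk_aff_change[OF j(1) _ D0(1), of 0] by simp
    finally show ?thesis .
  qed
  have "?\<phi> hZ * b2 * ?w = pull n \<psi> \<gamma> * jac n D0 (\<lambda>j. pull n \<psi> (\<alpha> j))"
  proof -
    have "jac n D0 (\<lambda>j. ?\<phi> (pullback (N, P) (Xn n) \<pi> (a0 j))) = jac n D0 (\<lambda>j. pull n \<psi> (\<alpha> j))"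
      by (rule jac_cong) (simp add: pull_Z(2)[OF a0'] \<alpha>_def)
    then show ?thesis using b2(2)[OF D0(1)] pull_Z(2)[OF g0] by (simp add: \<gamma>_def)
  qed
  also have "\<dots> = pull n \<psi> (\<gamma> * jac n ?D \<alpha>)"
  proof -
    have "jac n ?D \<alpha> \<in> loc n {0}"
      unfolding MY.jac_wronsk[OF D'] using \<alpha>K sr_1[OF K_subring] by (intro wronsk_K[OF D']) (auto split: nat.split)
    then show ?thesis
      using pull_mult[OF d\<psi> \<gamma>K] pull_jac[OF inv\<psi> D0(1) \<alpha>K] by simp
  qed
  also have "\<dots> = pull n \<psi> (\<eta> * b * wronsk n ?D (aff i))" by (simp only: b(2)[OF D'])
  also have "\<dots> = pull n \<psi> \<eta> * pull n \<psi> b * pull n \<psi> (wronsk n ?D (aff i))"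
    using pull_mult[OF d\<psi> sr_mult[OF K_subring \<eta>K bK] wronsk_K[OF D' affK[OF i(1)]]] pull_mult[OF d\<psi> \<eta>K bK] by simp
  finally have eq: "?\<phi> hZ * b2 = pull n \<psi> \<eta> * pull n \<psi> b * (A ^ Suc n * (to_fract (Const c) * h\<^sup>2 * aff 0 j ^ Suc n))"
    using D0'[OF j(1)] unfolding wi by (simp add: mult_ac)
  \<comment> \<open>All factors in \<open>eq\<close> other than the local equations are units at \<open>H\<close>, or $h^2$, or powers of exponent $n + 1$, which is even.\<close>
  define s where "s = h * (A * aff 0 j) ^ (Suc n div 2)"
  have s2: "s\<^sup>2 = A ^ Suc n * (h\<^sup>2 * aff 0 j ^ Suc n)"
  proof -
    have "2 dvd Suc n" using odd by simp
    then have e: "Suc n div 2 * 2 = Suc n" by (rule dvd_div_mult_self)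
    have "s\<^sup>2 = h\<^sup>2 * (A * aff 0 j) ^ (Suc n div 2 * 2)" unfolding s_def by (simp only: power_mult_distrib power_mult)
    then show ?thesis unfolding e power_mult_distrib by (simp only: mult_ac)
  qed
  have sK: "s \<in> loc n {0}" unfolding s_def using j
    by (intro sr_mult[OF K_subring] sr_power[OF K_subring] ch(2) AK affK) auto
  have s0: "s \<noteq> 0" unfolding s_def using ch(3) A0 affnz by simp
  \<comment> \<open>The unit \<open>b\<close> at \<open>Q\<close> pulls back to a unit at \<open>H\<close>: $\psi = \pi F$ maps \<open>H\<close> to \<open>Q\<close>, as \<open>F\<close> maps \<open>H\<close> to \<open>E\<close> and $\pi$ maps \<open>E\<close> to \<open>Q\<close>.\<close>
  have pbb: "pull n \<psi> b \<in> ?B - ?m"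
  proof -
    from im obtain \<pi>' where \<pi>': "same_map (N, P) (Xn n) \<pi> \<pi>'"
      "\<And>d f. f \<in> forms n d \<Longrightarrow> f \<in> Q \<longleftrightarrow> subst \<pi>' f \<in> E"
      unfolding image_point_def fst_conv by blast
    obtain e where e: "\<forall>i\<le>n. \<pi>' i \<in> forms N e" using rational_map_forms[OF same_mapD(2)[OF \<pi>'(1)]] by blast
    obtain f f' d where f: "b = to_fract f / to_fract f'" "f \<in> forms n d" "f' \<in> forms n d" "f' \<notin> Q"
      using b(1) by (elim DiffE locE)
    have "f \<notin> Q" using b(1) f fract_in_locm_iff[OF Qpp f(2-4)] by simp
    then have nE: "subst \<pi>' f \<notin> E" "subst \<pi>' f' \<notin> E" using \<pi>'(2)[OF f(2)] \<pi>'(2)[OF f(3)] f(4) by simp_all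
    have fo: "subst \<pi>' f \<in> forms N (d * e)" "subst \<pi>' f' \<in> forms N (d * e)" using f e by (auto intro!: subst_forms)
    have f'0: "f' \<noteq> 0" using f(4) pp_zero[OF Qpp] by auto
    have "pull n \<psi> b = to_fract (subst F (subst \<pi>' f)) / to_fract (subst F (subst \<pi>' f'))"
      unfolding f(1) by (rule pull\<psi>[OF \<pi>'(1) f(2,3) f'0])
    moreover note chiF[OF fo nE(2)]
    moreover have "subst F (subst \<pi>' f) \<notin> H" using dominantD(2)[OF dFE fo(1)] nE(1) by blast
    ultimately have "pull n \<psi> b \<in> loc n H - locm n H"
      using fract_in_locm_iff[OF H] by (auto intro: locI)
    then show ?thesis by (simp only: BH)
  qed
  have cU: "to_fract (Const c) \<in> ?B - ?m"
  proof -
    have "Const c \<notin> H"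
    proof
      assume "Const c \<in> H"
      then have "Const c * Const (inverse c) \<in> H" by (rule pp_mult[OF H]) simp
      then show False using ch(1) pp_one[OF H] by (simp flip: Const_mult)
    qed
    then have "to_fract (Const c) \<notin> locm n H"
      using fract_in_locm_iff[OF H Const_forms[of c] one_forms pp_one[OF H]] by simp
    then have "to_fract (Const c) \<in> loc n H - locm n H" using loc_Const[OF H] by simp
    then show ?thesis by (simp only: BH)
  qed
  have b2U: "b2 \<in> ?B - ?m" using b2(1) by (simp only: BH)
  have unitI: "x \<in> ?B - ?m" if x: "x \<in> ?\<phi> ` (stalk (N, P) E - stalk_max (N, P) E)" for x
  proof -
    obtain y where y: "y \<in> stalk (N, P) E" "y \<notin> stalk_max (N, P) E" "x = ?\<phi> y" using x by blast
    have "x \<notin> ?m"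
    proof
      assume "x \<in> ?m"
      then obtain z where z: "z \<in> stalk_max (N, P) E" "x = ?\<phi> z" by blast
      have "stalk_max (N, P) E \<subseteq> stalk (N, P) E"
        unfolding stalk_def stalk_max_def using locm_subset[OF Epp] by (auto simp: ps_local_max_eq)
      then have "y = z" using MZ.phi_inj[of y z] MZ.stalk_carrier[OF Ep] y z by blast
      then show False using y z by simp
    qed
    then show ?thesis using y by blast
  qed
  have uU: "u \<in> ?B - ?m" and u2U: "u2 \<in> ?B - ?m" using unitI[OF u(1)] unitI[OF u2(1)] .
  obtain a where a: "a \<in> ?B - ?m" "t2 = a * t" using other_uniformizer[OF t2] by blast
  have "pull n \<psi> \<eta> = u2 * a powi l * t powi l"
    using u2(2) pull_Z(2)[OF hY] by (simp add: \<eta>_def a(2) power_int_mult_distrib mult_ac)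
  then have "u * t powi k * b2 = (u2 * a powi l * t powi l) * pull n \<psi> b * to_fract (Const c) * s\<^sup>2"
    using eq u(2) unfolding s2 by (simp add: mult_ac)
  moreover define v where "v = u2 * a powi l * pull n \<psi> b * to_fract (Const c)"
  ultimately have "u * b2 * t powi k = v * t powi l * s\<^sup>2" by (simp add: mult_ac)
  moreover have vU: "v \<in> ?B - ?m"
    unfolding v_def by (intro unit_mult unit_powi u2U a(1) pbb cU)
  ultimately have "(u * b2 * inverse v) * t powi (k - l) = s\<^sup>2"
    using t(2) unit_nonzero[OF vU] by (simp add: power_int_diff field_simps)
  moreover have "u * b2 * inverse v \<in> ?B - ?m" by (intro unit_mult unit_inverse uU b2U vU)
  ultimately have "even (k - l)" using square_even[OF _ sK s0] by blast
  then show ?thesis by (simp add: mkl)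
qed

end
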